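(* Let $\phi\in\mathbf{B}$ and, for $f\in C_c(\mathbb{Z}_+)$, let $\mathbb{L}_\phi f(n)=\mathbb{G}_\phi f(n)+n\,\partial_-f(n)$. (1) The operator $(\mathbb{L}_\phi,C_c(\mathbb{Z}_+))$ generates a Feller Markov semigroup on $C_0(\mathbb{Z}_+)$, denoted by $\mathbb{K}^\phi=(\mathbb{K}^\phi_t)_{t\ge0}$. (2) For every $f\in C_0(\mathbb{Z}_+)$ and $t\ge0$, $\mathbb{K}^\phi_tf=\mathbb{Q}^\phi_{e^t-1}\mathbb{D}_{e^{-t}}f$. (3) The semigroup $\mathbb{K}^\phi$ has a unique invariant distribution $\mathbf{n}_\phi$, and $\mathbf{n}_\phi(n)>0$ for all $n\in\mathbb{Z}_+$. Moreover, $\mathbf{n}_\phi$ has moments of all orders and is moment determinate. (4) The semigroup $\mathbb{K}^\phi$ is self-adjoint in $\ell^2(\mathbf{n}_\phi)$ if and only if $\phi(u)=m+\sigma^2u$ for some $m,\sigma^2\ge0$.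
   Context: $\mathbb{Z}_+=\{0,1,2,\dots\}$; $C_0(\mathbb{Z}_+)$ and $C_c(\mathbb{Z}_+)$ denote functions on $\mathbb{Z}_+$ vanishing at infinity, respectively finitely supported. $\mathbf{B}$ is the class of all functions $\phi(u)=m+\sigma^2u+\int_0^\infty(1-e^{-uy})\overline{\Pi}(y)\,dy$, $u\ge 0$, where $m,\sigma^2\ge 0$, $\Pi$ is a nonnegative measure on $(0,\infty)$ with $\int_0^\infty (y\wedge y^2)\,\Pi(dy)<\infty$, and $\overline{\Pi}(y)=\Pi((y,\infty))$. $\mathbb{D}_\alpha f(n)=\sum_{r=0}^n\binom{n}{r}\alpha^r(1-\alpha)^{n-r}f(r)$; $\partial_\pm f(n)=f(n\pm1)-f(n)$ (with $n\partial_-f(n)=0$ at $n=0$); and for $f\in C_c(\mathbb{Z}_+)$ $$\mathbb{G}_\phi f(n)=\sigma^2 n(\partial_++\partial_-)f(n)+(m+\sigma^2)\partial_+f(n)+\frac{1}{n+1}\int_0^\infty\left[\mathbb{D}_{e^{-y}}f(n+1)-f(n+1)+y(n+1)\partial_+f(n)\right]\Pi(dy).$$ $\mathbb{Q}^\phi$ is the Feller semigroup on $C_0(\mathbb{Z}_+)$ generated by $\mathbb{G}_\phi$, for which $C_c(\mathbb{Z}_+)$ is a core. $\ell^2(\mathbf{n}_\phi)$ is the weighted Hilbert space with inner product $\langle f,g\rangle_{\mathbf{n}_\phi}=\sum_nf(n)g(n)\mathbf{n}_\phi(n)$; $\mathbb{K}^\phi$ extends to a contraction semigroup on it. Moment determinate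 means uniquely determined among probability measures by its moments.
   Formalization: Positivity of the invariant distribution at every n is claimed only when φ is not identically zero; for φ ≡ 0, which the definition of B allows, the semigroup is a pure death process with invariant law δ₀, so that claim fails. *)

theory Defs
  imports "HOL-Probability.Probability"
begin

section \<open>Function spaces on the nonnegative integers\<close>

definition C0 :: "(nat \<Rightarrow> real) set" where
  "C0 = {f. f \<longlonglongrightarrow> 0}"

definition Cc :: "(nat \<Rightarrow> real) set" where
  "Cc = {f. finite {n. f n \<noteq> 0}}"


section \<open>Feller semigroups and their generators\<close>

text \<open>
  A family of operators on \<open>C0\<close> is a function \<open>P :: real \<Rightarrow> (nat \<Rightarrow> real) \<Rightarrow> nat \<Rightarrow> real\<close>;
  only its values at \<open>t \<ge> 0\<close> and at arguments in \<open>C0\<close> are meaningful.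
  Convergence in the supremum norm is \<open>uniform_limit\<close> on \<open>UNIV\<close>.
\<close>

definition feller_semigroup :: "(real \<Rightarrow> (nat \<Rightarrow> real) \<Rightarrow> nat \<Rightarrow> real) \<Rightarrow> bool" where
  "feller_semigroup P \<longleftrightarrow>
     (\<forall>t\<ge>0. \<forall>f\<in>C0. P t f \<in> C0) \<and>
     (\<forall>t\<ge>0. \<forall>f\<in>C0. \<forall>g\<in>C0. \<forall>a b.
        P t (\<lambda>n. a * f n + b * g n) = (\<lambda>n. a * P t f n + b * P t g n)) \<and>
     (\<forall>t\<ge>0. \<forall>f\<in>C0. (\<forall>n. 0 \<le> f n \<and> f n \<le> 1) \<longrightarrow> (\<forall>n. 0 \<le> P t f n \<and> P t f n \<le> 1)) \<and>
     (\<forall>f\<in>C0. P 0 f = f) \<and>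
     (\<forall>s\<ge>0. \<forall>t\<ge>0. \<forall>f\<in>C0. P (s + t) f = P s (P t f)) \<and>
     (\<forall>f\<in>C0. uniform_limit UNIV (\<lambda>t. P t f) f (at_right 0))"

text \<open>
  The constant function 1 is not in \<open>C0\<close>, so conservativeness \<open>P\<^sub>t 1 = 1\<close> is expressed through the
  transition probabilities \<open>p\<^sub>t(n,k) = P\<^sub>t 1\<^bsub>{k}\<^esub>(n)\<close>, which are required to sum to 1 over \<open>k\<close>.
\<close>

definition feller_markov_semigroup :: "(real \<Rightarrow> (nat \<Rightarrow> real) \<Rightarrow> nat \<Rightarrow> real) \<Rightarrow> bool" where
  "feller_markov_semigroup P \<longleftrightarrow>
     feller_semigroup P \<and> (\<forall>t\<ge>0. \<forall>n. (\<lambda>k. P t (indicator {k}) n) sums 1)"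

text \<open>The generator, as a graph in \<open>C0 \<times> C0\<close>.\<close>

definition generator ::
    "(real \<Rightarrow> (nat \<Rightarrow> real) \<Rightarrow> nat \<Rightarrow> real) \<Rightarrow> ((nat \<Rightarrow> real) \<times> (nat \<Rightarrow> real)) set" where
  "generator P = {(f, g). f \<in> C0 \<and> g \<in> C0 \<and>
     uniform_limit UNIV (\<lambda>t n. (P t f n - f n) / t) g (at_right 0)}"

text \<open>
  \<open>(A, D)\<close> generates \<open>P\<close> if the generator of \<open>P\<close> extends \<open>A\<close> on \<open>D\<close> and is the closure of its
  restriction to \<open>D\<close>, i.e. \<open>D\<close> is a core.
\<close>

definition generates ::
    "((nat \<Rightarrow> real) \<Rightarrow> nat \<Rightarrow> real) \<Rightarrow> (nat \<Rightarrow> real) set \<Rightarrow>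
     (real \<Rightarrow> (nat \<Rightarrow> real) \<Rightarrow> nat \<Rightarrow> real) \<Rightarrow> bool" where
  "generates A D P \<longleftrightarrow>
     (\<forall>f\<in>D. (f, A f) \<in> generator P) \<and>
     (\<forall>(f, g)\<in>generator P. \<exists>F. (\<forall>k. F k \<in> D) \<and>
        uniform_limit UNIV F f sequentially \<and>
        uniform_limit UNIV (\<lambda>k. A (F k)) g sequentially)"


section \<open>The class B and the operators\<close>

text \<open>
  \<open>bernstein_rep \<phi> m s2 \<mu>\<close> says that \<open>\<phi>\<close> belongs to the class B with characteristics
  \<open>m\<close>, \<open>\<sigma>\<^sup>2 = s2\<close> and measure \<open>\<Pi> = \<mu>\<close>. A measure on \<open>(0,\<infinity>)\<close> is encoded as a Borel measure on the real line that
  gives no mass to \<open>(-\<infinity>,0]\<close>. The tail \<open>\<mu>((y,\<infinity>))\<close> is finite for \<open>y > 0\<close> by the integrability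
  condition, so \<^const>\<open>measure\<close> loses nothing.
\<close>

definition bernstein_rep ::
    "(real \<Rightarrow> real) \<Rightarrow> real \<Rightarrow> real \<Rightarrow> real measure \<Rightarrow> bool" where
  "bernstein_rep \<phi> m s2 \<mu> \<longleftrightarrow>
     0 \<le> m \<and> 0 \<le> s2 \<and>
     sets \<mu> = sets borel \<and> emeasure \<mu> {..0} = 0 \<and>
     (\<integral>\<^sup>+ y. ennreal (min y (y\<^sup>2)) \<partial>\<mu>) < \<infinity> \<and>
     (\<forall>u\<ge>0. \<phi> u = m + s2 * u +
        (LINT y:{0<..}|lborel. (1 - exp (- (u * y))) * measure \<mu> {y<..}))"

definition dil :: "real \<Rightarrow> (nat \<Rightarrow> real) \<Rightarrow> nat \<Rightarrow> real" where
  "dil \<alpha> f n = (\<Sum>r=0..n. real (n choose r) * \<alpha> ^ r * (1 - \<alpha>) ^ (n - r) * f r)"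

definition dplus :: "(nat \<Rightarrow> real) \<Rightarrow> nat \<Rightarrow> real" where
  "dplus f n = f (n + 1) - f n"

text \<open>At \<open>n = 0\<close> the truncated subtraction gives the value 0.\<close>

definition dminus :: "(nat \<Rightarrow> real) \<Rightarrow> nat \<Rightarrow> real" where
  "dminus f n = f (n - 1) - f n"

definition GG :: "real \<Rightarrow> real \<Rightarrow> real measure \<Rightarrow> (nat \<Rightarrow> real) \<Rightarrow> nat \<Rightarrow> real" where
  "GG m s2 \<mu> f n =
     s2 * real n * (dplus f n + dminus f n) + (m + s2) * dplus f n +
     1 / real (n + 1) *
       (LINT y|\<mu>. dil (exp (- y)) f (n + 1) - f (n + 1) + y * real (n + 1) * dplus f n)"

definition LL :: "real \<Rightarrow> real \<Rightarrow> real measure \<Rightarrow> (nat \<Rightarrow> real) \<Rightarrow> nat \<Rightarrow> real" where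
  "LL m s2 \<mu> f n = GG m s2 \<mu> f n + real n * dminus f n"


section \<open>Invariant distributions and moments\<close>

definition invariant_distribution ::
    "(real \<Rightarrow> (nat \<Rightarrow> real) \<Rightarrow> nat \<Rightarrow> real) \<Rightarrow> nat pmf \<Rightarrow> bool" where
  "invariant_distribution P \<nu> \<longleftrightarrow>
     (\<forall>t\<ge>0. \<forall>f\<in>C0. measure_pmf.expectation \<nu> (P t f) = measure_pmf.expectation \<nu> f)"

definition has_all_moments :: "real measure \<Rightarrow> bool" where
  "has_all_moments M \<longleftrightarrow> (\<forall>k::nat. integrable M (\<lambda>x. x ^ k))"

definition moment_determinate :: "real measure \<Rightarrow> bool" where
  "moment_determinate M \<longleftrightarrow>
     (\<forall>N. prob_space N \<and> sets N = sets borel \<and> has_all_moments N \<and>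
        (\<forall>k::nat. (LINT x|N. x ^ k) = (LINT x|M. x ^ k)) \<longrightarrow> N = M)"


section \<open>The weighted Hilbert space\<close>

text \<open>
  Elements of the Hilbert space are represented by functions, two of which are identified when they
  agree on the support \<^term>\<open>set_pmf \<nu>\<close> of the weight (so not at all if the weight is everywhere positive).
\<close>

definition l2 :: "nat pmf \<Rightarrow> (nat \<Rightarrow> real) set" where
  "l2 \<nu> = {f. summable (\<lambda>n. (f n)\<^sup>2 * pmf \<nu> n)}"

definition l2_inner :: "nat pmf \<Rightarrow> (nat \<Rightarrow> real) \<Rightarrow> (nat \<Rightarrow> real) \<Rightarrow> real" where
  "l2_inner \<nu> f g = (\<Sum>n. f n * g n * pmf \<nu> n)"

definition l2_norm :: "nat pmf \<Rightarrow> (nat \<Rightarrow> real) \<Rightarrow> real" where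
  "l2_norm \<nu> f = sqrt (l2_inner \<nu> f f)"

text \<open>\<open>E\<close> is a (strongly continuous) contraction semigroup on \<open>l2 \<nu>\<close> that extends \<open>P\<close>.\<close>

definition l2_extension ::
    "nat pmf \<Rightarrow> (real \<Rightarrow> (nat \<Rightarrow> real) \<Rightarrow> nat \<Rightarrow> real) \<Rightarrow>
     (real \<Rightarrow> (nat \<Rightarrow> real) \<Rightarrow> nat \<Rightarrow> real) \<Rightarrow> bool" where
  "l2_extension \<nu> P E \<longleftrightarrow>
     (\<forall>t\<ge>0. \<forall>f\<in>l2 \<nu>. E t f \<in> l2 \<nu> \<and> l2_norm \<nu> (E t f) \<le> l2_norm \<nu> f) \<and>
     (\<forall>t\<ge>0. \<forall>f\<in>l2 \<nu>. \<forall>g\<in>l2 \<nu>. \<forall>a b. \<forall>n\<in>set_pmf \<nu>.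
        E t (\<lambda>k. a * f k + b * g k) n = a * E t f n + b * E t g n) \<and>
     (\<forall>f\<in>l2 \<nu>. \<forall>n\<in>set_pmf \<nu>. E 0 f n = f n) \<and>
     (\<forall>s\<ge>0. \<forall>t\<ge>0. \<forall>f\<in>l2 \<nu>. \<forall>n\<in>set_pmf \<nu>. E (s + t) f n = E s (E t f) n) \<and>
     (\<forall>f\<in>l2 \<nu>. ((\<lambda>t. l2_norm \<nu> (\<lambda>n. E t f n - f n)) \<longlongrightarrow> 0) (at_right 0)) \<and>
     (\<forall>t\<ge>0. \<forall>f\<in>C0. \<forall>n\<in>set_pmf \<nu>. E t f n = P t f n)"

text \<open>For operators defined and bounded on all of \<open>l2 \<nu>\<close>, being self-adjoint is the identity below.\<close>

definition l2_selfadjoint ::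
    "nat pmf \<Rightarrow> (real \<Rightarrow> (nat \<Rightarrow> real) \<Rightarrow> nat \<Rightarrow> real) \<Rightarrow> bool" where
  "l2_selfadjoint \<nu> E \<longleftrightarrow>
     (\<forall>t\<ge>0. \<forall>f\<in>l2 \<nu>. \<forall>g\<in>l2 \<nu>. l2_inner \<nu> (E t f) g = l2_inner \<nu> f (E t g))"

end

theory Submission
  imports Defs
begin

text \<open>
  On binomial coefficients, \<open>GG\<close> sends \<open>binom(x,k+1)\<close> to a multiple of \<open>binom(x,k)\<close>, the dilation \<open>D\<^sub>\<alpha>\<close>
  multiplies \<open>binom(x,k)\<close> by \<open>\<alpha>\<^sup>k\<close>, and \<open>n \<partial>\<^sub>-\<close> by \<open>-k\<close>. Hence \<open>GG D\<^sub>\<alpha> = \<alpha> D\<^sub>\<alpha> GG\<close> and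
  \<open>Q\<^sub>t D\<^sub>\<alpha> = D\<^sub>\<alpha> Q\<^bsub>\<alpha> t\<^esub>\<close>, which makes \<open>K\<^sub>t = Q\<^bsub>exp t - 1\<^esub> D\<^bsub>exp (-t)\<^esub>\<close> a semigroup and, in the form
  \<open>K\<^sub>t = D\<^bsub>exp (-t)\<^esub> Q\<^bsub>1 - exp (-t)\<^esub>\<close>, shows \<open>K\<^sub>t f \<longlongrightarrow> Q\<^sub>1 f 0\<close>: the invariant law is \<open>Q\<^sub>1(0, \<cdot>)\<close>.
  Both generators jump upwards by at most one and have linearly bounded variance; multiplication by the
  cutoffs \<open>(1 - n/N)\<^sup>+\<close> then shows that the finitely supported functions are a core of the maximal operator,
  so every generator is determined, and the same cutoffs give conservativeness.
  Symmetry of \<open>K\<close> forces detailed balance; since upward jumps of size two are impossible, downward ones are as well,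
  which kills the jump measure. Conversely a birth-death generator is in detailed balance with its invariant law.
\<close>

section \<open>Feller semigroups on the integers\<close>

text \<open>The relations on \<open>binom(x,k)\<close> cannot be used directly on a semigroup, since
  polynomials are not in \<open>C0\<close>. Two devices bridge the gap. Firstly, \<open>GG\<close>
  at \<open>n\<close> sees only the states up to \<open>n+1\<close>, on which every function is a
  finite combination of binomials; hence the commutation relations hold pointwise for all functions,
  without convergence questions. Secondly, they pass from generators to semigroups by uniqueness of
  the Cauchy problem \<open>u' = G u\<close>. This needs the candidate solution to lie in the domain
  of the generator, which can be checked because the generator is the maximal operator: a function
  of \<open>C0\<close> is in the domain as soon as its formal image is in \<open>C0\<close>. The
  factor in front of \<open>binom(x,k)\<close> in the image of \<open>binom(x,k+1)\<close> is
  \<phi>(k+1). It grows at most linearly, so the binomial moments of \<open>Q_1(0, .)\<close> grow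
  at most geometrically; this yields an exponential moment and with it moment determinacy.\<close>

lemma uniform_limit_right_iff:
  "uniform_limit UNIV F l (at_right (0::real)) \<longleftrightarrow>
    (\<forall>e>0. \<exists>d>0. \<forall>t. 0 < t \<and> t < d \<longrightarrow> (\<forall>n. \<bar>F t n - l n :: real\<bar> < e))"
  unfolding uniform_limit_iff eventually_at_right_field dist_real_def by (simp add: imp_conjL)

lemma uniform_limit_seq_iff:
  "uniform_limit UNIV F l sequentially \<longleftrightarrow>
    (\<forall>e>0. \<exists>N. \<forall>k\<ge>N. \<forall>n. \<bar>F k n - l n :: real\<bar> < e)"
  unfolding uniform_limit_iff eventually_sequentially dist_real_def by auto

lemma C0_combination: "f \<in> C0 \<Longrightarrow> g \<in> C0 \<Longrightarrow> (\<lambda>n. a * f n + b * g n) \<in> C0"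
  unfolding C0_def by (auto intro!: tendsto_eq_intros)

lemma C0_scale: "f \<in> C0 \<Longrightarrow> (\<lambda>n. a * f n) \<in> C0"
  unfolding C0_def by (auto intro!: tendsto_eq_intros)

lemma C0_divide: "f \<in> C0 \<Longrightarrow> (\<lambda>n. f n / a) \<in> C0"
  using C0_scale[of f "1/a"] by simp

lemma C0_add: "f \<in> C0 \<Longrightarrow> g \<in> C0 \<Longrightarrow> (\<lambda>n. f n + g n) \<in> C0"
  unfolding C0_def by (auto intro!: tendsto_eq_intros)

lemma C0_diff: "f \<in> C0 \<Longrightarrow> g \<in> C0 \<Longrightarrow> (\<lambda>n. f n - g n) \<in> C0"
  unfolding C0_def by (auto intro!: tendsto_eq_intros)

lemma C0_zero: "(\<lambda>n. 0) \<in> C0"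
  unfolding C0_def by auto

lemma C0_bounded:
  assumes "f \<in> C0" obtains B where "0 < B" "\<And>n. \<bar>f n\<bar> \<le> B"
proof -
  have "Bseq f" using assms unfolding C0_def by (auto intro: convergent_imp_Bseq convergentI)
  then show ?thesis using that by (auto simp: Bseq_def)
qed

lemma C0_iff: "f \<in> C0 \<longleftrightarrow> (\<forall>e>0. \<exists>N. \<forall>n\<ge>N. \<bar>f n\<bar> < e)"
  unfolding C0_def LIMSEQ_iff by simp

lemma C0_dominated:
  assumes "f \<in> C0" "\<And>n. \<bar>g n\<bar> \<le> \<bar>f n\<bar>" shows "g \<in> C0"
  using assms unfolding C0_iff by (meson le_less_trans)

lemma Cc_iff: "f \<in> Cc \<longleftrightarrow> (\<exists>N. \<forall>n\<ge>N. f n = 0)"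
proof
  assume "f \<in> Cc"
  then have "finite {n. f n \<noteq> 0}" by (simp add: Cc_def)
  then obtain N where "\<forall>n\<in>{n. f n \<noteq> 0}. n < N" using finite_nat_set_iff_bounded by blast
  then show "\<exists>N. \<forall>n\<ge>N. f n = 0" by (auto intro!: exI[of _ N])
next
  assume "\<exists>N. \<forall>n\<ge>N. f n = 0"
  then obtain N where "\<forall>n\<ge>N. f n = 0" by blast
  then have "{n. f n \<noteq> 0} \<subseteq> {..<N}" by (auto simp: not_le[symmetric])
  then show "f \<in> Cc" unfolding Cc_def using finite_subset by blast
qed

lemma Cc_subset_C0: "f \<in> Cc \<Longrightarrow> f \<in> C0"
  unfolding Cc_iff C0_iff by (metis abs_zero)

lemma Cc_mult: "f \<in> Cc \<Longrightarrow> (\<lambda>n. g n * f n) \<in> Cc" "f \<in> Cc \<Longrightarrow> (\<lambda>n. f n * g n) \<in> Cc"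
  unfolding Cc_iff by auto

lemma Cc_indicator: "finite S \<Longrightarrow> (indicator S :: nat \<Rightarrow> real) \<in> Cc"
  unfolding Cc_def mem_Collect_eq by (rule finite_subset[of _ S]) (auto simp: indicator_def)

lemma Cc_dense:
  assumes "f \<in> C0" "0 < e"
  obtains g where "g \<in> Cc" "\<And>n. \<bar>f n - g n\<bar> < e"
proof -
  obtain N where N: "\<And>n. n \<ge> N \<Longrightarrow> \<bar>f n\<bar> < e" using assms unfolding C0_iff by blast
  show ?thesis
  proof (rule that[of "\<lambda>n. indicator {..<N} n * f n"])
    show "(\<lambda>n. indicator {..<N} n * f n) \<in> Cc" by (intro Cc_mult Cc_indicator) auto
    show "\<bar>f n - indicator {..<N} n * f n\<bar> < e" for n
      using N[of n] assms by (auto simp: indicator_def)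
  qed
qed

section \<open>Order and norm bounds for a Feller semigroup\<close>

locale feller =
  fixes P :: "real \<Rightarrow> (nat \<Rightarrow> real) \<Rightarrow> nat \<Rightarrow> real"
  assumes feller_P: "feller_semigroup P"
begin

lemmas feller_unfolded = feller_P[unfolded feller_semigroup_def]

lemma closed: "0 \<le> t \<Longrightarrow> f \<in> C0 \<Longrightarrow> P t f \<in> C0"
  using feller_unfolded[THEN conjunct1] by simp

lemma combination: "0 \<le> t \<Longrightarrow> f \<in> C0 \<Longrightarrow> g \<in> C0 \<Longrightarrow>
    P t (\<lambda>n. a * f n + b * g n) k = a * P t f k + b * P t g k"
  using feller_unfolded[THEN conjunct2, THEN conjunct1] by simp

lemma unit_interval: "0 \<le> t \<Longrightarrow> f \<in> C0 \<Longrightarrow> (\<And>n. 0 \<le> f n \<and> f n \<le> 1) \<Longrightarrow> 0 \<le> P t f k \<and> P t f k \<le> 1"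
  using feller_unfolded[THEN conjunct2, THEN conjunct2, THEN conjunct1] by simp

lemma at_0: "f \<in> C0 \<Longrightarrow> P 0 f = f"
  using feller_unfolded[THEN conjunct2, THEN conjunct2, THEN conjunct2, THEN conjunct1] by simp

lemma semigroup: "0 \<le> s \<Longrightarrow> 0 \<le> t \<Longrightarrow> f \<in> C0 \<Longrightarrow> P (s + t) f = P s (P t f)"
  using feller_unfolded[THEN conjunct2, THEN conjunct2, THEN conjunct2, THEN conjunct2, THEN conjunct1] by simp

lemma uniform_limit_at_0: "f \<in> C0 \<Longrightarrow> uniform_limit UNIV (\<lambda>t. P t f) f (at_right 0)"
  using feller_unfolded[THEN conjunct2, THEN conjunct2, THEN conjunct2, THEN conjunct2, THEN conjunct2] by simp

lemma strongly_continuous: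
  assumes "f \<in> C0" "0 < e"
  obtains d where "0 < d" "\<And>t n. 0 \<le> t \<Longrightarrow> t < d \<Longrightarrow> \<bar>P t f n - f n\<bar> < e"
proof -
  have "\<exists>d>0. \<forall>t. 0 < t \<and> t < d \<longrightarrow> (\<forall>n. \<bar>P t f n - f n\<bar> < e)"
    using uniform_limit_at_0[OF assms(1)] assms(2) by (simp add: uniform_limit_right_iff)
  then obtain d where d: "d > 0" "\<And>t n. 0 < t \<Longrightarrow> t < d \<Longrightarrow> \<bar>P t f n - f n\<bar> < e"
    by blast
  have "\<bar>P t f n - f n\<bar> < e" if "0 \<le> t" "t < d" for t n
    using that d(2)[of t n] at_0[OF assms(1)] assms(2) by (cases "t = 0") auto
  with d(1) show ?thesis by (rule that)
qed

lemma scale: "0 \<le> t \<Longrightarrow> f \<in> C0 \<Longrightarrow> P t (\<lambda>n. a * f n) k = a * P t f k"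
  using combination[of t f f a 0] by simp

lemma diff: "0 \<le> t \<Longrightarrow> f \<in> C0 \<Longrightarrow> g \<in> C0 \<Longrightarrow> P t (\<lambda>n. f n - g n) k = P t f k - P t g k"
  using combination[of t f g 1 "-1"] by simp

lemma add: "0 \<le> t \<Longrightarrow> f \<in> C0 \<Longrightarrow> g \<in> C0 \<Longrightarrow> P t (\<lambda>n. f n + g n) k = P t f k + P t g k"
  using combination[of t f g 1 1] by simp

lemma divide: "0 \<le> t \<Longrightarrow> f \<in> C0 \<Longrightarrow> P t (\<lambda>n. f n / a) k = P t f k / a"
  using scale[of t f "1/a"] by simp

lemma sum:
  assumes "0 \<le> t" "finite S" "\<And>i. i \<in> S \<Longrightarrow> f i \<in> C0"
  shows "P t (\<lambda>n. \<Sum>i\<in>S. f i n) k = (\<Sum>i\<in>S. P t (f i) k) \<and> (\<lambda>n. \<Sum>i\<in>S. f i n) \<in> C0"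
  using assms(2,3)
proof (induction S)
  case empty
  then show ?case using combination[of t "\<lambda>_. 0" "\<lambda>_. 0" 0 0 k] assms(1) by (simp add: C0_zero)
next
  case (insert x S)
  then show ?case using add[of t "f x" "\<lambda>n. \<Sum>i\<in>S. f i n" k] assms(1) by (simp add: C0_add)
qed

lemma nonneg_bounds:
  assumes "0 \<le> t" "f \<in> C0" "\<And>n. 0 \<le> f n" "\<And>n. f n \<le> M" "0 < M"
  shows "0 \<le> P t f k" "P t f k \<le> M"
proof -
  have "0 \<le> P t (\<lambda>n. f n / M) k \<and> P t (\<lambda>n. f n / M) k \<le> 1"
    using assms by (intro unit_interval C0_divide) (auto simp: field_simps)
  then have *: "0 \<le> P t f k / M \<and> P t f k / M \<le> 1" using divide assms by simp
  then show "0 \<le> P t f k" "P t f k \<le> M" using assms(5) by (auto simp: field_simps zero_le_divide_iff)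
qed

lemma nonneg: "0 \<le> t \<Longrightarrow> f \<in> C0 \<Longrightarrow> (\<And>n. 0 \<le> f n) \<Longrightarrow> 0 \<le> P t f k"
  by (metis C0_bounded nonneg_bounds(1) abs_le_D1)

lemma mono: "0 \<le> t \<Longrightarrow> f \<in> C0 \<Longrightarrow> g \<in> C0 \<Longrightarrow> (\<And>n. f n \<le> g n) \<Longrightarrow> P t f k \<le> P t g k"
  using nonneg[of t "\<lambda>n. g n - f n" k] diff[of t g f k] by (simp add: C0_diff)

lemma upper_bound:
  assumes "0 \<le> t" "f \<in> C0" "\<And>n. f n \<le> M" "0 \<le> M"
  shows "P t f k \<le> M"
proof (cases "M = 0")
  case True
  then show ?thesis using mono[of t f "\<lambda>_. 0 * (0::real)" k] scale[of t "\<lambda>_. 0" 0 k] assms C0_zero by simp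
next
  case False
  \<comment> \<open>The constant \<open>M\<close> is not in \<open>C0\<close>, so
    \<open>mono\<close> cannot compare \<open>f\<close> with it; the positive part of
    \<open>f\<close> is in \<open>C0\<close> and lies between 0 and \<open>M\<close>.\<close>
  let ?g = "\<lambda>n. max 0 (f n)"
  have g: "?g \<in> C0" by (rule C0_dominated[OF assms(2)]) auto
  have "P t f k \<le> P t ?g k" using assms g by (intro mono) auto
  also have "\<dots> \<le> M" using assms g False by (intro nonneg_bounds) auto
  finally show ?thesis .
qed

lemma lower_bound:
  assumes "0 \<le> t" "f \<in> C0" "\<And>n. - M \<le> f n" "0 \<le> M"
  shows "- M \<le> P t f k"
proof -
  have "P t (\<lambda>n. -1 * f n) k \<le> M"
    using assms by (intro upper_bound C0_scale) (auto simp: minus_le_iff)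
  then show ?thesis using scale[OF assms(1,2), of "-1" k] by simp
qed

lemma contraction:
  assumes "0 \<le> t" "f \<in> C0" "\<And>n. \<bar>f n\<bar> \<le> M"
  shows "\<bar>P t f k\<bar> \<le> M"
proof -
  have "0 \<le> M" using assms(3)[of 0] by simp
  moreover have "f n \<le> M" "- M \<le> f n" for n using assms(3)[of n] by auto
  ultimately show ?thesis using upper_bound[OF assms(1,2)] lower_bound[OF assms(1,2)] by (metis abs_leI minus_le_iff)
qed

lemma contraction_diff:
  assumes "0 \<le> t" "f \<in> C0" "g \<in> C0" "\<And>n. \<bar>f n - g n\<bar> \<le> M"
  shows "\<bar>P t f k - P t g k\<bar> \<le> M"
  using contraction[of t "\<lambda>n. f n - g n" M k] diff[of t f g k] assms by (simp add: C0_diff)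

section \<open>Generators, differentiability of orbits and the Cauchy problem\<close>

lemma generatorE:
  assumes "(f, g) \<in> generator P" "0 < e"
  obtains d where "0 < d" "\<And>t n. 0 < t \<Longrightarrow> t < d \<Longrightarrow> \<bar>(P t f n - f n) / t - g n\<bar> < e"
  using assms unfolding generator_def uniform_limit_right_iff by auto

lemma generator_C0: "(f, g) \<in> generator P \<Longrightarrow> f \<in> C0" "(f, g) \<in> generator P \<Longrightarrow> g \<in> C0"
  unfolding generator_def by auto

lemma generator_invariant:
  assumes "(f, g) \<in> generator P" "0 \<le> s"
  shows "(P s f, P s g) \<in> generator P"
proof -
  note C = generator_C0[OF assms(1)]
  have "\<exists>d>0. \<forall>t. 0 < t \<and> t < d \<longrightarrow> (\<forall>n. \<bar>(P t (P s f) n - P s f n) / t - P s g n\<bar> < e)" if e: "0 < e" for e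
  proof -
    obtain d where d: "0 < d" "\<And>t n. 0 < t \<Longrightarrow> t < d \<Longrightarrow> \<bar>(P t f n - f n) / t - g n\<bar> < e/2"
      using generatorE[OF assms(1), of "e/2"] half_gt_zero[OF e] by blast
    have "\<bar>(P t (P s f) n - P s f n) / t - P s g n\<bar> < e" if t: "0 < t" "t < d" for t n
    proof -
      have "P t (P s f) = P s (P t f)" using semigroup[of t s f] semigroup[of s t f] C t assms(2) by (simp add: add.commute)
      then have "(P t (P s f) n - P s f n) / t = P s (\<lambda>n. (P t f n - f n) / t) n"
        using t C assms(2) by (simp add: divide diff C0_diff closed)
      moreover have "\<bar>P s (\<lambda>n. (P t f n - f n) / t) n - P s g n\<bar> \<le> e/2"
        using d(2)[OF t] t C assms(2) by (intro contraction_diff C0_divide C0_diff closed) (auto intro: less_imp_le)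
      ultimately show ?thesis using e by simp
    qed
    then show ?thesis using d(1) by blast
  qed
  then show ?thesis
    using C assms(2) closed unfolding generator_def uniform_limit_right_iff by auto
qed

text \<open>One \<open>d\<close> serves all \<open>n\<close>, all base points \<open>r\<close> and
  both directions. A forward quotient at \<open>r\<close> is \<open>P r\<close> applied to the
  quotient at time 0, so contraction makes it uniform; a backward quotient is a forward one based at
  the earlier time, corrected by strong continuity of the orbit of \<open>g\<close>.\<close>

lemma uniform_derivative:
  assumes "(f, g) \<in> generator P" "0 < e"
  obtains d where "0 < d"
    "\<And>r y n. 0 \<le> r \<Longrightarrow> 0 \<le> y \<Longrightarrow> y \<noteq> r \<Longrightarrow> \<bar>y - r\<bar> < d \<Longrightarrow> \<bar>(P y f n - P r f n) / (y - r) - P r g n\<bar> < e"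
proof -
  note C = generator_C0[OF assms(1)]
  obtain d1 where d1: "0 < d1" "\<And>t n. 0 < t \<Longrightarrow> t < d1 \<Longrightarrow> \<bar>(P t f n - f n) / t - g n\<bar> < e/4"
    using generatorE[OF assms(1), of "e/4"] assms(2) by auto
  obtain d2 where d2: "0 < d2" "\<And>t n. 0 \<le> t \<Longrightarrow> t < d2 \<Longrightarrow> \<bar>P t g n - g n\<bar> < e/4"
    using strongly_continuous[OF C(2), of "e/4"] assms(2) by auto
  have fwd: "\<bar>(P (a + h) f n - P a f n) / h - P a g n\<bar> \<le> e/4" if "0 \<le> a" "0 < h" "h < d1" for a h n
  proof -
    have "(P (a + h) f n - P a f n) / h = P a (\<lambda>n. (P h f n - f n) / h) n"
      using that C by (simp add: divide diff C0_diff closed semigroup)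
    moreover have "\<bar>P a (\<lambda>n. (P h f n - f n) / h) n - P a g n\<bar> \<le> e/4"
      using d1(2)[OF that(2,3)] that C by (intro contraction_diff C0_divide C0_diff closed) (auto intro: less_imp_le)
    ultimately show ?thesis by simp
  qed
  have con: "\<bar>P (a + h) g n - P a g n\<bar> \<le> e/4" if "0 \<le> a" "0 < h" "h < d2" for a h n
    using contraction_diff[of a "P h g" g "e/4" n] that C d2(2)[of h] semigroup[of a h g]
    by (simp add: closed less_imp_le)
  show ?thesis
  proof (rule that[of "min d1 d2"])
    show "0 < min d1 d2" using d1 d2 by simp
    fix r y n assume H: "0 \<le> r" "0 \<le> (y::real)" "y \<noteq> r" "\<bar>y - r\<bar> < min d1 d2"
    show "\<bar>(P y f n - P r f n) / (y - r) - P r g n\<bar> < e"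
    proof (cases "r < y")
      case True
      then show ?thesis using fwd[of r "y - r" n] H assms(2) by auto
    next
      case False
      have "\<bar>(P r f n - P y f n) / (r - y) - P y g n\<bar> \<le> e/4" using fwd[of y "r - y" n] H False by auto
      moreover have "\<bar>P r g n - P y g n\<bar> \<le> e/4" using con[of y "r - y" n] H False by auto
      moreover have "(P y f n - P r f n) / (y - r) = (P r f n - P y f n) / (r - y)"
        by (metis minus_diff_eq minus_divide_divide)
      ultimately show ?thesis using assms(2) by linarith
    qed
  qed
qed

lemma has_derivative_orbit:
  assumes "(f, g) \<in> generator P" "0 \<le> r"
  shows "((\<lambda>s. P s f n) has_real_derivative P r g n) (at r within {0..})"
  unfolding has_field_derivative_iff LIM_def tendsto_iff eventually_at
proof (intro allI impI)
  fix e :: real assume "0 < e"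
  obtain d where "0 < d" "\<And>y. 0 \<le> y \<Longrightarrow> y \<noteq> r \<Longrightarrow> \<bar>y - r\<bar> < d \<Longrightarrow> \<bar>(P y f n - P r f n) / (y - r) - P r g n\<bar> < e"
    using uniform_derivative[OF assms(1) \<open>0 < e\<close>] assms(2) by metis
  then show "\<exists>d>0. \<forall>x\<in>{0..}. x \<noteq> r \<and> dist x r < d \<longrightarrow> dist ((P x f n - P r f n) / (x - r)) (P r g n) < e"
    by (auto simp: dist_real_def)
qed

lemma continuous_orbit:
  assumes "f \<in> C0" "0 \<le> r"
  shows "((\<lambda>s. P s f n) \<longlongrightarrow> P r f n) (at r within {0..})"
  unfolding tendsto_iff eventually_at
proof (intro allI impI)
  fix e :: real assume "0 < e"
  obtain d where d: "0 < d" "\<And>t n. 0 \<le> t \<Longrightarrow> t < d \<Longrightarrow> \<bar>P t f n - f n\<bar> < e/2"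
    using strongly_continuous[OF assms(1), of "e/2"] \<open>0 < e\<close> by auto
  have *: "\<bar>P (a + h) f n - P a f n\<bar> \<le> e/2" if "0 \<le> a" "0 \<le> h" "h < d" for a h
    using contraction_diff[of a "P h f" f "e/2" n] that assms d(2)[of h] semigroup[of a h f]
    by (simp add: closed less_imp_le)
  have "dist (P x f n) (P r f n) < e" if "0 \<le> x" "dist x r < d" for x
  proof (cases "x \<le> r")
    case True
    then have "\<bar>P r f n - P x f n\<bar> \<le> e/2" using *[of x "r - x"] that by (simp add: dist_real_def del: le_divide_eq_numeral1)
    then show ?thesis using \<open>0 < e\<close> unfolding dist_real_def by linarith
  next
    case False
    then have "\<bar>P x f n - P r f n\<bar> \<le> e/2" using *[of r "x - r"] that assms by (simp add: dist_real_def del: le_divide_eq_numeral1)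
    then show ?thesis using \<open>0 < e\<close> unfolding dist_real_def by linarith
  qed
  then show "\<exists>d>0. \<forall>x\<in>{0..}. x \<noteq> r \<and> dist x r < d \<longrightarrow> dist (P x f n) (P r f n) < e"
    using d(1) by auto
qed

text \<open>Stands in for the formula \<open>P t f = f +\<close> integral of \<open>P s g\<close>:
  the mean value theorem gives a one-sided estimate at each \<open>n\<close> without integrating the
  orbit in time.\<close>

lemma increment_bound:
  assumes "(f, g) \<in> generator P" "0 \<le> t" "\<And>s. 0 \<le> s \<Longrightarrow> s \<le> t \<Longrightarrow> a \<le> P s g n"
  shows "P t f n \<ge> f n + a * t"
proof (cases "t = 0")
  case True then show ?thesis using at_0 generator_C0[OF assms(1)] by simp
next
  case False
  have "\<exists>z\<in>{0<..<t}. P t f n - P 0 f n = (t - 0) * P z g n"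
  proof -
    have "\<exists>z\<in>{0<..<t}. P t f n - P 0 f n = (\<lambda>x. P z g n * x) (t - 0)"
    proof (rule mvt_simple)
      show "0 < t" using False assms by simp
      fix x assume "0 \<le> x" "x \<le> t"
      then have "((\<lambda>s. P s f n) has_real_derivative P x g n) (at x within {0..t})"
        by (intro DERIV_subset[OF has_derivative_orbit[OF assms(1)]]) auto
      then show "((\<lambda>s. P s f n) has_derivative (\<lambda>y. P x g n * y)) (at x within {0..t})"
        by (simp add: has_field_derivative_def)
    qed
    then show ?thesis by (simp add: mult.commute)
  qed
  then obtain z where z: "z \<in> {0<..<t}" "P t f n - P 0 f n = t * P z g n" by auto
  have "a * t \<le> t * P z g n" using assms(2) assms(3)[of z] z(1) by (simp add: mult.commute mult_right_mono)
  then show ?thesis using z(2) at_0 generator_C0[OF assms(1)] by simp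
qed

lemma generator_scale:
  assumes "(f, g) \<in> generator P"
  shows "((\<lambda>n. a * f n), (\<lambda>n. a * g n)) \<in> generator P"
proof -
  note C = generator_C0[OF assms(1)]
  have "uniform_limit UNIV (\<lambda>t n. a * ((P t f n - f n) / t)) (\<lambda>n. a * g n) (at_right 0)"
    using assms unfolding generator_def by (auto intro!: uniform_limit_intros simp del: times_divide_eq_right)
  moreover have "\<forall>\<^sub>F t in at_right 0. \<forall>n\<in>UNIV. a * ((P t f n - f n) / t) = (P t (\<lambda>n. a * f n) n - a * f n) / t"
    using eventually_at_right_less by eventually_elim (simp add: scale C right_diff_distrib)
  ultimately have "uniform_limit UNIV (\<lambda>t n. (P t (\<lambda>n. a * f n) n - a * f n) / t) (\<lambda>n. a * g n) (at_right 0)"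
    by (subst (asm) uniform_limit_cong) auto
  then show ?thesis using C by (simp add: generator_def C0_scale)
qed

text \<open>The increment of \<open>F k\<close> over \<open>[0,t]\<close> is within
  \<open>t * (e/2 + y)\<close> of \<open>t * g n\<close>, by \<open>increment_bound\<close> applied
  to \<open>F k\<close> and to its negative. Only \<open>y\<close> depends on the quality of the
  approximation, so it can be sent to 0 while \<open>t\<close> stays fixed.\<close>

lemma generator_closed:
  assumes F: "\<And>k. (F k, G k) \<in> generator P"
    and lim: "uniform_limit UNIV F f sequentially" "uniform_limit UNIV G g sequentially"
    and C: "f \<in> C0" "g \<in> C0"
  shows "(f, g) \<in> generator P"
proof -
  have "\<exists>d>0. \<forall>t. 0 < t \<and> t < d \<longrightarrow> (\<forall>n. \<bar>(P t f n - f n) / t - g n\<bar> < e)" if e: "0 < e" for e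
  proof -
    obtain d where d: "0 < d" "\<And>t n. 0 \<le> t \<Longrightarrow> t < d \<Longrightarrow> \<bar>P t g n - g n\<bar> < e/2"
      using strongly_continuous[OF C(2), of "e/2"] e by auto
    have "\<bar>(P t f n - f n) / t - g n\<bar> < e" if t: "0 < t" "t < d" for t n
    proof -
      have "\<bar>P t f n - f n - t * g n\<bar> \<le> t * (e/2) + z" if z: "0 < z" for z
      proof -
        \<comment> \<open>The error is \<open>t * y\<close> from approximating \<open>g\<close> and
          \<open>2 * y\<close> from approximating \<open>f\<close> at the times 0 and
          \<open>t\<close>; the denominator is large enough to fit it into \<open>z\<close>.\<close>
        define y where "y = z / (2 + 3 * t)"
        have yz: "y * (2 + 3 * t) = z" using z t by (simp add: y_def)
        have z': "0 < y" using z t by (simp add: y_def)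
        obtain k1 where k1: "\<And>k n. k \<ge> k1 \<Longrightarrow> \<bar>F k n - f n\<bar> < y"
          using lim(1) z' unfolding uniform_limit_seq_iff by meson
        obtain k2 where k2: "\<And>k n. k \<ge> k2 \<Longrightarrow> \<bar>G k n - g n\<bar> < y"
          using lim(2) z' unfolding uniform_limit_seq_iff by meson
        define k where "k = max k1 k2"
        have kf: "\<bar>F k n - f n\<bar> < y" and kg: "\<bar>G k n - g n\<bar> < y" for n
          using k1[of k] k2[of k] by (auto simp: k_def)
        note Ck = generator_C0[OF F[of k]]
        have near: "\<bar>P s (G k) n - g n\<bar> \<le> e/2 + y" if "0 \<le> s" "s \<le> t" for s
          using contraction_diff[of s "G k" g "y" n] kg d(2)[of s n] that t Ck C
          by (smt (verit))
        have lo: "P t (F k) n \<ge> F k n + (g n - (e/2 + y)) * t"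
        proof (rule increment_bound[OF F])
          fix s assume "0 \<le> s" "s \<le> t"
          then show "g n - (e/2 + y) \<le> P s (G k) n" using near[of s] by linarith
        qed (use t in auto)
        have "P t (\<lambda>n. -1 * F k n) n \<ge> -1 * F k n + (- g n - (e/2 + y)) * t"
        proof (rule increment_bound[OF generator_scale[OF F]])
          fix s assume "0 \<le> s" "s \<le> t"
          then show "- g n - (e/2 + y) \<le> P s (\<lambda>n. -1 * G k n) n"
            using near[of s] scale[of s "G k" "-1" n] Ck by linarith
        qed (use t in auto)
        then have hi: "P t (F k) n \<le> F k n + (g n + (e/2 + y)) * t"
          using scale[of t "F k" "-1" n] Ck t by (simp add: algebra_simps)
        have "\<bar>P t (F k) n - F k n - t * g n\<bar> \<le> t * (e/2 + y)"
          using lo hi by (simp add: algebra_simps abs_le_iff)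
        moreover have "\<bar>P t (F k) n - P t f n\<bar> \<le> y"
          using kf t Ck C by (intro contraction_diff) (auto intro: less_imp_le)
        ultimately have "\<bar>P t f n - f n - t * g n\<bar> \<le> t * (e/2 + y) + 2 * y"
          using kf[of n] by linarith
        also have "\<dots> \<le> t * (e/2) + y * (2 + 3 * t)" using z' t by (simp add: algebra_simps)
        also have "\<dots> = t * (e/2) + z" by (simp only: yz)
        finally show ?thesis .
      qed
      then have "\<bar>P t f n - f n - t * g n\<bar> \<le> t * (e/2)" by (rule field_le_epsilon)
      then have "\<bar>(P t f n - f n - t * g n) / t\<bar> \<le> e/2" using t by (simp add: abs_divide field_simps)
      moreover have "(P t f n - f n - t * g n) / t = (P t f n - f n) / t - g n" using t by (simp add: field_simps)
      ultimately show ?thesis using e by simp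
    qed
    then show ?thesis using d(1) by blast
  qed
  then show ?thesis using C unfolding generator_def uniform_limit_right_iff by auto
qed

text \<open>As a function of \<open>s\<close>, \<open>P (t - s) (u s) n\<close> has derivative 0 on
  \<open>[0,t]\<close> and joins \<open>P t (u 0) n\<close> to \<open>u t n\<close>.
  Differentiability of \<open>u\<close> is asked uniformly in \<open>n\<close> because the quotients
  are fed into \<open>P (t - y)\<close>, which is controlled in the sup norm only.\<close>

lemma cauchy_problem_unique:
  assumes gen: "\<And>s. 0 \<le> s \<Longrightarrow> (u s, v s) \<in> generator P"
    and der: "\<And>s e. 0 \<le> s \<Longrightarrow> 0 < e \<Longrightarrow>
      \<exists>d>0. \<forall>y\<ge>0. y \<noteq> s \<and> \<bar>y - s\<bar> < d \<longrightarrow> (\<forall>n. \<bar>(u y n - u s n) / (y - s) - v s n\<bar> < e)"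
    and t: "0 \<le> t"
  shows "u t = P t (u 0)"
proof
  fix n
  note C = generator_C0[OF gen]
  have "((\<lambda>s. P (t - s) (u s) n) has_real_derivative 0) (at s within {0..t})" if s: "s \<in> {0..t}" for s
  proof -
    have s0: "0 \<le> s" "s \<le> t" using s by auto
    \<comment> \<open>Product rule: \<open>u\<close> moves from \<open>s\<close> to \<open>y\<close>
      with the semigroup held at \<open>t - y\<close>, then the semigroup moves with
      \<open>u\<close> held at \<open>s\<close>. The two limits cancel.\<close>
    have 1: "((\<lambda>y. P (t - y) (\<lambda>k. (u y k - u s k) / (y - s)) n) \<longlongrightarrow> P (t - s) (v s) n) (at s within {0..t})"
      unfolding tendsto_iff eventually_at
    proof (intro allI impI)
      fix e :: real assume e: "0 < e"
      obtain d1 where d1: "0 < d1" "\<And>y n. 0 \<le> y \<Longrightarrow> y \<noteq> s \<Longrightarrow> \<bar>y - s\<bar> < d1 \<Longrightarrow> \<bar>(u y n - u s n) / (y - s) - v s n\<bar> < e/2"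
        using der[OF s0(1), of "e/2"] e by auto
      obtain d2 where d2: "0 < d2" "\<And>x. x \<ge> 0 \<Longrightarrow> x \<noteq> t - s \<and> dist x (t - s) < d2 \<Longrightarrow> dist (P x (v s) n) (P (t - s) (v s) n) < e/2"
        using continuous_orbit[OF C(2)[OF s0(1)], of "t - s" n] s0 e unfolding tendsto_iff eventually_at
        by (metis atLeast_iff diff_ge_0_iff_ge half_gt_zero)
      have "dist (P (t - y) (\<lambda>k. (u y k - u s k) / (y - s)) n) (P (t - s) (v s) n) < e"
        if y: "y \<in> {0..t}" "y \<noteq> s" "dist y s < min d1 d2" for y
      proof -
        have "\<bar>P (t - y) (\<lambda>k. (u y k - u s k) / (y - s)) n - P (t - y) (v s) n\<bar> \<le> e/2"
          using y d1(2)[of y] s0 C by (intro contraction_diff C0_divide C0_diff) (auto simp: dist_real_def intro: less_imp_le)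
        moreover have "dist (P (t - y) (v s) n) (P (t - s) (v s) n) < e/2"
          using y by (intro d2(2)) (auto simp: dist_real_def)
        ultimately show ?thesis unfolding dist_real_def by linarith
      qed
      then show "\<exists>d>0. \<forall>x\<in>{0..t}. x \<noteq> s \<and> dist x s < d \<longrightarrow>
          dist (P (t - x) (\<lambda>k. (u x k - u s k) / (x - s)) n) (P (t - s) (v s) n) < e"
        using d1(1) d2(1) by (metis min_less_iff_conj)
    qed
    have 2: "((\<lambda>y. P (t - y) (u s) n) has_real_derivative P (t - s) (v s) n * (0 - 1)) (at s within {0..t})"
    proof -
      have "((\<lambda>r. P r (u s) n) has_real_derivative P (t - s) (v s) n) (at (t - s) within (\<lambda>y. t - y) ` {0..t})"
        using s0 by (intro DERIV_subset[OF has_derivative_orbit[OF gen[OF s0(1)]]]) auto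
      moreover have "((\<lambda>y. t - y) has_real_derivative 0 - 1) (at s within {0..t})"
        by (intro derivative_intros)
      ultimately show ?thesis
        using DERIV_image_chain[of "\<lambda>r. P r (u s) n" "P (t - s) (v s) n" "\<lambda>y. t - y" s "{0..t}" "0 - 1"]
        by (simp add: o_def)
    qed
    have "((\<lambda>y. (P (t - y) (u s) n - P (t - s) (u s) n) / (y - s)) \<longlongrightarrow> - P (t - s) (v s) n) (at s within {0..t})"
      using 2 by (simp add: has_field_derivative_iff)
    from tendsto_add[OF 1 this]
    have "((\<lambda>y. P (t - y) (\<lambda>k. (u y k - u s k) / (y - s)) n + (P (t - y) (u s) n - P (t - s) (u s) n) / (y - s)) \<longlongrightarrow> 0) (at s within {0..t})"
      by simp
    moreover have "\<forall>\<^sub>F y in at s within {0..t}. P (t - y) (\<lambda>k. (u y k - u s k) / (y - s)) n + (P (t - y) (u s) n - P (t - s) (u s) n) / (y - s)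
        = (P (t - y) (u y) n - P (t - s) (u s) n) / (y - s)"
      unfolding eventually_at_filter using s0 C
      by (auto simp: divide diff C0_diff diff_divide_distrib[symmetric] add_divide_distrib[symmetric] intro!: always_eventually)
    ultimately show ?thesis unfolding has_field_derivative_iff by (simp cong: tendsto_cong)
  qed
  then have "\<exists>c. \<forall>s\<in>{0..t}. P (t - s) (u s) n = c"
    by (intro has_field_derivative_zero_constant) auto
  then show "u t n = P t (u 0) n"
    using t at_0 C(1)[OF t] by (metis atLeastAtMost_iff diff_self diff_zero order_refl)
qed

lemma equal_if_on_Cc:
  assumes "feller R" "0 \<le> t" "\<And>f. f \<in> Cc \<Longrightarrow> P t f = R t f" "f \<in> C0"
  shows "P t f = R t f"
proof
  fix n
  interpret R: feller R by fact
  have "\<bar>P t f n - R t f n\<bar> \<le> 0 + e" if e: "0 < e" for e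
  proof -
    obtain g where g: "g \<in> Cc" "\<And>n. \<bar>f n - g n\<bar> < e/2" using Cc_dense[OF assms(4), of "e/2"] e by auto
    have "\<bar>P t f n - P t g n\<bar> \<le> e/2" "\<bar>R t f n - R t g n\<bar> \<le> e/2"
      using less_imp_le[OF g(2)] assms Cc_subset_C0[OF g(1)] by (auto intro!: contraction_diff R.contraction_diff simp del: le_divide_eq_numeral1)
    then show ?thesis using fun_cong[OF assms(3)[OF g(1)], of n] by linarith
  qed
  then have "\<bar>P t f n - R t f n\<bar> \<le> 0" by (rule field_le_epsilon)
  then show "P t f n = R t f n" by simp
qed

end

section \<open>Moment determinacy\<close>

lemma power_le_even_powers: "\<bar>x::real\<bar> ^ Suc k \<le> \<bar>x\<bar> ^ k + \<bar>x\<bar> ^ Suc (Suc k)"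
proof (cases "\<bar>x\<bar> \<le> 1")
  case True
  then have "\<bar>x\<bar> ^ Suc k \<le> \<bar>x\<bar> ^ k" by (intro power_decreasing) auto
  then show ?thesis by (smt (verit) zero_le_power abs_ge_zero)
next
  case False
  then have "\<bar>x\<bar> ^ Suc k \<le> \<bar>x\<bar> ^ Suc (Suc k)" by (intro power_increasing) auto
  then show ?thesis by (smt (verit) zero_le_power abs_ge_zero)
qed

text \<open>Even absolute moments are moments and transfer from \<open>M\<close> to
  \<open>N\<close>. An odd one is bounded by its two even neighbours; the extra factor
  \<open>k + 1\<close> from \<open>fact (k + 1)\<close> is at most \<open>2 ^ k\<close>, which
  doubles the base \<open>A\<close>.\<close>

lemma absolute_moments_from_moments:
  assumes MA: "\<And>k. (LINT x|M. \<bar>x\<bar> ^ k) \<le> B * A ^ k * fact k" and A: "1 \<le> A" and B: "0 \<le> B"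
    and N: "\<And>k. integrable N (\<lambda>x::real. x ^ k)" and eq: "\<And>k. (LINT x|N. x ^ k) = (LINT x|M. x ^ k)"
    and sets: "sets N = sets borel"
  shows "(LINT x|N. \<bar>x\<bar> ^ k) \<le> (2 * B * A) * (2 * A) ^ k * fact k"
proof -
  have even: "(LINT x|N. \<bar>x\<bar> ^ k) \<le> B * A ^ k * fact k" if "even k" for k
    using MA[of k] eq[of k] power_even_abs[OF that, where 'a = real] by simp
  have abs: "integrable N (\<lambda>x. \<bar>x\<bar> ^ k)" for k
    using integrable_norm[OF N[of k]] by (simp add: power_abs)
  show ?thesis
  proof (cases "even k")
    case True
    have "B * A ^ k * fact k \<le> (2 * B * A) * (2 * A) ^ k * fact k"
    proof (intro mult_right_mono mult_mono)
      have "B * 1 \<le> 2 * B * A" using A B by (intro mult_mono) auto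
      then show "B \<le> 2 * B * A" by simp
      show "A ^ k \<le> (2 * A) ^ k" using A by (intro power_mono) auto
    qed (use A B in auto)
    then show ?thesis using even[OF True] by linarith
  next
    case False
    then obtain j where j: "k = Suc j" "even j" by (metis even_Suc not0_implies_Suc even_zero)
    have "(LINT x|N. \<bar>x\<bar> ^ k) \<le> (LINT x|N. \<bar>x\<bar> ^ j + \<bar>x\<bar> ^ Suc (Suc j))"
      unfolding j by (intro integral_mono abs Bochner_Integration.integrable_add power_le_even_powers)
    also have "\<dots> = (LINT x|N. \<bar>x\<bar> ^ j) + (LINT x|N. \<bar>x\<bar> ^ Suc (Suc j))"
      by (intro Bochner_Integration.integral_add abs)
    also have "\<dots> \<le> B * A ^ j * fact j + B * A ^ Suc (Suc j) * fact (Suc (Suc j))"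
      using even[of j] even[of "Suc (Suc j)"] j by (intro add_mono) auto
    also have "\<dots> \<le> B * A ^ Suc (Suc j) * fact (Suc (Suc j)) + B * A ^ Suc (Suc j) * fact (Suc (Suc j))"
    proof (intro add_right_mono mult_mono)
      show "A ^ j \<le> A ^ Suc (Suc j)" using A by (intro power_increasing) auto
      show "fact j \<le> (fact (Suc (Suc j)) :: real)" by (intro fact_mono) auto
    qed (use A B in auto)
    also have "\<dots> = (2 * B * A) * A ^ k * (real (Suc k) * fact k)" unfolding j by simp
    also have "\<dots> \<le> (2 * B * A) * A ^ k * (2 ^ k * fact k)"
    proof (intro mult_left_mono mult_right_mono)
      have "Suc k \<le> 2 ^ k" using less_exp[of k] by (rule Suc_leI)
      then show "real (Suc k) \<le> 2 ^ k" by (metis of_nat_le_iff of_nat_numeral of_nat_power)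
    qed (use A B in auto)
    finally show ?thesis by (simp add: power_mult_distrib mult_ac)
  qed
qed

text \<open>The series of \<open>iexp (s * x)\<close> is integrated term by term. The admissible
  \<open>s\<close> depends on \<open>A\<close> only, not on \<open>t\<close> or \<open>k\<close>,
  and the result at \<open>t + s\<close> has the form of the coefficients at \<open>t\<close>, so
  the expansion can be iterated.\<close>

lemma iexp_moment_expansion:
  fixes M :: "real measure"
  assumes int: "\<And>k. integrable M (\<lambda>x::real. x ^ k)" and sets [measurable_cong]: "sets M = sets borel"
    and MA: "\<And>k. (LINT x|M. \<bar>x\<bar> ^ k) \<le> B * A ^ k * fact k" and A: "1 \<le> A" and B: "0 \<le> B"
    and s: "\<bar>s\<bar> * (2 * A) < 1"
  shows "(\<lambda>j. ((\<i> * of_real s) ^ j / fact j) * (LINT x|M. of_real x ^ (k + j) * iexp (t * x)))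
      sums (LINT x|M. of_real x ^ k * iexp ((t + s) * x))"
proof -
  define f where "f j x = ((\<i> * of_real s) ^ j / fact j) * (of_real x ^ (k + j) * iexp (t * x))" for j and x :: real
  have abs: "integrable M (\<lambda>x. \<bar>x\<bar> ^ k)" for k
    using integrable_norm[OF int[of k]] by (simp add: power_abs)
  have nrm: "norm (of_real x ^ p * iexp (t * x)) = \<bar>x\<bar> ^ p" for x p
    by (simp add: norm_mult norm_power)
  have base: "integrable M (\<lambda>x. of_real x ^ p * iexp (t * x))" for p
  proof (rule Bochner_Integration.integrable_bound[OF abs[of p]])
    show "AE x in M. norm (of_real x ^ p * iexp (t * x)) \<le> norm (\<bar>x\<bar> ^ p)"
      by (simp only: nrm) simp
  qed simp
  have intf: "integrable M (f j)" for j unfolding f_def by (intro integrable_mult_right base)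
  have nf: "norm (f j x) = \<bar>s\<bar> ^ j / fact j * \<bar>x\<bar> ^ (k + j)" for j x
    unfolding f_def norm_mult[of "_ / _"] nrm by (simp add: norm_divide norm_power norm_mult)
  have expsum: "(\<lambda>j. f j x) sums (of_real x ^ k * iexp ((t + s) * x))" for x
  proof -
    have "(\<lambda>j. (\<i> * of_real s * of_real x) ^ j /\<^sub>R fact j) sums exp (\<i> * of_real s * of_real x)"
      by (rule exp_converges)
    then have "(\<lambda>j. of_real x ^ k * iexp (t * x) * ((\<i> * of_real s * of_real x) ^ j /\<^sub>R fact j))
        sums (of_real x ^ k * iexp (t * x) * exp (\<i> * of_real s * of_real x))" by (rule sums_mult)
    moreover have "of_real x ^ k * iexp (t * x) * ((\<i> * of_real s * of_real x) ^ j /\<^sub>R fact j) = f j x" for j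
      unfolding f_def by (simp add: scaleR_conv_of_real power_add power_mult_distrib field_simps)
    moreover have "of_real x ^ k * iexp (t * x) * exp (\<i> * of_real s * of_real x) = of_real x ^ k * iexp ((t + s) * x)"
      by (simp add: exp_add[symmetric] algebra_simps)
    ultimately show ?thesis by (simp only:)
  qed
  have "(\<lambda>j. integral\<^sup>L M (f j)) sums (LINT x|M. (\<Sum>j. f j x))"
  proof (rule sums_integral[OF intf])
    show "AE x in M. summable (\<lambda>j. norm (f j x))"
    proof (intro always_eventually allI)
      fix x
      have "summable (\<lambda>j. \<bar>x\<bar> ^ k * ((\<bar>s\<bar> * \<bar>x\<bar>) ^ j /\<^sub>R fact j))"
        by (intro summable_mult summable_exp_generic)
      then show "summable (\<lambda>j. norm (f j x))"
        unfolding nf by (simp add: power_add power_mult_distrib field_simps)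
    qed
    show "summable (\<lambda>j. LINT x|M. norm (f j x))"
    proof (rule summable_comparison_test')
      show "summable (\<lambda>j. (B * (2 * A) ^ k * fact k) * (\<bar>s\<bar> * (2 * A)) ^ j)"
        using s A by (intro summable_mult summable_geometric) auto
      fix j :: nat
      have "norm (LINT x|M. norm (f j x)) = \<bar>s\<bar> ^ j / fact j * (LINT x|M. \<bar>x\<bar> ^ (k + j))"
        unfolding nf by simp
      also have "\<dots> \<le> \<bar>s\<bar> ^ j / fact j * (B * A ^ (k + j) * fact (k + j))"
        by (intro mult_left_mono MA) auto
      also have "fact (k + j) = (fact k * fact j * real ((k + j) choose k) :: real)"
        using binomial_fact_lemma[of k "k + j"] by (simp add: of_nat_mult[symmetric] fact_fact_dvd_fact) (metis of_nat_fact of_nat_mult)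
      also have "\<bar>s\<bar> ^ j / fact j * (B * A ^ (k + j) * (fact k * fact j * real ((k + j) choose k)))
          = \<bar>s\<bar> ^ j * (B * A ^ (k + j) * fact k) * real ((k + j) choose k)" by (simp add: field_simps)
      \<comment> \<open>The quotient of factorials is \<open>fact k\<close> times a binomial
        coefficient, which is at most \<open>2 ^ (k + j)\<close>; the ratio of the resulting
        geometric series is the quantity assumed to be below 1.\<close>
      also have "\<dots> \<le> \<bar>s\<bar> ^ j * (B * A ^ (k + j) * fact k) * 2 ^ (k + j)"
      proof (intro mult_left_mono)
        have "(k + j) choose k \<le> 2 ^ (k + j)"
          by (metis binomial_le_pow2)
        then show "real ((k + j) choose k) \<le> 2 ^ (k + j)" by (metis of_nat_le_iff of_nat_numeral of_nat_power)
      qed (use A B in auto)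
      also have "\<dots> = (B * (2 * A) ^ k * fact k) * (\<bar>s\<bar> * (2 * A)) ^ j"
        by (simp add: power_add power_mult_distrib mult_ac)
      finally show "norm (LINT x|M. norm (f j x)) \<le> (B * (2 * A) ^ k * fact k) * (\<bar>s\<bar> * (2 * A)) ^ j" .
    qed
  qed
  moreover have "(\<Sum>j. f j x) = of_real x ^ k * iexp ((t + s) * x)" for x
    using sums_unique[OF expsum[of x]] by simp
  moreover have "integral\<^sup>L M (f j) = ((\<i> * of_real s) ^ j / fact j) * (LINT x|M. of_real x ^ (k + j) * iexp (t * x))" for j
    unfolding f_def by simp
  ultimately show ?thesis by simp
qed

text \<open>The moments determine the characteristic function in steps of fixed length, by Taylor expansion at each node.\<close>

lemma moment_determinate_factorial_growth:
  assumes M: "prob_space M" "sets M = sets borel" and int: "\<And>k. integrable M (\<lambda>x::real. x ^ k)"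
    and MA: "\<And>k. (LINT x|M. \<bar>x\<bar> ^ k) \<le> B * A ^ k * fact k" and A: "1 \<le> A" and B: "0 \<le> B"
  shows "moment_determinate M"
  unfolding moment_determinate_def
proof (intro allI impI, elim conjE)
  fix N :: "real measure"
  assume N: "prob_space N" "sets N = sets borel" and hN: "has_all_moments N"
    and eq: "\<forall>k. (LINT x|N. x ^ k) = (LINT x|M. x ^ k)"
  have intN: "integrable N (\<lambda>x. x ^ k)" for k using hN by (simp add: has_all_moments_def)
  have NA: "(LINT x|N. \<bar>x\<bar> ^ k) \<le> (2 * B * A) * (2 * A) ^ k * fact k" for k
    by (rule absolute_moments_from_moments[OF MA A B intN eq[rule_format] N(2)])
  \<comment> \<open>\<open>C\<close> and \<open>D\<close> are the weaker constants, valid for both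
    measures, so that one step length serves both expansions.\<close>
  define C where "C = 2 * A"
  define D where "D = 2 * B * A"
  have CD: "1 \<le> C" "0 \<le> D" using A B by (auto simp: C_def D_def)
  have N': "(LINT x|N. \<bar>x\<bar> ^ k) \<le> D * C ^ k * fact k" for k using NA by (simp add: C_def D_def)
  have M': "(LINT x|M. \<bar>x\<bar> ^ k) \<le> D * C ^ k * fact k" for k
    using absolute_moments_from_moments[OF MA A B int refl M(2)] by (simp add: C_def D_def)
  \<comment> \<open>All weights \<open>x ^ k\<close> are carried along, since a step from
    \<open>t\<close> to \<open>t + s\<close> consumes the integrals at \<open>t\<close> for every
    higher exponent.\<close>
  define E where "E t \<longleftrightarrow> (\<forall>k. (LINT x|N. of_real x ^ k * iexp (t * x)) = (LINT x|M. of_real x ^ k * iexp (t * x)))" for t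
  have E0: "E 0"
  proof -
    have "(LINT x|L. complex_of_real x ^ k) = of_real (LINT x|L. x ^ k)" for k and L :: "real measure"
      unfolding of_real_power[symmetric] by (rule integral_complex_of_real)
    then show ?thesis using eq by (simp add: E_def)
  qed
  have step: "E (t + s)" if "E t" "\<bar>s\<bar> * (2 * C) < 1" for t s
    unfolding E_def
  proof
    fix k
    have "(\<lambda>j. ((\<i> * of_real s) ^ j / fact j) * (LINT x|N. of_real x ^ (k + j) * iexp (t * x)))
        sums (LINT x|N. of_real x ^ k * iexp ((t + s) * x))"
      by (rule iexp_moment_expansion[OF intN N(2) N' CD that(2)])
    moreover have "(LINT x|N. of_real x ^ (k + j) * iexp (t * x)) = (LINT x|M. of_real x ^ (k + j) * iexp (t * x))" for j
      using that(1) unfolding E_def by (rule spec)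
    ultimately have "(\<lambda>j. ((\<i> * of_real s) ^ j / fact j) * (LINT x|M. of_real x ^ (k + j) * iexp (t * x)))
        sums (LINT x|N. of_real x ^ k * iexp ((t + s) * x))" by (simp only:)
    then show "(LINT x|N. of_real x ^ k * iexp ((t + s) * x)) = (LINT x|M. of_real x ^ k * iexp ((t + s) * x))"
      by (rule sums_unique2) (rule iexp_moment_expansion[OF int M(2) M' CD that(2)])
  qed
  have "E t" for t
  proof -
    obtain n :: nat where n: "\<bar>t\<bar> * (2 * C) < n" using reals_Archimedean2 by blast
    have n0: "0 < real n" using n CD by (smt (verit) mult_nonneg_nonneg)
    have s: "\<bar>t / n\<bar> * (2 * C) < 1" using n n0 by (simp add: abs_divide field_simps)
    have "E (real i * (t / n))" for i
    proof (induction i)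
      case (Suc i)
      have "real (Suc i) * (t / n) = real i * (t / n) + t / n" by (simp add: distrib_right add_divide_distrib)
      then show ?case using step[OF Suc s] by (simp only:)
    qed (use E0 in simp)
    from this[of n] show ?thesis using n0 by simp
  qed
  then have "\<forall>k. (LINT x|N. of_real x ^ k * iexp (t * x)) = (LINT x|M. of_real x ^ k * iexp (t * x))" for t
    unfolding E_def .
  from this[THEN spec, of 0] have "char N = char M" unfolding char_def by (intro ext) simp
  moreover have "real_distribution N" "real_distribution M"
    using M N by (auto simp: real_distribution_def real_distribution_axioms_def)
  ultimately show "N = M" by (intro Levy_uniqueness)
qed

section \<open>Generators that move at most one step upwards\<close>

definition cut :: "nat \<Rightarrow> nat \<Rightarrow> real" where
  "cut N n = max 0 (1 - real n / real N)"

lemma cut_Cc: "0 < N \<Longrightarrow> cut N \<in> Cc"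
  unfolding Cc_iff cut_def by (auto intro!: exI[of _ N] simp: field_simps)

lemma cut_unit: "0 \<le> cut N n" "cut N n \<le> 1"
  unfolding cut_def by auto

text \<open>Seen from a state \<open>n\<close> beyond \<open>N\<close>, every chord has slope at
  most \<open>1/n\<close> in absolute value, not just \<open>1/N\<close>. This sharper denominator
  balances second moments growing like \<open>n + 1\<close>, uniformly in \<open>n\<close>.\<close>

lemma cut_lipschitz:
  assumes "0 < N"
  shows "\<bar>cut N k - cut N n\<bar> \<le> \<bar>real k - real n\<bar> / max (real n) (real N)"
proof (cases "n < N")
  case True
  then have "max (real n) (real N) = real N" by simp
  moreover have "\<bar>cut N k - cut N n\<bar> \<le> \<bar>(1 - real k / N) - (1 - real n / N)\<bar>" unfolding cut_def by linarith
  moreover have "\<bar>(1 - real k / N) - (1 - real n / N)\<bar> = \<bar>real k - real n\<bar> / N"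
    using assms by (simp add: diff_divide_distrib[symmetric] abs_minus_commute)
  ultimately show ?thesis by simp
next
  case False
  then have M: "max (real n) (real N) = real n" by simp
  have c: "cut N n = 0" using False assms by (simp add: cut_def)
  show ?thesis
  proof (cases "k < N")
    case True
    then have "cut N k = 1 - real k / N" using assms by (simp add: cut_def)
    also have "\<dots> \<le> 1 - real k / n" using False assms by (simp add: frac_le)
    also have "\<dots> = \<bar>real k - real n\<bar> / n" using False True assms by (simp add: field_simps)
    finally show ?thesis using c M cut_unit(1)[of N k] by simp
  next
    case F: False
    then have "cut N k = 0" using assms by (simp add: cut_def)
    then show ?thesis using c by simp
  qed
qed

text \<open>Gaps between integers are 0 or at least 1, so Lipschitz bounds are also quadratic bounds.\<close>

lemma gap_le_square: "\<bar>real k - real n\<bar> \<le> (real k - real n)\<^sup>2"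
proof (cases "k = n")
  case False
  then have "1 \<le> \<bar>real k - real n\<bar>" by linarith
  then show ?thesis using mult_right_mono[of 1 "\<bar>real k - real n\<bar>" "\<bar>real k - real n\<bar>"] by (simp add: power2_eq_square)
qed simp

text \<open>The quotient is at most 2 once \<open>N \<ge> 1\<close> and tends to 0 for each fixed
  \<open>n\<close>. The decay of \<open>a\<close> handles large \<open>n\<close>, the size of
  \<open>N\<close> the finitely many others.\<close>

lemma vanishing_weight:
  assumes "a \<in> C0" "0 < (e::real)"
  shows "\<exists>N0. \<forall>N\<ge>N0. \<forall>n. \<bar>a n\<bar> * ((real n + 1) / max (real n) (real N)) < e"
proof -
  obtain B where B: "0 < B" "\<And>n. \<bar>a n\<bar> \<le> B" using C0_bounded[OF assms(1)] by blast
  obtain n0 where n0: "\<And>n. n \<ge> n0 \<Longrightarrow> \<bar>a n\<bar> < e / 2"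
    using assms half_gt_zero[OF assms(2)] unfolding C0_iff by blast
  obtain N0 :: nat where N0: "real N0 > B * (n0 + 1) / e" using reals_Archimedean2 by blast
  have "\<bar>a n\<bar> * ((real n + 1) / max (real n) (real N)) < e" if N: "N \<ge> max 1 N0" for N n
  proof (cases "n \<ge> n0")
    case True
    have "(real n + 1) / max (real n) (real N) \<le> 2"
      using N by (auto simp: divide_le_eq max_def)
    then have "\<bar>a n\<bar> * ((real n + 1) / max (real n) (real N)) \<le> \<bar>a n\<bar> * 2" by (intro mult_left_mono) auto
    also have "\<dots> < e" using n0[OF True] by linarith
    finally show ?thesis .
  next
    case False
    have "\<bar>a n\<bar> * ((real n + 1) / max (real n) (real N)) \<le> B * ((real n0 + 1) / real N)"
      using B N False by (intro mult_mono frac_le) auto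
    also have "\<dots> < e"
    proof -
      have "B * (n0 + 1) / e < real N" using N N0 by linarith
      then show ?thesis using N assms(2) by (simp add: field_simps)
    qed
    finally show ?thesis .
  qed
  then show ?thesis by blast
qed

text \<open>\<open>s n\<close> is the steepest slope of a chord of \<open>f\<close> starting at
  \<open>n\<close>. For large \<open>n\<close>, the other endpoint either has a small value of
  \<open>f\<close> or is so far away that the distance wins; hence the slopes vanish at
  infinity.\<close>

lemma C0_slope:
  assumes f: "f \<in> C0"
  obtains s where "s \<in> C0" "\<And>n k. \<bar>f k - f n\<bar> \<le> s n * \<bar>real k - real n\<bar>"
proof -
  obtain B where B: "0 < B" "\<And>n. \<bar>f n\<bar> \<le> B" using C0_bounded[OF f] by blast
  define r where "r n k = \<bar>f k - f n\<bar> / \<bar>real k - real n\<bar>" for n k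
  define s where "s n = (SUP k. r n k)" for n
  have le2: "\<bar>f k - f n\<bar> \<le> 2 * B" for n k using B(2)[of n] B(2)[of k] by linarith
  have rB: "r n k \<le> 2 * B" for n k
  proof (cases "k = n")
    case True then show ?thesis using B by (simp add: r_def)
  next
    case False
    then have "1 \<le> \<bar>real k - real n\<bar>" by linarith
    then have "r n k \<le> \<bar>f k - f n\<bar> / 1" unfolding r_def by (intro divide_left_mono) auto
    then show ?thesis using le2[of k n] by simp
  qed
  then have bdd: "bdd_above (range (r n))" for n by (auto simp: bdd_above_def)
  have rs: "r n k \<le> s n" for n k unfolding s_def by (rule cSUP_upper[OF _ bdd]) simp
  have s0: "0 \<le> s n" for n using rs[of n n] by (simp add: r_def)
  show ?thesis
  proof (rule that[of s])
    show "\<bar>f k - f n\<bar> \<le> s n * \<bar>real k - real n\<bar>" for n k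
      using rs[of n k] by (cases "k = n") (auto simp: r_def field_simps)
    show "s \<in> C0" unfolding C0_iff
    proof (intro allI impI)
      fix e :: real assume e: "0 < e"
      obtain n1 where n1: "\<And>n. n \<ge> n1 \<Longrightarrow> \<bar>f n\<bar> < e / 4"
        using f e unfolding C0_iff by (metis zero_less_divide_iff zero_less_numeral)
      \<comment> \<open>\<open>R\<close> is a distance at which the crude bound \<open>2 * B\<close>
        on a difference of values amounts to a slope below \<open>e / 2\<close>.\<close>
      obtain R :: nat where R: "4 * B / e < R" using reals_Archimedean2 by blast
      have "s n \<le> e / 2" if n: "n \<ge> n1 + R" for n
        unfolding s_def
      proof (rule cSUP_least)
        fix k :: nat
        show "r n k \<le> e / 2"
        proof (cases "k = n")
          case True then show ?thesis using e by (simp add: r_def)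
        next
          case False
          then have 1: "1 \<le> \<bar>real k - real n\<bar>" by linarith
          show ?thesis
          proof (cases "k \<ge> n1")
            case True
            have "\<bar>f k - f n\<bar> \<le> e / 2 * 1" using n1[OF True] n1[of n] n by linarith
            also have "\<dots> \<le> e / 2 * \<bar>real k - real n\<bar>" using 1 e by (intro mult_left_mono) auto
            finally show ?thesis using 1 by (simp add: r_def divide_le_eq)
          next
            case F: False
            then have "4 * B / e \<le> \<bar>real k - real n\<bar>" using n R by linarith
            then have "2 * B \<le> e / 2 * \<bar>real k - real n\<bar>" using e by (simp add: field_simps)
            then have "\<bar>f k - f n\<bar> \<le> e / 2 * \<bar>real k - real n\<bar>" using le2[of k n] by linarith
            then show ?thesis using 1 by (simp add: r_def divide_le_eq)
          qed
        qed
      qed simp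
      then have "\<bar>s n\<bar> < e" if "n \<ge> n1 + R" for n using that s0[of n] e by fastforce
      then show "\<exists>N. \<forall>n\<ge>N. \<bar>s n\<bar> < e" by blast
    qed
  qed
qed

text \<open>What is used of \<open>GG\<close> and \<open>LL\<close>, on arbitrary functions:
  \<open>local\<close> makes \<open>A\<close> meaningful without growth conditions.
  \<open>minimum\<close> is the positive maximum principle, stated at a zero of a nonnegative
  function; \<open>drift\<close> and \<open>second_moment\<close> bound the infinitesimal moments of
  the displacement from \<open>n\<close>.\<close>

locale rate_op =
  fixes A :: "(nat \<Rightarrow> real) \<Rightarrow> nat \<Rightarrow> real" and b c :: real
  assumes lin: "A (\<lambda>x. r * f x + s * g x) n = r * A f n + s * A g n"
    and local: "(\<And>k. k \<le> n + 1 \<Longrightarrow> f k = g k) \<Longrightarrow> A f n = A g n"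
    and minimum: "(\<And>k. 0 \<le> f k) \<Longrightarrow> f n = 0 \<Longrightarrow> 0 \<le> A f n"
    and const: "A (\<lambda>x. 1) n = 0"
    and drift: "A real n \<le> b"
    and second_moment: "A (\<lambda>x. (real x - real n)\<^sup>2) n \<le> c * (real n + 1)"
    and b_nonneg: "0 \<le> b" and c_nonneg: "0 \<le> c"
begin

lemma op_add: "A (\<lambda>x. f x + g x) n = A f n + A g n"
  using lin[of 1 f 1 g n] by simp

lemma op_diff: "A (\<lambda>x. f x - g x) n = A f n - A g n"
  using lin[of 1 f "-1" g n] by simp

lemma op_scale: "A (\<lambda>x. r * f x) n = r * A f n"
  using lin[of r f 0 f n] by simp

lemma op_constant: "A (\<lambda>x. r) n = 0"
  using op_scale[of r "\<lambda>x. 1" n] const by simp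

lemma op_sum: "finite S \<Longrightarrow> A (\<lambda>x. \<Sum>i\<in>S. a i * f i x) n = (\<Sum>i\<in>S. a i * A (f i) n)"
  by (induction S rule: finite_induct) (simp_all add: op_constant op_add op_scale)

lemma op_mono: "(\<And>k. f k \<le> g k) \<Longrightarrow> f n = g n \<Longrightarrow> A f n \<le> A g n"
  using minimum[of "\<lambda>x. g x - f x" n] op_diff[of g f n] by simp

text \<open>Both \<open>f\<close> and its negative lie below the parabola and touch it at
  \<open>n\<close>, so \<open>op_mono\<close> compares them there.\<close>

lemma square_bound:
  assumes "\<And>k. \<bar>f k\<bar> \<le> K * (real k - real n)\<^sup>2"
  shows "\<bar>A f n\<bar> \<le> K * c * (real n + 1)"
proof -
  have K: "0 \<le> K" using assms[of "n+1"] by simp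
  have f0: "f n = 0" using assms[of n] by simp
  have "A f n \<le> A (\<lambda>x. K * (real x - real n)\<^sup>2) n"
    using assms f0 by (intro op_mono) (auto simp: abs_le_iff)
  moreover have "A (\<lambda>x. -1 * f x) n \<le> A (\<lambda>x. K * (real x - real n)\<^sup>2) n"
    using assms f0 by (intro op_mono) (auto simp: abs_le_iff)
  ultimately have "\<bar>A f n\<bar> \<le> K * A (\<lambda>x. (real x - real n)\<^sup>2) n" unfolding op_scale by auto
  also have "\<dots> \<le> K * (c * (real n + 1))" using K second_moment by (intro mult_left_mono)
  finally show ?thesis by (simp add: mult.assoc)
qed

text \<open>About \<open>n\<close>, the operator on \<open>cut * f\<close> obeys the product rule up
  to a term in which both factors are differences. Each error pairs a slope of order
  \<open>1 / max n N\<close> of the cutoff with a quantity of order \<open>n + 1\<close>, and keeps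
  a \<open>C0\<close> weight that makes it uniformly small.\<close>

lemma cutoff_approx:
  assumes f: "f \<in> C0" and Af: "A f \<in> C0"
  shows "uniform_limit UNIV (\<lambda>N x. cut (Suc N) x * f x) f sequentially"
    and "uniform_limit UNIV (\<lambda>N. A (\<lambda>x. cut (Suc N) x * f x)) (A f) sequentially"
proof -
  have cut1: "\<bar>cut N n - 1\<bar> \<le> (real n + 1) / max (real n) (real N)" if "0 < N" for N n
  proof -
    have "\<bar>cut N n - 1\<bar> = \<bar>cut N 0 - cut N n\<bar>" by (auto simp: cut_def)
    also have "\<dots> \<le> real n / max (real n) (real N)" using cut_lipschitz[OF that, of 0 n] by simp
    also have "\<dots> \<le> (real n + 1) / max (real n) (real N)" by (intro divide_right_mono) (auto simp: max_def)
    finally show ?thesis .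
  qed
  show "uniform_limit UNIV (\<lambda>N x. cut (Suc N) x * f x) f sequentially"
    unfolding uniform_limit_seq_iff
  proof (intro allI impI)
    fix e :: real assume "0 < e"
    then obtain N0 where N0: "\<And>N n. N \<ge> N0 \<Longrightarrow> \<bar>f n\<bar> * ((real n + 1) / max (real n) (real N)) < e"
      using vanishing_weight[OF f] by blast
    have "\<bar>cut (Suc N) n * f n - f n\<bar> < e" if "N \<ge> N0" for N n
    proof -
      have "\<bar>cut (Suc N) n * f n - f n\<bar> = \<bar>f n\<bar> * \<bar>cut (Suc N) n - 1\<bar>"
        by (simp add: abs_mult[symmetric] algebra_simps)
      also have "\<dots> \<le> \<bar>f n\<bar> * ((real n + 1) / max (real n) (real (Suc N)))"
        by (intro mult_left_mono cut1) auto
      also have "\<dots> < e" using N0[of "Suc N" n] that by simp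
      finally show ?thesis .
    qed
    then show "\<exists>N. \<forall>k\<ge>N. \<forall>n. \<bar>cut (Suc k) n * f n - f n\<bar> < e" by blast
  qed
  obtain s where s: "s \<in> C0" "\<And>n k. \<bar>f k - f n\<bar> \<le> s n * \<bar>real k - real n\<bar>"
    using C0_slope[OF f] by blast
  have s0: "0 \<le> s n" for n using s(2)[of "n+1" n] by simp
  \<comment> \<open>One weight for each error: \<open>A f\<close> for the deficit of the cutoff from
    1, \<open>f\<close> for the operator applied to the cutoff, and the slope \<open>s\<close> for
    the mixed term.\<close>
  define w where "w n = \<bar>A f n\<bar> + c * \<bar>f n\<bar> + c * s n" for n
  have w: "w \<in> C0"
    using f Af s(1) unfolding w_def C0_def by (auto intro!: tendsto_eq_intros)
  have w0: "0 \<le> w n" for n using s0 c_nonneg by (simp add: w_def)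
  have main: "\<bar>A (\<lambda>x. cut N x * f x) n - A f n\<bar> \<le> w n * ((real n + 1) / max (real n) (real N))" if N: "0 < N" for N n
  proof -
    let ?M = "max (real n) (real N)"
    let ?g = "\<lambda>x. (cut N x - cut N n) * (f x - f n)"
    have M: "0 < ?M" using N by auto
    have "(\<lambda>x. cut N x * f x) = (\<lambda>x. (cut N n * f x + f n * cut N x) + (?g x - cut N n * f n))"
      by (simp add: algebra_simps)
    then have "A (\<lambda>x. cut N x * f x) n = cut N n * A f n + f n * A (cut N) n + A ?g n"
      by (simp add: op_add op_diff op_scale op_constant)
    then have eq: "A (\<lambda>x. cut N x * f x) n - A f n = (cut N n - 1) * A f n + f n * A (cut N) n + A ?g n"
      by (simp add: algebra_simps)
    have 1: "\<bar>(cut N n - 1) * A f n\<bar> \<le> \<bar>A f n\<bar> * ((real n + 1) / ?M)"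
      unfolding abs_mult mult.commute[of "\<bar>cut N n - 1\<bar>"] by (intro mult_left_mono cut1[OF N]) auto
    have "\<bar>A (\<lambda>x. cut N x - cut N n) n\<bar> \<le> 1 / ?M * c * (real n + 1)"
    proof (rule square_bound)
      fix k
      have "\<bar>cut N k - cut N n\<bar> \<le> \<bar>real k - real n\<bar> / ?M" by (rule cut_lipschitz[OF N])
      also have "\<dots> \<le> (real k - real n)\<^sup>2 / ?M" using M by (intro divide_right_mono gap_le_square) auto
      finally show "\<bar>cut N k - cut N n\<bar> \<le> 1 / ?M * (real k - real n)\<^sup>2" by simp
    qed
    then have "\<bar>A (cut N) n\<bar> \<le> c * ((real n + 1) / ?M)" by (simp add: op_diff op_constant)
    then have 2: "\<bar>f n * A (cut N) n\<bar> \<le> \<bar>f n\<bar> * (c * ((real n + 1) / ?M))"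
      unfolding abs_mult by (intro mult_left_mono) auto
    have "\<bar>A ?g n\<bar> \<le> s n / ?M * c * (real n + 1)"
    proof (rule square_bound)
      fix k
      have "\<bar>(cut N k - cut N n) * (f k - f n)\<bar> \<le> (\<bar>real k - real n\<bar> / ?M) * (s n * \<bar>real k - real n\<bar>)"
        unfolding abs_mult using s0 M by (intro mult_mono cut_lipschitz[OF N] s(2)) auto
      also have "\<dots> = s n / ?M * (real k - real n)\<^sup>2" by (simp add: power2_eq_square)
      finally show "\<bar>(cut N k - cut N n) * (f k - f n)\<bar> \<le> s n / ?M * (real k - real n)\<^sup>2" .
    qed
    then have 3: "\<bar>A ?g n\<bar> \<le> c * s n * ((real n + 1) / ?M)" by (simp add: mult_ac)
    have "\<bar>A (\<lambda>x. cut N x * f x) n - A f n\<bar>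
        \<le> \<bar>A f n\<bar> * ((real n + 1) / ?M) + \<bar>f n\<bar> * (c * ((real n + 1) / ?M)) + c * s n * ((real n + 1) / ?M)"
      unfolding eq using 1 2 3 by linarith
    also have "\<dots> = w n * ((real n + 1) / ?M)" unfolding w_def by (simp add: distrib_right mult.assoc mult.left_commute add_divide_distrib)
    finally show ?thesis .
  qed
  show "uniform_limit UNIV (\<lambda>N. A (\<lambda>x. cut (Suc N) x * f x)) (A f) sequentially"
    unfolding uniform_limit_seq_iff
  proof (intro allI impI)
    fix e :: real assume "0 < e"
    then obtain N0 where N0: "\<And>N n. N \<ge> N0 \<Longrightarrow> \<bar>w n\<bar> * ((real n + 1) / max (real n) (real N)) < e"
      using vanishing_weight[OF w] by blast
    have "\<bar>A (\<lambda>x. cut (Suc N) x * f x) n - A f n\<bar> < e" if "N \<ge> N0" for N n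
      using main[of "Suc N" n] N0[of "Suc N" n] that w0[of n] by simp
    then show "\<exists>N. \<forall>k\<ge>N. \<forall>n. \<bar>A (\<lambda>x. cut (Suc k) x * f x) n - A f n\<bar> < e" by blast
  qed
qed

end

text \<open>Only the action on finitely supported functions is assumed; that they form a core, and
  hence that \<open>P\<close> is determined by \<open>A\<close>, is derived.\<close>

locale rate_semigroup = rate_op A b c + feller P for A b c P +
  assumes on_Cc: "f \<in> Cc \<Longrightarrow> (f, A f) \<in> generator P"
begin

text \<open>Since \<open>A\<close> only looks one step upwards and kills constants, the mass escaping from \<open>{..n+1}\<close> is \<open>o(t)\<close>.\<close>

lemma generator_eq_op:
  assumes "(f, g) \<in> generator P"
  shows "g = A f"
proof
  fix n
  have f: "f \<in> C0" using generator_C0[OF assms] by simp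
  obtain B where B: "0 < B" "\<And>n. \<bar>f n\<bar> \<le> B" using C0_bounded[OF f] by blast
  define h :: "nat \<Rightarrow> real" where "h = indicator {..n+1}"
  have h: "h \<in> Cc" unfolding h_def by (rule Cc_indicator) simp
  have fh: "(\<lambda>k. f k * h k) \<in> Cc" by (rule Cc_mult(1)[OF h])
  have lim: "((\<lambda>t. (P t u n - u n) / t) \<longlongrightarrow> v n) (at_right 0)" if "(u, v) \<in> generator P" for u v
    using that unfolding generator_def by (auto intro: tendsto_uniform_limitI)
  have "A h n = 0" using local[of n h "\<lambda>_. 1"] const by (simp add: h_def)
  moreover have "h n = 1" by (simp add: h_def)
  moreover have "((\<lambda>t. B * - ((P t h n - h n) / t)) \<longlongrightarrow> B * - A h n) (at_right 0)"
    by (intro tendsto_intros lim[OF on_Cc[OF h]])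
  ultimately have esc: "((\<lambda>t. B * ((1 - P t h n) / t)) \<longlongrightarrow> 0) (at_right 0)"
    by (simp add: minus_divide_left)
  define rest where "rest t = P t f n - P t (\<lambda>k. f k * h k) n" for t
  have rest: "\<bar>rest t\<bar> \<le> B * (1 - P t h n)" if t: "0 \<le> t" for t
  proof -
    \<comment> \<open>\<open>h\<close> and \<open>1 - h\<close> have disjoint supports, so
      \<open>B * h\<close> plus or minus \<open>f * (1 - h)\<close> is still bounded by
      \<open>B\<close>; contraction then controls the tail of \<open>f\<close> by the escaped
      mass.\<close>
    have *: "\<bar>P t (\<lambda>k. B * h k + r * (f k - f k * h k)) n\<bar> \<le> B" if "\<bar>r\<bar> = 1" for r
    proof (intro contraction C0_combination C0_diff t f Cc_subset_C0[OF h] Cc_subset_C0[OF fh])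
      show "\<bar>B * h k + r * (f k - f k * h k)\<bar> \<le> B" for k
        using that B by (cases "k \<le> n + 1") (simp_all add: h_def abs_mult)
    qed
    have eq: "P t (\<lambda>k. B * h k + r * (f k - f k * h k)) n = B * P t h n + r * rest t" for r
      using Cc_subset_C0[OF h] Cc_subset_C0[OF fh] f t by (simp add: combination diff C0_diff rest_def)
    then show ?thesis using *[of 1] *[of "-1"] unfolding eq by (intro abs_leI) (simp_all add: algebra_simps abs_le_iff)
  qed
  have "((\<lambda>t. rest t / t) \<longlongrightarrow> 0) (at_right 0)"
  proof (rule Lim_null_comparison[where g = "\<lambda>t. B * ((1 - P t h n) / t)"])
    show "\<forall>\<^sub>F t in at_right 0. norm (rest t / t) \<le> B * ((1 - P t h n) / t)"
      using eventually_at_right_less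
      by eventually_elim (use rest in \<open>auto simp: abs_divide field_simps\<close>)
    show "((\<lambda>t. B * ((1 - P t h n) / t)) \<longlongrightarrow> 0) (at_right 0)" by (rule esc)
  qed
  from tendsto_add[OF lim[OF on_Cc[OF fh]] this]
  have "((\<lambda>t. (P t f n - f n) / t) \<longlongrightarrow> A (\<lambda>k. f k * h k) n + 0) (at_right 0)"
    by (simp add: rest_def h_def add_divide_distrib[symmetric])
  moreover have "A (\<lambda>k. f k * h k) n = A f n" by (rule local) (simp add: h_def)
  ultimately have "g n = A f n" using tendsto_unique[OF _ lim[OF assms]] by simp
  then show "g n = A f n" .
qed

lemma op_in_generator:
  assumes "f \<in> C0" "A f \<in> C0"
  shows "(f, A f) \<in> generator P"
  by (rule generator_closed[OF on_Cc cutoff_approx[OF assms] assms]) (intro Cc_mult cut_Cc, simp)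

text \<open>The generator is the maximal operator of \<open>A\<close> on \<open>C0\<close>, so
  membership of a candidate solution in the domain reduces to computing \<open>A\<close> on
  it.\<close>

lemma generator_iff: "(f, g) \<in> generator P \<longleftrightarrow> f \<in> C0 \<and> g \<in> C0 \<and> g = A f"
  using generator_C0 generator_eq_op op_in_generator by blast

lemma generates_op: "generates A Cc P"
  unfolding generates_def
proof (intro conjI ballI; clarify?)
  show "(f, A f) \<in> generator P" if "f \<in> Cc" for f using on_Cc that .
  fix f g assume "(f, g) \<in> generator P"
  then have "f \<in> C0" "A f \<in> C0" "g = A f" using generator_iff by auto
  then show "\<exists>F. (\<forall>k. F k \<in> Cc) \<and> uniform_limit UNIV F f sequentially \<and> uniform_limit UNIV (\<lambda>k. A (F k)) g sequentially"
    using cutoff_approx[of f] by (intro exI[of _ "\<lambda>N x. cut (Suc N) x * f x"]) (auto intro!: Cc_mult cut_Cc)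
qed

lemma op_commutes:
  assumes "f \<in> C0" "A f \<in> C0" "0 \<le> t"
  shows "A (P t f) = P t (A f)"
  using generator_eq_op[OF generator_invariant[OF op_in_generator[OF assms(1,2)] assms(3)]] by simp

text \<open>Below \<open>N\<close> the operator sees only the affine part of the cutoff, with the
  kink \<open>N\<close> as the last visible point at worst, and returns minus the drift over
  \<open>N\<close>. From \<open>N\<close> on, the cutoff is at its minimum 0.\<close>

lemma op_cut_lower:
  assumes N: "0 < N" shows "- (b / N) \<le> A (cut N) n"
proof (cases "n < N")
  case True
  have "A (cut N) n = A (\<lambda>x. 1 - (1 / N) * real x) n"
    using True N by (intro local) (auto simp: cut_def field_simps)
  also have "\<dots> = - (A real n / N)" unfolding op_diff op_scale op_constant by simp
  finally show ?thesis using divide_right_mono[OF drift[of n], of "real N"] by simp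
next
  case False
  then have "0 \<le> A (cut N) n" using N by (intro minimum cut_unit) (simp add: cut_def)
  then show ?thesis using b_nonneg by (smt (verit) divide_nonneg_nonneg of_nat_0_le_iff)
qed

lemma cut_lower:
  assumes "0 < N" "0 \<le> t"
  shows "cut N n - b / N * t \<le> P t (cut N) n"
proof -
  have g: "(cut N, A (cut N)) \<in> generator P" by (intro on_Cc cut_Cc assms)
  have "- (b / N) \<le> P s (A (cut N)) n" if "0 \<le> s" for s
    using that generator_C0[OF g] op_cut_lower[OF assms(1)] b_nonneg by (intro lower_bound) auto
  then show ?thesis using increment_bound[OF g assms(2), of "- (b / N)" n] by simp
qed

text \<open>The drift bound lets the cutoff at level \<open>N\<close> decrease by at most
  \<open>b * t / N\<close> up to time \<open>t\<close>, so the mass kept below \<open>N\<close> is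
  at least \<open>1 - (n + b * t) / N\<close>.\<close>

lemma conservative:
  assumes "0 \<le> t"
  shows "(\<lambda>k. P t (indicator {k}) n) sums 1"
proof -
  have "(\<Sum>k<N. P t (indicator {k}) n) = P t (indicator {..<N}) n" for N
  proof -
    have "(\<lambda>x. \<Sum>k<N. indicator {k} x) = (indicator {..<N} :: nat \<Rightarrow> real)"
      by (auto simp: indicator_def)
    then show ?thesis using sum[of t "{..<N}" "\<lambda>k. indicator {k}" n] assms Cc_subset_C0 Cc_indicator by simp
  qed
  moreover have "(\<lambda>N. P t (indicator {..<N}) n) \<longlonglongrightarrow> 1"
  proof (rule tendsto_sandwich)
    have "1 - (n + b * t) / N \<le> P t (indicator {..<N}) n" if N: "0 < N" for N
    proof -
      have "1 - (n + b * t) / N \<le> cut N n - b / N * t" unfolding cut_def by (simp add: add_divide_distrib)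
      also have "\<dots> \<le> P t (cut N) n" by (rule cut_lower[OF N assms])
      also have "\<dots> \<le> P t (indicator {..<N}) n"
        using assms N by (intro mono Cc_subset_C0 cut_Cc Cc_indicator) (auto simp: indicator_def cut_def)
      finally show ?thesis .
    qed
    then show "\<forall>\<^sub>F N in sequentially. 1 - (n + b * t) / N \<le> P t (indicator {..<N}) n"
      by (rule eventually_mono[OF eventually_gt_at_top[of 0]])
    show "\<forall>\<^sub>F N in sequentially. P t (indicator {..<N}) n \<le> 1"
      using assms by (intro always_eventually allI upper_bound Cc_subset_C0 Cc_indicator) auto
    have "(\<lambda>N::nat. 1 - (n + b * t) * (1 / N)) \<longlonglongrightarrow> 1 - (n + b * t) * 0"
      by (intro tendsto_intros lim_1_over_n)
    then show "(\<lambda>N::nat. 1 - (n + b * t) / N) \<longlonglongrightarrow> 1" by simp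
  qed simp
  ultimately show ?thesis unfolding sums_def by simp
qed

lemma feller_markov: "feller_markov_semigroup P"
  unfolding feller_markov_semigroup_def using feller_P conservative by simp

text \<open>The orbits of \<open>R\<close> solve the Cauchy problem of \<open>P\<close>, because
  both generators are the maximal operator of the same \<open>A\<close>.\<close>

lemma unique:
  assumes R: "rate_semigroup A b c R" and "0 \<le> t" "f \<in> C0"
  shows "P t f = R t f"
proof -
  interpret R: rate_semigroup A b c R by fact
  show ?thesis
  proof (rule equal_if_on_Cc[OF R.feller_axioms assms(2) _ assms(3)])
    fix f assume f: "f \<in> Cc"
    then have g: "(f, A f) \<in> generator R" by (rule R.on_Cc)
    have "R t f = P t (R 0 f)"
    proof (rule cauchy_problem_unique[of "\<lambda>s. R s f" "\<lambda>s. R s (A f)", OF _ _ assms(2)])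
      show "(R s f, R s (A f)) \<in> generator P" if "0 \<le> s" for s
        using R.generator_invariant[OF g that] unfolding R.generator_iff generator_iff by metis
      show "\<exists>d>0. \<forall>y\<ge>0. y \<noteq> s \<and> \<bar>y - s\<bar> < d \<longrightarrow> (\<forall>n. \<bar>(R y f n - R s f n) / (y - s) - R s (A f) n\<bar> < e)"
        if "0 \<le> s" "0 < e" for s e
        using R.uniform_derivative[OF g that(2)] that(1) by metis
    qed
    then show "P t f = R t f" using R.at_0 Cc_subset_C0[OF f] by simp
  qed
qed

end

section \<open>Binomial thinning\<close>

text \<open>Generator of the pure death process in which each of \<open>n\<close> individuals dies
  at rate 1; thinning with parameter \<open>exp (- t)\<close> is its semigroup.\<close>

definition death_op :: "(nat \<Rightarrow> real) \<Rightarrow> nat \<Rightarrow> real" where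
  "death_op f n = real n * dminus f n"

text \<open>Every function on \<open>{..N}\<close> is a polynomial in the binomial basis, so
  identities between local linear operators need checking only on that basis.\<close>

lemma newton_expansion:
  obtains a :: "nat \<Rightarrow> real" where "\<And>x. x \<le> N \<Longrightarrow> f x = (\<Sum>k\<le>N. a k * real (x choose k))"
proof -
  have "\<exists>a. \<forall>x\<le>N. f x = (\<Sum>k\<le>N. a k * real (x choose k))"
  proof (induction N)
    case 0
    then show ?case by (intro exI[of _ f]) simp
  next
    case (Suc N)
    then obtain a where a: "\<And>x. x \<le> N \<Longrightarrow> f x = (\<Sum>k\<le>N. a k * real (x choose k))" by blast
    let ?a = "a(Suc N := f (Suc N) - (\<Sum>k\<le>N. a k * real (Suc N choose k)))"
    have "f x = (\<Sum>k\<le>Suc N. ?a k * real (x choose k))" if "x \<le> Suc N" for x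
      using that a[of x] by (cases "x = Suc N") (auto simp: binomial_eq_0 simp del: binomial_Suc_Suc)
    then show ?case by blast
  qed
  then show ?thesis using that by blast
qed

lemma binomial_absorb_real: "real (Suc j) * real (n choose Suc j) = (real n - real j) * real (n choose j)"
proof (cases "j \<le> n")
  case True
  have "Suc j * (n choose Suc j) = (n - j) * (n choose j)"
    by (simp only: binomial_absorption binomial_absorb_comp)
  then have "real (Suc j) * real (n choose Suc j) = real (n - j) * real (n choose j)"
    by (metis of_nat_mult)
  then show ?thesis using True by (simp add: of_nat_diff)
qed (simp add: binomial_eq_0)

lemma binomial_pred_real: "real n * real ((n - 1) choose k) = (real n - real k) * real (n choose k)"
proof (cases "k \<le> n")
  case True
  have "real (n - k) * real (n choose k) = real n * real ((n - 1) choose k)"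
    by (metis binomial_absorb_comp of_nat_mult)
  then show ?thesis using True by (simp add: of_nat_diff)
qed (simp add: binomial_eq_0)

lemma dil_cong: "(\<And>k. k \<le> n \<Longrightarrow> f k = g k) \<Longrightarrow> dil \<alpha> f n = dil \<alpha> g n"
  unfolding dil_def by (intro sum.cong) auto

lemma dil_sum: "dil \<alpha> (\<lambda>x. \<Sum>k\<in>S. a k * f k x) n = (\<Sum>k\<in>S. a k * dil \<alpha> (f k) n)"
  unfolding dil_def sum_distrib_left by (subst sum.swap) (simp add: mult_ac)

lemma dil_combination: "dil \<alpha> (\<lambda>x. r * f x + s * g x) n = r * dil \<alpha> f n + s * dil \<alpha> g n"
  unfolding dil_def by (simp add: sum_distrib_left sum.distrib[symmetric] algebra_simps)

lemma dil_diff: "dil \<alpha> (\<lambda>x. f x - g x) n = dil \<alpha> f n - dil \<alpha> g n"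
  using dil_combination[of \<alpha> 1 f "-1" g n] by simp

text \<open>A binomial moment of the binomial law: \<open>choose_mult\<close> pulls
  \<open>n choose k\<close> out of the sum, and what remains is the binomial expansion of a power of
  \<open>\<alpha> + (1 - \<alpha>)\<close>.\<close>

lemma dil_binomial: "dil \<alpha> (\<lambda>x. real (x choose k)) n = \<alpha> ^ k * real (n choose k)"
proof (cases "k \<le> n")
  case False
  then have "dil \<alpha> (\<lambda>x. real (x choose k)) n = 0"
    unfolding dil_def by (intro sum.neutral) (auto simp: binomial_eq_0)
  then show ?thesis using False by (simp add: binomial_eq_0)
next
  case True
  let ?t = "\<lambda>r. real (n choose r) * \<alpha> ^ r * (1 - \<alpha>) ^ (n - r) * real (r choose k)"
  have "dil \<alpha> (\<lambda>x. real (x choose k)) n = (\<Sum>r=k..n. ?t r)"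
    unfolding dil_def by (intro sum.mono_neutral_right) (auto simp: binomial_eq_0)
  also have "\<dots> = (\<Sum>j\<le>n - k. ?t (k + j))"
    using sum.atLeastAtMost_shift_0[OF True, of ?t] by (simp add: atMost_atLeast0)
  also have "\<dots> = (\<Sum>j\<le>n - k. \<alpha> ^ k * real (n choose k) * (real ((n - k) choose j) * \<alpha> ^ j * (1 - \<alpha>) ^ (n - k - j)))"
  proof (rule sum.cong[OF refl])
    fix j assume j: "j \<in> {..n - k}"
    have "(n choose (k + j)) * ((k + j) choose k) = (n choose k) * ((n - k) choose (k + j - k))"
      using j True by (intro choose_mult) auto
    then have "real (n choose (k + j)) * real ((k + j) choose k) = real (n choose k) * real ((n - k) choose j)"
      by (metis add_diff_cancel_left' of_nat_mult)
    then show "?t (k + j) = \<alpha> ^ k * real (n choose k) * (real ((n - k) choose j) * \<alpha> ^ j * (1 - \<alpha>) ^ (n - k - j))"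
      by (simp add: power_add mult_ac)
  qed
  also have "\<dots> = \<alpha> ^ k * real (n choose k) * (\<alpha> + (1 - \<alpha>)) ^ (n - k)"
    unfolding binomial_ring sum_distrib_left by simp
  finally show ?thesis by simp
qed

lemma dil_newton:
  assumes "\<And>x. x \<le> N \<Longrightarrow> f x = (\<Sum>k\<le>N. a k * real (x choose k))" "n \<le> N"
  shows "dil \<alpha> f n = (\<Sum>k\<le>N. (a k * \<alpha> ^ k) * real (n choose k))"
proof -
  have "dil \<alpha> f n = dil \<alpha> (\<lambda>x. \<Sum>k\<le>N. a k * real (x choose k)) n"
    using assms by (intro dil_cong) auto
  also have "\<dots> = (\<Sum>k\<le>N. (a k * \<alpha> ^ k) * real (n choose k))"
    unfolding dil_sum dil_binomial by (simp add: mult.assoc)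
  finally show ?thesis .
qed

lemma death_op_newton:
  assumes "\<And>x. x \<le> N \<Longrightarrow> f x = (\<Sum>k\<le>N. a k * real (x choose k))" "n \<le> N"
  shows "death_op f n = (\<Sum>k\<le>N. (a k * - real k) * real (n choose k))"
proof -
  have "death_op f n = real n * ((\<Sum>k\<le>N. a k * real ((n - 1) choose k)) - (\<Sum>k\<le>N. a k * real (n choose k)))"
    unfolding death_op_def dminus_def using assms(1)[of n] assms(1)[of "n - 1"] assms(2) by simp
  also have "\<dots> = (\<Sum>k\<le>N. a k * (real n * real ((n - 1) choose k) - real n * real (n choose k)))"
    by (simp add: sum_distrib_left sum_subtractf[symmetric] algebra_simps)
  also have "\<dots> = (\<Sum>k\<le>N. (a k * - real k) * real (n choose k))"
    unfolding binomial_pred_real by (simp add: algebra_simps)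
  finally show ?thesis .
qed

lemma dil_dil: "dil \<alpha> (dil \<beta> f) n = dil (\<alpha> * \<beta>) f n"
proof -
  obtain a where a: "\<And>x. x \<le> n \<Longrightarrow> f x = (\<Sum>k\<le>n. a k * real (x choose k))"
    using newton_expansion[of n f] by blast
  have "dil \<alpha> (dil \<beta> f) n = (\<Sum>k\<le>n. (a k * \<beta> ^ k * \<alpha> ^ k) * real (n choose k))"
    by (rule dil_newton[OF dil_newton[OF a]]) auto
  also have "\<dots> = dil (\<alpha> * \<beta>) f n"
    using dil_newton[OF a, of n "\<alpha> * \<beta>"] by (simp add: power_mult_distrib mult_ac)
  finally show ?thesis .
qed

lemma dil_const: "dil \<alpha> (\<lambda>x. r) n = r"
  using dil_combination[of \<alpha> r "\<lambda>x. real (x choose 0)" 0 "\<lambda>x. real (x choose 0)" n] dil_binomial[of \<alpha> 0 n]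
  by simp

lemma dil_1: "dil 1 f n = f n"
proof -
  obtain a where a: "\<And>x. x \<le> n \<Longrightarrow> f x = (\<Sum>k\<le>n. a k * real (x choose k))"
    using newton_expansion[of n f] by blast
  show ?thesis using dil_newton[OF a, of n 1] a[of n] by simp
qed

lemma dil_at_0: "dil \<alpha> f 0 = f 0"
  by (simp add: dil_def)

lemma dil_mono:
  assumes "0 \<le> \<alpha>" "\<alpha> \<le> 1" "\<And>k. k \<le> n \<Longrightarrow> f k \<le> g k"
  shows "dil \<alpha> f n \<le> dil \<alpha> g n"
  unfolding dil_def using assms by (intro sum_mono mult_left_mono) auto

lemma dil_abs_le:
  assumes "0 \<le> \<alpha>" "\<alpha> \<le> 1" "\<And>k. \<bar>f k\<bar> \<le> g k"
  shows "\<bar>dil \<alpha> f n\<bar> \<le> dil \<alpha> g n"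
proof -
  have "- f k \<le> g k" "f k \<le> g k" for k using assms(3)[of k] by auto
  then have "dil \<alpha> f n \<le> dil \<alpha> g n" "dil \<alpha> (\<lambda>k. -1 * f k + 0 * f k) n \<le> dil \<alpha> g n"
    using assms by (auto intro!: dil_mono)
  then show ?thesis unfolding dil_combination by simp
qed

lemma dil_contraction:
  assumes "0 \<le> \<alpha>" "\<alpha> \<le> 1" "\<And>k. \<bar>f k\<bar> \<le> M"
  shows "\<bar>dil \<alpha> f n\<bar> \<le> M"
  using dil_abs_le[OF assms] by (simp add: dil_const)

lemma dil_power: "dil \<alpha> (\<lambda>x. z ^ x) n = (\<alpha> * z + (1 - \<alpha>)) ^ n"
  unfolding dil_def binomial_ring atMost_atLeast0 by (simp add: power_mult_distrib mult_ac)

text \<open>A \<open>C0\<close> function is bounded by \<open>e/2\<close> plus a multiple of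
  \<open>(1/2) ^ n\<close>, and thinning maps this power to \<open>(1 - \<alpha>/2) ^ n\<close>,
  which tends to 0 because \<alpha> is positive.\<close>

lemma dil_C0:
  assumes "0 < \<alpha>" "\<alpha> \<le> 1" "f \<in> C0"
  shows "dil \<alpha> f \<in> C0"
  unfolding C0_iff
proof (intro allI impI)
  fix e :: real assume e: "0 < e"
  obtain B where B: "0 < B" "\<And>n. \<bar>f n\<bar> \<le> B" using C0_bounded[OF assms(3)] by blast
  obtain R where R: "\<And>n. n \<ge> R \<Longrightarrow> \<bar>f n\<bar> < e / 2"
    using assms(3) half_gt_zero[OF e] unfolding C0_iff by blast
  let ?M = "B * 2 ^ R"
  have f: "\<bar>f n\<bar> \<le> 1 * (e/2) + ?M * (1/2) ^ n" for n
  proof (cases "n \<ge> R")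
    case True
    have "0 \<le> ?M * (1/2) ^ n" using B by simp
    then show ?thesis using R[OF True] by linarith
  next
    case False
    then have "(2::real) ^ n \<le> 2 ^ R" by (intro power_increasing) auto
    then have "1 \<le> (2::real) ^ R * (1/2) ^ n" by (simp add: power_divide)
    then have "B * 1 \<le> B * (2 ^ R * (1/2) ^ n)" using B by (intro mult_left_mono) auto
    then have "\<bar>f n\<bar> \<le> ?M * (1/2) ^ n" using B(2)[of n] by (simp add: mult.assoc)
    then show ?thesis using e by linarith
  qed
  have bound: "\<bar>dil \<alpha> f n\<bar> \<le> e/2 + ?M * (1 - \<alpha>/2) ^ n" for n
  proof -
    have "\<bar>dil \<alpha> f n\<bar> \<le> dil \<alpha> (\<lambda>n. 1 * (e/2) + ?M * (1/2) ^ n) n"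
      using f assms by (intro dil_abs_le) auto
    also have "\<dots> = e/2 + ?M * (1 - \<alpha>/2) ^ n"
      unfolding dil_combination dil_power dil_const by (simp add: algebra_simps)
    finally show ?thesis .
  qed
  have "(\<lambda>n. ?M * (1 - \<alpha>/2) ^ n) \<longlonglongrightarrow> ?M * 0"
    using assms by (intro tendsto_intros LIMSEQ_power_zero) auto
  then obtain N where N: "\<And>n. n \<ge> N \<Longrightarrow> \<bar>?M * (1 - \<alpha>/2) ^ n\<bar> < e/2"
    using half_gt_zero[OF e] unfolding LIMSEQ_iff by fastforce
  have "\<bar>dil \<alpha> f n\<bar> < e" if "n \<ge> N" for n using bound[of n] N[OF that] by linarith
  then show "\<exists>N. \<forall>n\<ge>N. \<bar>dil \<alpha> f n\<bar> < e" by blast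
qed

lemma death_op_Cc: "f \<in> Cc \<Longrightarrow> death_op f \<in> Cc"
  unfolding Cc_iff death_op_def dminus_def
  by (metis (no_types, opaque_lifting) Suc_le_D diff_Suc_1 diff_self le_SucI mult_zero_right not_less_eq_eq)

lemma dil_derivative:
  "((\<lambda>t. dil (exp (- t)) f n) has_real_derivative dil (exp (- t)) (death_op f) n) (at t within S)"
proof -
  obtain a where a: "\<And>x. x \<le> n \<Longrightarrow> f x = (\<Sum>k\<le>n. a k * real (x choose k))"
    using newton_expansion[of n f] by blast
  have pow: "exp (- t) ^ k = exp (- real k * t)" for t :: real and k
    by (simp add: exp_of_nat_mult[symmetric])
  have "((\<lambda>t. \<Sum>k\<le>n. (a k * exp (- real k * t)) * real (n choose k)) has_real_derivative
      (\<Sum>k\<le>n. (a k * - real k * exp (- real k * t)) * real (n choose k))) (at t within S)"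
    by (intro DERIV_sum) (auto intro!: derivative_eq_intros)
  then show ?thesis
    unfolding dil_newton[OF a order_refl, simplified] dil_newton[OF death_op_newton[OF a] order_refl, simplified] pow by simp
qed

lemma dil_increment:
  assumes "0 \<le> t" "\<And>k. \<bar>death_op f k\<bar> \<le> B"
  shows "\<bar>dil (exp (- t)) f n - f n\<bar> \<le> t * B"
proof (cases "t = 0")
  case True then show ?thesis by (simp add: dil_1)
next
  case False
  then have "0 < t" using assms by simp
  then obtain z where z: "0 < z" "z < t" "dil (exp (- t)) f n - dil (exp (- 0)) f n = (t - 0) * dil (exp (- z)) (death_op f) n"
    using MVT2[of 0 t "\<lambda>t. dil (exp (- t)) f n" "\<lambda>t. dil (exp (- t)) (death_op f) n"] dil_derivative[of f n _ UNIV] by metis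
  have "\<bar>dil (exp (- z)) (death_op f) n\<bar> \<le> B" using z assms by (intro dil_contraction) auto
  then show ?thesis using z \<open>0 < t\<close> by (simp add: dil_1 abs_mult mult_left_mono)
qed

text \<open>The second-order remainder is of order \<open>t * t\<close> uniformly in
  \<open>n\<close>, so it still vanishes after the division by \<open>t\<close> when
  \<open>K\<close> is differentiated at time 0.\<close>

lemma dil_increment2:
  assumes "0 \<le> t" "\<And>k. \<bar>death_op (death_op f) k\<bar> \<le> B"
  shows "\<bar>dil (exp (- t)) f n - f n - t * death_op f n\<bar> \<le> t * t * B"
proof (cases "t = 0")
  case True then show ?thesis by (simp add: dil_1)
next
  case False
  then have "0 < t" using assms by simp
  have "((\<lambda>t. dil (exp (- t)) f n - t * death_op f n) has_real_derivative dil (exp (- t)) (death_op f) n - death_op f n) (at t)" for t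
    by (auto intro!: derivative_eq_intros dil_derivative)
  then obtain z where z: "0 < z" "z < t"
    "(dil (exp (- t)) f n - t * death_op f n) - (dil (exp (- 0)) f n - 0 * death_op f n) = (t - 0) * (dil (exp (- z)) (death_op f) n - death_op f n)"
    using MVT2[OF \<open>0 < t\<close>, of "\<lambda>t. dil (exp (- t)) f n - t * death_op f n" "\<lambda>t. dil (exp (- t)) (death_op f) n - death_op f n"] by metis
  have "\<bar>dil (exp (- z)) (death_op f) n - death_op f n\<bar> \<le> z * B" using z assms by (intro dil_increment) auto
  also have "\<dots> \<le> t * B" using z assms(2)[of 0] by (intro mult_right_mono) auto
  finally have "t * \<bar>dil (exp (- z)) (death_op f) n - death_op f n\<bar> \<le> t * (t * B)" using assms by (intro mult_left_mono)
  moreover have "dil (exp (- t)) f n - f n - t * death_op f n = t * (dil (exp (- z)) (death_op f) n - death_op f n)"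
    using z by (simp add: dil_1 algebra_simps)
  ultimately show ?thesis using assms by (simp add: abs_mult mult.assoc)
qed

lemma dil_strongly_continuous:
  assumes "f \<in> C0" "0 < e"
  obtains d where "0 < d" "\<And>t n. 0 \<le> t \<Longrightarrow> t < d \<Longrightarrow> \<bar>dil (exp (- t)) f n - f n\<bar> < e"
proof -
  obtain g where g: "g \<in> Cc" "\<And>n. \<bar>f n - g n\<bar> < e/3" using Cc_dense[OF assms(1), of "e/3"] assms(2) by auto
  obtain B where B: "0 < B" "\<And>n. \<bar>death_op g n\<bar> \<le> B" using C0_bounded[OF Cc_subset_C0[OF death_op_Cc[OF g(1)]]] by blast
  show ?thesis
  proof (rule that[of "e / (3 * B)"])
    show "0 < e / (3 * B)" using assms B by simp
    fix t n assume t: "0 \<le> t" "t < e / (3 * B)"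
    have "\<bar>dil (exp (- t)) (\<lambda>n. f n - g n) n\<bar> \<le> e/3"
      using t less_imp_le[OF g(2)] by (intro dil_contraction) auto
    then have "\<bar>dil (exp (- t)) f n - dil (exp (- t)) g n\<bar> \<le> e/3" unfolding dil_diff .
    moreover have "\<bar>dil (exp (- t)) g n - g n\<bar> \<le> t * B" using t B by (intro dil_increment) auto
    moreover have "t * B < e / 3" using t B by (simp add: field_simps)
    ultimately show "\<bar>dil (exp (- t)) f n - f n\<bar> < e" using g(2)[of n] by linarith
  qed
qed

section \<open>The operators \<open>GG\<close> and \<open>LL\<close>\<close>

text \<open>At \<open>x = k * y\<close> this is the factor by which the compensated jump integrand
  of \<open>GG\<close> acts on \<open>binom(.,k)\<close>; being of second order at 0 and linear at
  infinity, it is integrable under the condition on \<mu>.\<close>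

definition exp_remainder :: "real \<Rightarrow> real" where
  "exp_remainder x = exp (- x) - 1 + x"

lemma exp_remainder_0 [simp]: "exp_remainder 0 = 0"
  by (simp add: exp_remainder_def)

lemma exp_remainder_nonneg: "0 \<le> exp_remainder x"
  using exp_ge_add_one_self[of "- x"] by (simp add: exp_remainder_def)

lemma exp_remainder_pos: "0 < x \<Longrightarrow> 0 < exp_remainder x"
  using exp_ge_one_minus_x_over_n_power_n[of x 2] exp_ge_add_one_self[of "- x"]
  by (smt (verit) exp_minus_greater exp_remainder_def)

text \<open>The linear bound serves large \<open>y\<close>, the quadratic one small
  \<open>y\<close>; enlarging \<open>k\<close> to \<open>k\<^sup>2\<close> in the former puts both
  under one constant.\<close>

lemma exp_remainder_bound:
  assumes "0 < y"
  shows "exp_remainder (real k * y) \<le> (real k)\<^sup>2 * min y (y\<^sup>2)"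
proof (cases "k = 0")
  case False
  let ?x = "real k * y"
  have x: "0 < ?x" using False assms by simp
  have "exp_remainder ?x \<le> ?x" using x by (simp add: exp_remainder_def)
  also have "\<dots> \<le> (real k)\<^sup>2 * y"
    using False assms by (intro mult_right_mono) (auto simp: power2_eq_square)
  finally have 1: "exp_remainder ?x \<le> (real k)\<^sup>2 * y" .
  have "exp (- ?x) \<le> 1 / (1 + ?x)"
    using exp_ge_add_one_self[of ?x] x by (simp add: exp_minus field_simps)
  also have "\<dots> \<le> 1 - ?x + ?x\<^sup>2"
  proof -
    have "1 \<le> 1 + ?x ^ 3" using x by simp
    also have "\<dots> = (1 - ?x + ?x\<^sup>2) * (1 + ?x)" by (simp add: power2_eq_square power3_eq_cube algebra_simps)
    finally show ?thesis using x by (simp only: divide_le_eq) auto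
  qed
  finally have "exp_remainder ?x \<le> ?x\<^sup>2" by (simp add: exp_remainder_def)
  then have 2: "exp_remainder ?x \<le> (real k)\<^sup>2 * y\<^sup>2" by (simp add: power_mult_distrib)
  show ?thesis using 1 2 by (auto simp: min_def)
qed simp

lemma exp_remainder_measurable [measurable]: "exp_remainder \<in> borel_measurable borel"
  unfolding exp_remainder_def by measurable

locale levy_data =
  fixes m s2 :: real and \<mu> :: "real measure"
  assumes m_nonneg: "0 \<le> m" and s2_nonneg: "0 \<le> s2"
    and sets_mu [measurable_cong]: "sets \<mu> = sets borel"
    and null_nonpos: "emeasure \<mu> {..0} = 0"
    and finite_integral: "(\<integral>\<^sup>+ y. ennreal (min y (y\<^sup>2)) \<partial>\<mu>) < \<infinity>"
begin

lemma space_mu [simp]: "space \<mu> = UNIV"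
  using sets_eq_imp_space_eq[OF sets_mu] by simp

lemma AE_pos: "AE y in \<mu>. 0 < y"
  by (rule AE_I[OF _ null_nonpos]) (auto simp: sets_mu)

lemma integrable_min: "integrable \<mu> (\<lambda>y. min y (y\<^sup>2))"
  using AE_pos finite_integral by (intro integrableI_nonneg) auto

lemma integrable_exp_remainder: "integrable \<mu> (\<lambda>y. exp_remainder (real k * y))"
proof (rule Bochner_Integration.integrable_bound)
  show "integrable \<mu> (\<lambda>y. (real k)\<^sup>2 * min y (y\<^sup>2))" using integrable_min by simp
  show "AE y in \<mu>. norm (exp_remainder (real k * y)) \<le> norm ((real k)\<^sup>2 * min y (y\<^sup>2))"
    using AE_pos
  proof eventually_elim
    fix y :: real assume "0 < y"
    then show "norm (exp_remainder (real k * y)) \<le> norm ((real k)\<^sup>2 * min y (y\<^sup>2))"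
      using exp_remainder_bound[of y k] exp_remainder_nonneg[of "real k * y"] by simp
  qed
qed simp

text \<open>Exchanging integrals identifies \<open>rate k\<close> with \<phi>(k): the integral of
  \<open>1 - exp (- k y)\<close> against the tail is that of \<open>exp_remainder (k y) / k\<close>
  against \<mu>. At \<open>k = 0\<close> the last term is 0, which leaves \<open>m\<close>.\<close>

definition rate :: "nat \<Rightarrow> real" where
  "rate k = m + s2 * real k + (LINT y|\<mu>. exp_remainder (real k * y)) / real k"

lemma integral_exp_remainder_nonneg: "0 \<le> (LINT y|\<mu>. exp_remainder (real k * y))"
  by (intro Bochner_Integration.integral_nonneg exp_remainder_nonneg)

lemma rate_nonneg: "0 \<le> rate k"
  unfolding rate_def using m_nonneg s2_nonneg integral_exp_remainder_nonneg[of k] by simp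

text \<open>The factor \<open>k\<^sup>2\<close> of \<open>exp_remainder_bound\<close> loses one
  power in the division by \<open>k\<close>. Linear growth is what keeps the binomial moments of the
  invariant law geometric.\<close>

lemma rate_linear_bound:
  obtains C where "0 < C" "\<And>k. 0 < k \<Longrightarrow> rate k \<le> C * real k"
proof -
  let ?I = "LINT y|\<mu>. min y (y\<^sup>2)"
  have I0: "0 \<le> ?I" by (rule integral_nonneg_AE) (use AE_pos in \<open>auto\<close>)
  show ?thesis
  proof (rule that[of "m + s2 + ?I + 1"])
    show "0 < m + s2 + ?I + 1" using m_nonneg s2_nonneg I0 by simp
    fix k :: nat assume k: "0 < k"
    have "(LINT y|\<mu>. exp_remainder (real k * y)) \<le> (LINT y|\<mu>. (real k)\<^sup>2 * min y (y\<^sup>2))"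
      using integrable_exp_remainder integrable_min AE_pos
      by (intro integral_mono_AE) (auto elim!: eventually_mono intro: exp_remainder_bound)
    then have "(LINT y|\<mu>. exp_remainder (real k * y)) / real k \<le> real k * ?I"
      using k by (simp add: divide_le_eq power2_eq_square mult_ac)
    moreover have "m * 1 \<le> m * real k" using k m_nonneg by (intro mult_left_mono) auto
    moreover have "0 \<le> real k" by simp
    ultimately show "rate k \<le> (m + s2 + ?I + 1) * real k"
      unfolding rate_def by (simp add: algebra_simps)
  qed
qed

abbreviation "G \<equiv> GG m s2 \<mu>"
abbreviation "L \<equiv> LL m s2 \<mu>"

section \<open>Action of the generators on the binomial basis\<close>

definition jump :: "(nat \<Rightarrow> real) \<Rightarrow> nat \<Rightarrow> real \<Rightarrow> real" where
  "jump f n y = dil (exp (- y)) f (n + 1) - f (n + 1) + y * real (n + 1) * dplus f n"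

text \<open>The compensator supplies exactly the missing linear term: \<open>n + 1\<close> times the
  increment of \<open>binom(.,k)\<close> from \<open>n\<close> to \<open>n + 1\<close> is
  \<open>k\<close> times \<open>binom(n+1,k)\<close>, which completes \<open>exp (- k y) - 1\<close>
  to \<open>exp_remainder\<close>.\<close>

lemma jump_newton:
  assumes f: "\<And>x. x \<le> n + 1 \<Longrightarrow> f x = (\<Sum>k\<le>n+1. a k * real (x choose k))"
  shows "jump f n y = (\<Sum>k\<le>n+1. (a k * real ((n + 1) choose k)) * exp_remainder (real k * y))"
proof -
  have pow: "exp (- y) ^ k = exp (- (real k * y))" for k
    by (simp add: exp_of_nat_mult[symmetric])
  have D: "dil (exp (- y)) f (n + 1) = (\<Sum>k\<le>n+1. a k * exp (- (real k * y)) * real ((n+1) choose k))"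
    unfolding pow[symmetric] by (rule dil_newton) (use f in auto)
  have "jump f n y = (\<Sum>k\<le>n+1. a k * exp (- (real k * y)) * real ((n+1) choose k)) - (\<Sum>k\<le>n+1. a k * real ((n+1) choose k))
      + y * real (n + 1) * ((\<Sum>k\<le>n+1. a k * real ((n+1) choose k)) - (\<Sum>k\<le>n+1. a k * real (n choose k)))"
    unfolding jump_def dplus_def D f[OF order_refl] using f[of n] by (simp del: binomial_Suc_Suc sum.atMost_Suc)
  also have "\<dots> = (\<Sum>k\<le>n+1. a k * exp (- (real k * y)) * real ((n+1) choose k) - a k * real ((n+1) choose k)
      + y * real (n + 1) * (a k * real ((n+1) choose k) - a k * real (n choose k)))"
    by (simp add: sum_distrib_left sum_subtractf sum.distrib right_diff_distrib del: binomial_Suc_Suc sum.atMost_Suc)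
  also have "\<dots> = (\<Sum>k\<le>n+1. (a k * real ((n + 1) choose k)) * exp_remainder (real k * y))"
  proof (rule sum.cong[OF refl])
    fix k
    have "real (n + 1) * real (n choose k) = (real (n + 1) - real k) * real ((n + 1) choose k)"
      using binomial_pred_real[of "n + 1" k] by simp
    then have "real (n + 1) * (real ((n+1) choose k) - real (n choose k)) = real k * real ((n + 1) choose k)"
      by (simp only: right_diff_distrib left_diff_distrib)
    then have "y * real (n + 1) * (a k * real ((n+1) choose k) - a k * real (n choose k)) = y * a k * (real k * real ((n + 1) choose k))"
      by (metis (no_types, opaque_lifting) mult.assoc mult.left_commute right_diff_distrib)
    then show "a k * exp (- (real k * y)) * real ((n+1) choose k) - a k * real ((n+1) choose k)
      + y * real (n + 1) * (a k * real ((n+1) choose k) - a k * real (n choose k))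
      = (a k * real ((n + 1) choose k)) * exp_remainder (real k * y)"
      unfolding exp_remainder_def by (simp only: algebra_simps)
  qed
  finally show ?thesis .
qed

lemma integrable_jump: "integrable \<mu> (jump f n)"
proof -
  obtain a where a: "\<And>x. x \<le> n + 1 \<Longrightarrow> f x = (\<Sum>k\<le>n+1. a k * real (x choose k))"
    using newton_expansion[of "n + 1" f] by blast
  have "jump f n = (\<lambda>y. \<Sum>k\<le>n+1. (a k * real ((n + 1) choose k)) * exp_remainder (real k * y))"
    by (intro ext jump_newton a)
  then show ?thesis
    by (simp only:) (intro Bochner_Integration.integrable_sum integrable_mult_right integrable_exp_remainder)
qed

lemma G_eq: "G f n = s2 * real n * (dplus f n + dminus f n) + (m + s2) * dplus f n + 1 / real (n + 1) * (LINT y|\<mu>. jump f n y)"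
  unfolding GG_def jump_def ..

text \<open>All parts give multiples of \<open>binom(n,j)\<close>: the two-sided difference
  contributes \<open>s2 * j\<close>, the upward drift \<open>m + s2\<close>, and the jump integral
  is divided by \<open>j + 1\<close> because
  \<open>binom(n+1,j+1) / (n+1) = binom(n,j) / (j+1)\<close>. Together they are
  \<open>rate (Suc j)\<close>.\<close>

lemma G_newton:
  assumes f: "\<And>x. x \<le> n + 1 \<Longrightarrow> f x = (\<Sum>k\<le>n+1. a k * real (x choose k))"
  shows "G f n = (\<Sum>j\<le>n. a (Suc j) * rate (Suc j) * real (n choose j))"
proof -
  let ?b = "\<lambda>k. real n * (real ((n+1) choose k) - real (n choose k)) + real n * (real ((n-1) choose k) - real (n choose k))"
  have d: "dplus f n = (\<Sum>k\<le>n+1. a k * (real ((n+1) choose k) - real (n choose k)))"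
    unfolding dplus_def using f[of n] f[of "n+1"] by (simp add: sum_subtractf right_diff_distrib del: binomial_Suc_Suc sum.atMost_Suc)
  have d': "dminus f n = (\<Sum>k\<le>n+1. a k * (real ((n-1) choose k) - real (n choose k)))"
    unfolding dminus_def using f[of n] f[of "n-1"] by (simp add: sum_subtractf right_diff_distrib del: binomial_Suc_Suc sum.atMost_Suc)
  have j: "(LINT y|\<mu>. jump f n y) = (\<Sum>k\<le>n+1. a k * real ((n + 1) choose k) * (LINT y|\<mu>. exp_remainder (real k * y)))"
  proof -
    have "jump f n = (\<lambda>y. \<Sum>k\<le>n+1. (a k * real ((n + 1) choose k)) * exp_remainder (real k * y))"
      by (intro ext jump_newton f)
    then show ?thesis
      by (simp only:) (subst Bochner_Integration.integral_sum; simp add: integrable_exp_remainder)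
  qed
  let ?t = "\<lambda>k. a k * (s2 * ?b k + (m + s2) * (real ((n+1) choose k) - real (n choose k))
        + real ((n + 1) choose k) * (LINT y|\<mu>. exp_remainder (real k * y)) / real (n + 1))"
  have "G f n = (\<Sum>k\<le>n+1. ?t k)"
    unfolding G_eq d d' j sum_distrib_left sum.distrib[symmetric]
    by (intro sum.cong refl) (simp add: algebra_simps del: binomial_Suc_Suc)
  also have "\<dots> = ?t 0 + (\<Sum>j\<le>n. ?t (Suc j))"
    using sum.atMost_Suc_shift[of ?t n] by simp
  also have "?t 0 = 0" by simp
  also have "0 + (\<Sum>j\<le>n. ?t (Suc j)) = (\<Sum>j\<le>n. a (Suc j) * rate (Suc j) * real (n choose j))"
    unfolding add_0
  proof (rule sum.cong[OF refl])
    fix j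
    let ?c = "real (n choose j)" and ?I = "LINT y|\<mu>. exp_remainder (real (Suc j) * y)"
    have 1: "real ((n+1) choose Suc j) - real (n choose Suc j) = ?c" by simp
    have 2: "real n * (real ((n-1) choose Suc j) - real (n choose Suc j)) = - (real n - real j) * ?c"
      using binomial_pred_real[of n "Suc j"] binomial_absorb_real[of j n] by (simp add: algebra_simps)
    have "real (Suc j) * real ((n+1) choose Suc j) = real (n + 1) * ?c"
      by (metis Suc_eq_plus1 Suc_times_binomial of_nat_mult)
    then have 3: "real ((n+1) choose Suc j) * I / real (n + 1) = ?c * (I / real (Suc j))" for I
      by (simp add: field_simps del: binomial_Suc_Suc)
    show "?t (Suc j) = a (Suc j) * rate (Suc j) * ?c"
      unfolding 1 2 3 rate_def by (simp add: algebra_simps)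
  qed
  finally show ?thesis .
qed

lemma G_local:
  assumes "\<And>k. k \<le> n + 1 \<Longrightarrow> f k = g k" shows "G f n = G g n"
proof -
  obtain a where a: "\<And>x. x \<le> n + 1 \<Longrightarrow> f x = (\<Sum>k\<le>n+1. a k * real (x choose k))"
    using newton_expansion[of "n + 1" f] by blast
  have a': "g x = (\<Sum>k\<le>n+1. a k * real (x choose k))" if "x \<le> n + 1" for x using a[OF that] assms[OF that] by simp
  have "G f n = (\<Sum>j\<le>n. a (Suc j) * rate (Suc j) * real (n choose j))" by (intro G_newton a)
  moreover have "G g n = (\<Sum>j\<le>n. a (Suc j) * rate (Suc j) * real (n choose j))" by (intro G_newton a')
  ultimately show ?thesis by simp
qed

lemma G_lin: "G (\<lambda>x. r * f x + s * g x) n = r * G f n + s * G g n"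
proof -
  obtain a where a: "\<And>x. x \<le> n + 1 \<Longrightarrow> f x = (\<Sum>k\<le>n+1. a k * real (x choose k))"
    using newton_expansion[of "n + 1" f] by blast
  obtain a' where a': "\<And>x. x \<le> n + 1 \<Longrightarrow> g x = (\<Sum>k\<le>n+1. a' k * real (x choose k))"
    using newton_expansion[of "n + 1" g] by blast
  have "G (\<lambda>x. r * f x + s * g x) n = (\<Sum>j\<le>n. (r * a (Suc j) + s * a' (Suc j)) * rate (Suc j) * real (n choose j))"
  proof (rule G_newton)
    show "r * f x + s * g x = (\<Sum>k\<le>n+1. (r * a k + s * a' k) * real (x choose k))" if "x \<le> n + 1" for x
      unfolding a[OF that] a'[OF that] sum_distrib_left sum.distrib[symmetric]
      by (simp add: algebra_simps del: sum.atMost_Suc)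
  qed
  moreover have "G f n = (\<Sum>j\<le>n. a (Suc j) * rate (Suc j) * real (n choose j))" by (intro G_newton a)
  moreover have "G g n = (\<Sum>j\<le>n. a' (Suc j) * rate (Suc j) * real (n choose j))" by (intro G_newton a')
  ultimately show ?thesis by (simp add: sum_distrib_left sum.distrib[symmetric] algebra_simps)
qed

lemma G_binomial: "G (\<lambda>x. real (x choose Suc j)) n = rate (Suc j) * real (n choose j)"
proof -
  have unit: "(\<Sum>k\<in>S. (if k = i then 1 else 0) * g k) = (if i \<in> S then g i else 0)"
    if "finite S" for S :: "nat set" and i and g :: "nat \<Rightarrow> real"
  proof -
    have "(\<Sum>k\<in>S. (if k = i then 1 else 0) * g k) = (\<Sum>k\<in>S. if k = i then g k else 0)"
      by (intro sum.cong) auto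
    then show ?thesis using that by simp
  qed
  have "G (\<lambda>x. real (x choose Suc j)) n = (\<Sum>i\<le>n. (if Suc i = Suc j then 1 else 0) * rate (Suc i) * real (n choose i))"
    by (rule G_newton) (subst unit, auto simp: binomial_eq_0)
  also have "\<dots> = (\<Sum>i\<le>n. (if i = j then 1 else 0) * (rate (Suc i) * real (n choose i)))"
    by (simp add: mult.assoc)
  also have "\<dots> = rate (Suc j) * real (n choose j)"
    by (subst unit) (auto simp: binomial_eq_0)
  finally show ?thesis .
qed

lemma G_const: "G (\<lambda>x. 1) n = 0"
  unfolding G_eq jump_def by (simp add: dil_const dplus_def dminus_def)

text \<open>Of all jumps out of \<open>n\<close> only the one to \<open>n + 1\<close> is kept, and
  its rate is \<open>rate (n + 1)\<close>. In the thinned term it is the event that all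
  \<open>n + 1\<close> individuals survive, of probability \<open>exp (- (n + 1) y)\<close>; the
  compensator adds the rest of \<open>exp_remainder\<close>.\<close>

lemma G_lower:
  assumes f: "\<And>k. 0 \<le> f k" "f n = 0"
  shows "rate (n + 1) * f (n + 1) \<le> G f n"
proof -
  have "exp_remainder (real (n + 1) * y) * f (n + 1) \<le> jump f n y" if y: "0 < y" for y
  proof -
    have "(\<Sum>r\<in>{n+1}. real ((n+1) choose r) * exp (- y) ^ r * (1 - exp (- y)) ^ ((n+1) - r) * f r) \<le> dil (exp (- y)) f (n + 1)"
      unfolding dil_def using f y by (intro sum_mono2) auto
    moreover have "exp (- y) ^ (n + 1) = exp (- (real (n + 1) * y))"
      by (simp only: exp_of_nat_mult[symmetric]) simp
    ultimately have "exp (- (real (n + 1) * y)) * f (n + 1) \<le> dil (exp (- y)) f (n + 1)" by simp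
    then show ?thesis unfolding jump_def dplus_def exp_remainder_def using f(2) by (simp add: algebra_simps)
  qed
  then have "(LINT y|\<mu>. exp_remainder (real (n + 1) * y) * f (n + 1)) \<le> (LINT y|\<mu>. jump f n y)"
    using integrable_exp_remainder[of "n + 1"] integrable_jump AE_pos
    by (intro integral_mono_AE) (auto elim!: eventually_mono)
  then have J: "1 / real (n + 1) * ((LINT y|\<mu>. exp_remainder (real (n + 1) * y)) * f (n + 1)) \<le> 1 / real (n + 1) * (LINT y|\<mu>. jump f n y)"
    by (intro mult_left_mono) auto
  have D: "s2 * real n * f (n + 1) \<le> s2 * real n * (dplus f n + dminus f n)"
    using s2_nonneg f by (intro mult_left_mono) (auto simp: dplus_def dminus_def)
  have "rate (n + 1) * f (n + 1) = s2 * real n * f (n + 1) + (m + s2) * f (n + 1)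
      + 1 / real (n + 1) * ((LINT y|\<mu>. exp_remainder (real (n + 1) * y)) * f (n + 1))"
    unfolding rate_def by (simp add: algebra_simps)
  also have "\<dots> \<le> G f n" unfolding G_eq using D J f(2) by (simp add: dplus_def)
  finally show ?thesis .
qed

lemma G_square:
  "G (\<lambda>x. (real x - real n)\<^sup>2) n = 2 * real n * (rate 2 - rate 1) + rate 1"
proof -
  have c2: "real (x choose 2) = real x * (real x - 1) / 2" for x
    using binomial_absorb_real[of 1 x] by (simp add: numeral_2_eq_2 mult.commute)
  \<comment> \<open>In the binomial basis \<open>G\<close> kills the constant and lowers the degree
    of the other terms, so the result is affine in \<open>n\<close>.\<close>
  have e: "(real x - real n)\<^sup>2 = 1 * (2 * real (x choose Suc 1) + (1 - 2 * real n) * real (x choose Suc 0)) + (real n)\<^sup>2 * 1" for x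
    using c2[of x] by (simp add: numeral_2_eq_2[symmetric] power2_eq_square algebra_simps)
  show ?thesis unfolding e G_lin G_binomial G_const by (simp add: numeral_2_eq_2[symmetric] algebra_simps)
qed

lemma G_real: "G real n = rate 1"
  using G_binomial[of 0 n] by simp

lemma rate_op_G: "rate_op G (rate 1) (2 * rate 2 + rate 1)"
proof
  show "0 \<le> G f n" if "\<And>k. 0 \<le> f k" "f n = 0" for f n
    using G_lower[of f n] that rate_nonneg[of "n+1"] that(1)[of "n+1"] by (meson mult_nonneg_nonneg order_trans)
  show "G (\<lambda>x. (real x - real n)\<^sup>2) n \<le> (2 * rate 2 + rate 1) * (real n + 1)" for n
  proof -
    have "0 \<le> rate 2 + rate 1 * real n * 3" using rate_nonneg by simp
    then show ?thesis unfolding G_square using rate_nonneg[of 2] by (simp add: algebra_simps)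
  qed
  show "G f n = G g n" if "\<And>k. k \<le> n + 1 \<Longrightarrow> f k = g k" for f g n
    using that by (rule G_local)
qed (simp_all add: G_lin G_const G_real rate_nonneg)

sublocale G: rate_op G "rate 1" "2 * rate 2 + rate 1" by (rule rate_op_G)

lemma L_eq: "L f n = G f n + death_op f n"
  by (simp add: LL_def death_op_def)

lemma L_real: "L real n = rate 1 - real n"
  by (cases n) (simp_all add: L_eq G_real death_op_def dminus_def algebra_simps)

lemma rate_op_L: "rate_op L (rate 1) (2 * rate 2 + rate 1 + 1)"
proof
  show "L (\<lambda>x. r * f x + s * g x) n = r * L f n + s * L g n" for r s f g n
    by (simp add: L_eq G_lin death_op_def dminus_def algebra_simps)
  show "L f n = L g n" if "\<And>k. k \<le> n + 1 \<Longrightarrow> f k = g k" for f g n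
    using G_local[OF that, of n] that[of n] that[of "n - 1"] by (simp add: L_eq death_op_def dminus_def)
  show "0 \<le> L f n" if "\<And>k. 0 \<le> f k" "f n = 0" for f n
    using G.minimum[of f n] that by (simp add: L_eq death_op_def dminus_def)
  show "L (\<lambda>x. 1) n = 0" for n by (simp add: L_eq G_const death_op_def dminus_def)
  show "L real n \<le> rate 1" for n by (simp add: L_real)
  show "L (\<lambda>x. (real x - real n)\<^sup>2) n \<le> (2 * rate 2 + rate 1 + 1) * (real n + 1)" for n
  proof -
    have "death_op (\<lambda>x. (real x - real n)\<^sup>2) n \<le> real n + 1" by (cases n) (simp_all add: death_op_def dminus_def)
    then show ?thesis using G.second_moment[of n] by (simp add: L_eq algebra_simps)
  qed
qed (simp_all add: rate_nonneg)

sublocale L: rate_op L "rate 1" "2 * rate 2 + rate 1 + 1" by (rule rate_op_L)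

lemma G_dil: "G (dil \<alpha> f) n = \<alpha> * dil \<alpha> (G f) n"
proof -
  obtain a where a: "\<And>x. x \<le> n + 1 \<Longrightarrow> f x = (\<Sum>k\<le>n+1. a k * real (x choose k))"
    using newton_expansion[of "n + 1" f] by blast
  have Gf: "G f x = (\<Sum>j\<le>n. (a (Suc j) * rate (Suc j)) * real (x choose j))" if "x \<le> n" for x
  proof -
    let ?p = "\<lambda>x. \<Sum>k\<le>n+1. a k * real (x choose k)"
    have "G f x = G ?p x" using that by (intro G_local a) auto
    also have "\<dots> = (\<Sum>k\<le>n+1. a k * G (\<lambda>x. real (x choose k)) x)" by (rule G.op_sum) simp
    also have "\<dots> = a 0 * G (\<lambda>x. real (x choose 0)) x + (\<Sum>j\<le>n. a (Suc j) * G (\<lambda>x. real (x choose Suc j)) x)"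
      using sum.atMost_Suc_shift[of "\<lambda>k. a k * G (\<lambda>x. real (x choose k)) x" n] by simp
    also have "\<dots> = (\<Sum>j\<le>n. (a (Suc j) * rate (Suc j)) * real (x choose j))"
      unfolding G_binomial by (simp add: G_const mult.assoc)
    finally show ?thesis .
  qed
  have "G (dil \<alpha> f) n = (\<Sum>j\<le>n. (a (Suc j) * \<alpha> ^ Suc j) * rate (Suc j) * real (n choose j))"
    by (rule G_newton[OF dil_newton[OF a]]) auto
  moreover have "\<alpha> * dil \<alpha> (G f) n = \<alpha> * (\<Sum>j\<le>n. (a (Suc j) * rate (Suc j) * \<alpha> ^ j) * real (n choose j))"
    by (subst dil_newton[OF Gf]) auto
  ultimately show ?thesis by (simp add: sum_distrib_left mult_ac)
qed

end

section \<open>The dilated semigroup\<close>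

locale self_similar = levy_data +
  fixes Q :: "real \<Rightarrow> (nat \<Rightarrow> real) \<Rightarrow> nat \<Rightarrow> real"
  assumes Q_feller: "feller_semigroup Q" and Q_gen: "generates G Cc Q"
begin

sublocale Q: rate_semigroup G "rate 1" "2 * rate 2 + rate 1" Q
proof
  show "feller_semigroup Q" by (rule Q_feller)
  show "(f, G f) \<in> generator Q" if "f \<in> Cc" for f
    using Q_gen that unfolding generates_def by blast
qed

text \<open>The function \<open>dil \<alpha> (Q (\<alpha> * s) f)\<close> of \<open>s\<close> solves
  the Cauchy problem of \<open>G\<close> started from \<open>dil \<alpha> f\<close>: the chain rule
  produces a factor \<alpha>, and \<open>G_dil\<close> the same one. Density carries this from
  finitely supported \<open>f\<close> to \<open>C0\<close>.\<close>

lemma Q_dil: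
  assumes \<alpha>: "0 < \<alpha>" "\<alpha> \<le> 1" and t: "0 \<le> t" and f: "f \<in> C0"
  shows "Q t (dil \<alpha> f) = dil \<alpha> (Q (\<alpha> * t) f)"
proof -
  have core: "Q t (dil \<alpha> f) = dil \<alpha> (Q (\<alpha> * t) f)" if f: "f \<in> Cc" for f
  proof -
    define u where "u s = dil \<alpha> (Q (\<alpha> * s) f)" for s
    define v where "v s n = \<alpha> * dil \<alpha> (Q (\<alpha> * s) (G f)) n" for s n
    have g: "(f, G f) \<in> generator Q" by (rule Q.on_Cc[OF f])
    note C = Q.generator_C0[OF g]
    have "u t = Q t (u 0)"
    proof (rule Q.cauchy_problem_unique[OF _ _ t])
      show "(u s, v s) \<in> generator Q" if s: "0 \<le> s" for s
      proof -
        have \<alpha>s: "0 \<le> \<alpha> * s" using \<alpha> s by simp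
        have "u s \<in> C0" unfolding u_def using C \<alpha> \<alpha>s by (intro dil_C0 Q.closed)
        moreover have "v s \<in> C0" unfolding v_def[abs_def] using C \<alpha> \<alpha>s by (intro C0_scale dil_C0 Q.closed)
        moreover have "v s = G (u s)"
          unfolding v_def[abs_def] u_def using Q.op_commutes[OF C \<alpha>s] by (auto simp: G_dil)
        ultimately show ?thesis unfolding Q.generator_iff by blast
      qed
      fix s e :: real assume s: "0 \<le> s" and e: "0 < e"
      obtain d where d: "0 < d" "\<And>r y n. 0 \<le> r \<Longrightarrow> 0 \<le> y \<Longrightarrow> y \<noteq> r \<Longrightarrow> \<bar>y - r\<bar> < d \<Longrightarrow>
          \<bar>(Q y f n - Q r f n) / (y - r) - Q r (G f) n\<bar> < e/2"
        using Q.uniform_derivative[OF g half_gt_zero[OF e]] by metis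
      have "\<bar>(u y n - u s n) / (y - s) - v s n\<bar> < e" if y: "0 \<le> y" "y \<noteq> s" "\<bar>y - s\<bar> < d" for y n
      proof -
        let ?w = "\<lambda>n. (Q (\<alpha> * y) f n - Q (\<alpha> * s) f n) / (\<alpha> * y - \<alpha> * s) - Q (\<alpha> * s) (G f) n"
        have "\<bar>\<alpha> * y - \<alpha> * s\<bar> = \<alpha> * \<bar>y - s\<bar>" using \<alpha> by (simp add: right_diff_distrib[symmetric] abs_mult)
        also have "\<dots> \<le> 1 * \<bar>y - s\<bar>" using \<alpha> by (intro mult_right_mono) auto
        finally have "\<bar>\<alpha> * y - \<alpha> * s\<bar> < d" using y by simp
        then have "\<bar>?w n\<bar> \<le> e/2" for n
          using d(2)[of "\<alpha> * s" "\<alpha> * y" n] \<alpha> s y by (intro less_imp_le) auto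
        then have w: "\<bar>dil \<alpha> ?w n\<bar> \<le> e/2" using \<alpha> by (intro dil_contraction) auto
        have "?w = (\<lambda>n. 1 / (\<alpha> * y - \<alpha> * s) * (1 * Q (\<alpha> * y) f n + -1 * Q (\<alpha> * s) f n) + -1 * Q (\<alpha> * s) (G f) n)"
          by simp
        then have "dil \<alpha> ?w n = 1 / (\<alpha> * y - \<alpha> * s) * (u y n - u s n) - dil \<alpha> (Q (\<alpha> * s) (G f)) n"
          by (simp only: dil_combination u_def) simp
        then have "\<alpha> * dil \<alpha> ?w n = (\<alpha> * (1 / (\<alpha> * y - \<alpha> * s))) * (u y n - u s n) - v s n"
          by (simp only: v_def right_diff_distrib[of \<alpha> "_ * _"] mult.assoc)
        moreover have "\<alpha> * (1 / (\<alpha> * y - \<alpha> * s)) = 1 / (y - s)"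
          using \<alpha> y by (simp only: right_diff_distrib[symmetric]) simp
        ultimately have "\<alpha> * dil \<alpha> ?w n = (u y n - u s n) / (y - s) - v s n" by (simp only:) simp
        moreover have "\<bar>\<alpha> * dil \<alpha> ?w n\<bar> \<le> 1 * (e/2)"
          unfolding abs_mult using w \<alpha> by (intro mult_mono) auto
        ultimately show ?thesis using e by simp
      qed
      then show "\<exists>d>0. \<forall>y\<ge>0. y \<noteq> s \<and> \<bar>y - s\<bar> < d \<longrightarrow> (\<forall>n. \<bar>(u y n - u s n) / (y - s) - v s n\<bar> < e)"
        using d(1) by blast
    qed
    then show ?thesis using Q.at_0[OF C(1)] by (simp add: u_def)
  qed
  show ?thesis
  proof
    fix n
    have \<alpha>t: "0 \<le> \<alpha> * t" using \<alpha> t by simp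
    have "\<bar>Q t (dil \<alpha> f) n - dil \<alpha> (Q (\<alpha> * t) f) n\<bar> \<le> 0 + e" if e: "0 < e" for e
    proof -
      obtain g where g: "g \<in> Cc" "\<And>n. \<bar>f n - g n\<bar> < e/2" using Cc_dense[OF f half_gt_zero[OF e]] by blast
      note gC = Cc_subset_C0[OF g(1)]
      have le: "\<bar>f n - g n\<bar> \<le> e/2" for n using g(2)[of n] by simp
      have "\<bar>dil \<alpha> f n - dil \<alpha> g n\<bar> \<le> e/2" for n
        unfolding dil_diff[symmetric] using le \<alpha> by (intro dil_contraction) auto
      then have 1: "\<bar>Q t (dil \<alpha> f) n - Q t (dil \<alpha> g) n\<bar> \<le> e/2"
        using f gC \<alpha> t by (intro Q.contraction_diff dil_C0) auto
      have "\<bar>Q (\<alpha> * t) f n - Q (\<alpha> * t) g n\<bar> \<le> e/2" for n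
        using f gC le \<alpha>t by (intro Q.contraction_diff) auto
      then have 2: "\<bar>dil \<alpha> (Q (\<alpha> * t) f) n - dil \<alpha> (Q (\<alpha> * t) g) n\<bar> \<le> e/2"
        unfolding dil_diff[symmetric] using \<alpha> by (intro dil_contraction) auto
      show ?thesis using 1 2 fun_cong[OF core[OF g(1)], of n] by linarith
    qed
    then have "\<bar>Q t (dil \<alpha> f) n - dil \<alpha> (Q (\<alpha> * t) f) n\<bar> \<le> 0" by (rule field_le_epsilon)
    then show "Q t (dil \<alpha> f) n = dil \<alpha> (Q (\<alpha> * t) f) n" by simp
  qed
qed

text \<open>The asserted formula is taken as the definition; semigroup law, continuity and generator
  are then verified for it.\<close>

definition K :: "real \<Rightarrow> (nat \<Rightarrow> real) \<Rightarrow> nat \<Rightarrow> real" where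
  "K t f = Q (exp t - 1) (dil (exp (- t)) f)"

lemma dil_exp_C0: "0 \<le> t \<Longrightarrow> f \<in> C0 \<Longrightarrow> dil (exp (- t)) f \<in> C0"
  by (intro dil_C0) auto

lemma K_alt:
  assumes "0 \<le> t" "f \<in> C0"
  shows "K t f = dil (exp (- t)) (Q (1 - exp (- t)) f)"
  using Q_dil[of "exp (- t)" "exp t - 1" f] assms by (simp add: K_def right_diff_distrib exp_minus_inverse mult.commute)

lemma K_strongly_continuous:
  assumes f: "f \<in> C0" and e: "0 < e"
  shows "\<exists>d>0. \<forall>t. 0 < t \<and> t < d \<longrightarrow> (\<forall>n. \<bar>K t f n - f n\<bar> < e)"
proof -
  obtain d1 where d1: "0 < d1" "\<And>t n. 0 \<le> t \<Longrightarrow> t < d1 \<Longrightarrow> \<bar>dil (exp (- t)) f n - f n\<bar> < e/2"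
    using dil_strongly_continuous[OF f half_gt_zero[OF e]] by metis
  obtain d2 where d2: "0 < d2" "\<And>t n. 0 \<le> t \<Longrightarrow> t < d2 \<Longrightarrow> \<bar>Q t f n - f n\<bar> < e/2"
    using Q.strongly_continuous[OF f half_gt_zero[OF e]] by metis
  have "\<bar>K t f n - f n\<bar> < e" if t: "0 < t" "t < min d1 (ln (1 + d2))" for t n
  proof -
    have "exp t < exp (ln (1 + d2))" using t by simp
    then have s: "0 \<le> exp t - 1" "exp t - 1 < d2" using t d2 by auto
    have "\<bar>K t f n - Q (exp t - 1) f n\<bar> \<le> e/2"
      unfolding K_def using d1(2)[of t] t s f by (intro Q.contraction_diff dil_exp_C0) (auto intro: less_imp_le simp del: le_divide_eq_numeral1)
    then show ?thesis using d2(2)[OF s, of n] by linarith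
  qed
  moreover have "0 < min d1 (ln (1 + d2))" using d1 d2 by simp
  ultimately show ?thesis by blast
qed

lemma K_feller: "feller_semigroup K"
  unfolding feller_semigroup_def
proof (intro conjI allI ballI impI)
  show "K t f \<in> C0" if "0 \<le> t" "f \<in> C0" for t f
    unfolding K_def using that by (intro Q.closed dil_exp_C0) auto
  show "K t (\<lambda>n. a * f n + b * g n) = (\<lambda>n. a * K t f n + b * K t g n)"
    if "0 \<le> t" "f \<in> C0" "g \<in> C0" for t f g a b
  proof
    have "dil (exp (- t)) (\<lambda>n. a * f n + b * g n) = (\<lambda>n. a * dil (exp (- t)) f n + b * dil (exp (- t)) g n)"
      by (rule ext) (rule dil_combination)
    then show "K t (\<lambda>n. a * f n + b * g n) n = a * K t f n + b * K t g n" for n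
      unfolding K_def using that by (simp add: Q.combination dil_exp_C0)
  qed
  show "0 \<le> K t f n" if "0 \<le> t" "f \<in> C0" "\<forall>n. 0 \<le> f n \<and> f n \<le> 1" for t f n
  proof -
    have "0 \<le> dil (exp (- t)) f k" for k
      using dil_mono[of "exp (- t)" k "\<lambda>_. 0" f] that by (simp add: dil_const)
    then show ?thesis unfolding K_def using that by (intro Q.nonneg dil_exp_C0) auto
  qed
  show "K t f n \<le> 1" if "0 \<le> t" "f \<in> C0" "\<forall>n. 0 \<le> f n \<and> f n \<le> 1" for t f n
  proof -
    have "dil (exp (- t)) f k \<le> 1" for k
      using dil_mono[of "exp (- t)" k f "\<lambda>_. 1"] that by (simp add: dil_const)
    then show ?thesis unfolding K_def using that by (intro Q.upper_bound dil_exp_C0) auto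
  qed
  show "K 0 f = f" if "f \<in> C0" for f
  proof -
    have "dil 1 f = f" by (rule ext) (rule dil_1)
    then show ?thesis using Q.at_0[OF that] by (simp add: K_def)
  qed
  show "K (s + t) f = K s (K t f)" if s: "0 \<le> s" and t: "0 \<le> t" and f: "f \<in> C0" for s t f
  proof -
    have D: "dil (exp (- s)) (dil (exp (- t)) f) = dil (exp (- (s + t))) f"
      by (rule ext) (simp add: dil_dil exp_add[symmetric])
    have "K s (K t f) = Q (exp s - 1) (dil (exp (- s)) (Q (exp t - 1) (dil (exp (- t)) f)))"
      by (simp add: K_def)
    \<comment> \<open>The time \<open>exp t - 1\<close> is written as \<open>exp (- s)\<close> times
      another time, so that \<open>Q_dil\<close> can be read from right to left.\<close>
    also have "dil (exp (- s)) (Q (exp t - 1) (dil (exp (- t)) f))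
        = dil (exp (- s)) (Q (exp (- s) * (exp s * (exp t - 1))) (dil (exp (- t)) f))"
      by (simp add: mult.assoc[symmetric] exp_minus_inverse mult.commute[of "exp (- s)"])
    also have "\<dots> = Q (exp s * (exp t - 1)) (dil (exp (- s)) (dil (exp (- t)) f))"
      using s t f by (intro Q_dil[symmetric] dil_exp_C0) auto
    also have "Q (exp s - 1) \<dots> = Q ((exp s - 1) + exp s * (exp t - 1)) (dil (exp (- s)) (dil (exp (- t)) f))"
      using s t f by (intro Q.semigroup[symmetric] dil_exp_C0) auto
    also have "(exp s - 1) + exp s * (exp t - 1) = exp (s + t) - 1" by (simp add: exp_add algebra_simps)
    finally show ?thesis unfolding D K_def ..
  qed
  show "uniform_limit UNIV (\<lambda>t. K t f) f (at_right 0)" if "f \<in> C0" for f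
    unfolding uniform_limit_right_iff using K_strongly_continuous[OF that] by blast
qed

text \<open>The increment splits into the second-order error of thinning, the motion of
  \<open>death_op f\<close> under \<open>Q\<close>, and the increment of \<open>f\<close> under
  \<open>Q\<close> over the time \<open>exp t - 1\<close>, which equals \<open>t\<close> up to a
  factor tending to 1.\<close>

lemma K_on_Cc:
  assumes f: "f \<in> Cc"
  shows "(f, L f) \<in> generator K"
proof -
  have g: "(f, G f) \<in> generator Q" by (rule Q.on_Cc[OF f])
  note C = Q.generator_C0[OF g]
  have EC: "death_op f \<in> C0" by (rule Cc_subset_C0[OF death_op_Cc[OF f]])
  obtain B1 where B1: "0 < B1" "\<And>n. \<bar>death_op (death_op f) n\<bar> \<le> B1"
    using C0_bounded[OF Cc_subset_C0[OF death_op_Cc[OF death_op_Cc[OF f]]]] by blast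
  obtain B2 where B2: "0 < B2" "\<And>n. \<bar>G f n\<bar> \<le> B2" using C0_bounded[OF C(2)] by blast
  have "\<exists>d>0. \<forall>t. 0 < t \<and> t < d \<longrightarrow> (\<forall>n. \<bar>(K t f n - f n) / t - L f n\<bar> < e)" if e: "0 < e" for e
  proof -
    have e8: "0 < e/8" using e by simp
    obtain d1 where d1: "0 < d1" "\<And>t n. 0 \<le> t \<Longrightarrow> t < d1 \<Longrightarrow> \<bar>Q t (death_op f) n - death_op f n\<bar> < e/8"
      using Q.strongly_continuous[OF EC e8] by metis
    obtain d2 where d2: "0 < d2" "\<And>t n. 0 < t \<Longrightarrow> t < d2 \<Longrightarrow> \<bar>(Q t f n - f n) / t - G f n\<bar> < e/8"
      using Q.generatorE[OF g e8] by metis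
    \<comment> \<open>The quotients by \<open>B1\<close> and \<open>B2\<close> make
      \<open>t * B1\<close> and \<open>t * B2\<close> smaller than \<open>e/8\<close>; the logarithm
      makes \<open>exp t - 1\<close> smaller than \<open>d1\<close> and \<open>d2\<close>.\<close>
    define d where "d = min (min 1 (e / (8 * B1))) (min (e / (8 * B2)) (ln (1 + min d1 d2)))"
    have "0 < d" using e B1 B2 d1 d2 by (simp add: d_def)
    moreover have "\<bar>(K t f n - f n) / t - L f n\<bar> < e" if t: "0 < t" "t < d" for t n
    proof -
      define s where "s = exp t - 1"
      have "exp t < exp (ln (1 + min d1 d2))" using t by (simp add: d_def)
      then have s: "0 < s" "s < d1" "s < d2" using t d1 d2 by (auto simp: s_def)
      \<comment> \<open>\<open>r\<close> converts quotients over \<open>s\<close> into quotients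
        over \<open>t\<close>; it lies between 1 and \<open>1 + t\<close>.\<close>
      define r where "r = s / t"
      have "exp t \<le> 1 + t + t\<^sup>2" using t by (intro exp_bound) (auto simp: d_def)
      then have "s \<le> t * (1 + t)" by (simp add: s_def power2_eq_square algebra_simps)
      then have r2: "r \<le> 1 + t" using t by (simp add: r_def divide_le_eq mult.commute)
      have "t \<le> exp t - 1" using exp_ge_add_one_self[of t] by linarith
      then have r1: "1 \<le> r" using t by (simp add: r_def s_def le_divide_eq)
      have small: "t * B1 < e/8" "t * B2 < e/8" "t < 1"
        using t B1 B2 by (auto simp: d_def less_divide_eq mult.commute mult.left_commute)
      have X: "\<bar>(Q s (dil (exp (- t)) f) n - Q s (\<lambda>n. f n + t * death_op f n) n) / t\<bar> \<le> t * B1"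
      proof -
        have "\<bar>Q s (dil (exp (- t)) f) n - Q s (\<lambda>n. f n + t * death_op f n) n\<bar> \<le> t * t * B1"
          using s t C EC B1 dil_increment2[of t f B1]
          by (intro Q.contraction_diff dil_exp_C0 C0_add C0_scale) (auto simp: algebra_simps)
        then show ?thesis using t by (simp add: abs_divide divide_le_eq mult.commute mult.left_commute)
      qed
      have Y: "\<bar>Q s (death_op f) n - death_op f n\<bar> < e/8" using s by (intro d1(2)) auto
      have Z: "\<bar>(Q s f n - f n) / t - G f n\<bar> \<le> e/4 + e/8"
      proof -
        let ?x = "(Q s f n - f n) / s"
        have "(Q s f n - f n) / t - G f n = (?x - G f n) * r + G f n * (r - 1)"
          using s t by (simp add: r_def field_simps)
        then have "\<bar>(Q s f n - f n) / t - G f n\<bar> \<le> \<bar>?x - G f n\<bar> * \<bar>r\<bar> + \<bar>G f n\<bar> * \<bar>r - 1\<bar>"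
          by (metis abs_mult abs_triangle_ineq)
        also have "\<dots> \<le> (e/8) * 2 + B2 * t"
          using d2(2)[OF s(1,3), of n] B2(2)[of n] r1 r2 small e B2 by (intro add_mono mult_mono) auto
        finally show ?thesis using small by (simp add: mult.commute)
      qed
      have "(K t f n - f n) / t - L f n = (Q s (dil (exp (- t)) f) n - Q s (\<lambda>n. f n + t * death_op f n) n) / t
          + (Q s (death_op f) n - death_op f n) + ((Q s f n - f n) / t - G f n)"
        using s t C EC by (simp add: K_def L_eq s_def[symmetric] Q.add Q.scale C0_scale field_simps)
      then show ?thesis using X Y Z small e by linarith
    qed
    ultimately show ?thesis by blast
  qed
  moreover have "L f \<in> C0" unfolding L_eq[abs_def] using C EC by (intro C0_add)
  ultimately show ?thesis using C unfolding generator_def uniform_limit_right_iff by auto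
qed

sublocale K: rate_semigroup L "rate 1" "2 * rate 2 + rate 1 + 1" K
  by unfold_locales (use K_feller K_on_Cc in auto)

end

section \<open>The invariant distribution\<close>

abbreviation mean :: "nat pmf \<Rightarrow> (nat \<Rightarrow> real) \<Rightarrow> real" where
  "mean p f \<equiv> measure_pmf.expectation p f"

lemma integrable_pmf_bounded:
  fixes f :: "nat \<Rightarrow> real"
  assumes "\<And>n. \<bar>f n\<bar> \<le> B" shows "integrable (measure_pmf p) f"
  by (rule measure_pmf.integrable_const_bound[of _ B]) (use assms in auto)

lemma integrable_pmf_C0: "f \<in> C0 \<Longrightarrow> integrable (measure_pmf p) f"
  by (metis C0_bounded integrable_pmf_bounded)

lemma mean_bound:
  fixes f :: "nat \<Rightarrow> real"
  assumes "\<And>n. \<bar>f n\<bar> \<le> B" shows "\<bar>mean p f\<bar> \<le> B"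
proof -
  have "f n \<le> B" "- B \<le> f n" for n using assms[of n] by auto
  then have "mean p f \<le> B" "- B \<le> mean p f"
    using integrable_pmf_bounded[OF assms]
    by (auto intro!: measure_pmf.integral_le_const measure_pmf.integral_ge_const)
  then show ?thesis by (rule abs_leI[OF _ minus_le_iff[THEN iffD1]])
qed

lemma pmf_eqI_C0:
  assumes "\<And>f. f \<in> C0 \<Longrightarrow> mean p f = mean q f"
  shows "p = q"
proof (rule pmf_eqI)
  fix n :: nat
  have "mean r (indicator {n}) = pmf r n" for r :: "nat pmf"
    by (simp add: measure_pmf_single)
  then show "pmf p n = pmf q n" using assms[OF Cc_subset_C0[OF Cc_indicator[of "{n}"]]] by simp
qed

section \<open>Transition kernels\<close>

context feller
begin

lemma kernel_exists:
  assumes "0 \<le> t" "(\<lambda>k. P t (indicator {k}) n) sums 1"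
  shows "\<exists>p. \<forall>f\<in>C0. mean p f = P t f n"
proof -
  have ind: "indicator {k} \<in> C0" for k :: nat by (intro Cc_subset_C0 Cc_indicator) simp
  have nn: "0 \<le> P t (indicator {k}) n" for k using assms ind by (intro nonneg) auto
  define p where "p = embed_pmf (\<lambda>k. P t (indicator {k}) n)"
  have p: "pmf p k = P t (indicator {k}) n" for k
    unfolding p_def
  proof (rule pmf_embed_pmf[OF nn])
    show "(\<integral>\<^sup>+ k. ennreal (P t (indicator {k}) n) \<partial>count_space UNIV) = 1"
      unfolding nn_integral_count_space_nat using suminf_ennreal_eq[OF nn assms(2)] by simp
  qed
  have Cc: "mean p f = P t f n" if f: "f \<in> Cc" for f
  proof -
    obtain N where N: "\<And>k. k \<ge> N \<Longrightarrow> f k = 0" using f unfolding Cc_iff by blast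
    have "f = (\<lambda>x. \<Sum>k<N. f k * indicator {k} x)"
    proof
      fix x
      have "(\<Sum>k<N. f k * indicator {k} x) = (\<Sum>k<N. if x = k then f k else 0)"
        by (intro sum.cong) (auto simp: indicator_def)
      then show "f x = (\<Sum>k<N. f k * indicator {k} x)" using N[of x] by simp
    qed
    then have "P t f n = P t (\<lambda>x. \<Sum>k<N. f k * indicator {k} x) n" by simp
    also have "\<dots> = (\<Sum>k<N. P t (\<lambda>x. f k * indicator {k} x) n)"
      using sum[of t "{..<N}" "\<lambda>k x. f k * indicator {k} x" n] assms(1) by (simp add: C0_scale ind)
    also have "\<dots> = (\<Sum>k<N. pmf p k *\<^sub>R f k)"
      using assms(1) by (simp add: scale ind p mult.commute)
    also have "\<dots> = mean p f"
      by (rule integral_measure_pmf[symmetric]) (use N in \<open>auto simp: not_le[symmetric]\<close>)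
    finally show ?thesis by simp
  qed
  have "mean p f = P t f n" if f: "f \<in> C0" for f
  proof -
    have "\<bar>mean p f - P t f n\<bar> \<le> 0 + e" if e: "0 < e" for e
    proof -
      obtain g where g: "g \<in> Cc" "\<And>n. \<bar>f n - g n\<bar> < e/2" using Cc_dense[OF f half_gt_zero[OF e]] by blast
      note gC = Cc_subset_C0[OF g(1)]
      have "\<bar>mean p (\<lambda>n. f n - g n)\<bar> \<le> e/2" using g(2) by (intro mean_bound less_imp_le)
      then have "\<bar>mean p f - mean p g\<bar> \<le> e/2"
        using f gC by (simp add: integrable_pmf_C0 del: le_divide_eq_numeral1)
      moreover have "\<bar>P t f n - P t g n\<bar> \<le> e/2"
        using less_imp_le[OF g(2)] by (intro contraction_diff assms(1) f gC)
      ultimately show ?thesis using Cc[OF g(1)] by linarith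
    qed
    then have "\<bar>mean p f - P t f n\<bar> \<le> 0" by (rule field_le_epsilon)
    then show ?thesis by simp
  qed
  then show ?thesis by blast
qed

end

context rate_semigroup
begin

definition kernel :: "real \<Rightarrow> nat \<Rightarrow> nat pmf" where
  "kernel t n = (SOME p. \<forall>f\<in>C0. mean p f = P t f n)"

lemma kernel: "0 \<le> t \<Longrightarrow> f \<in> C0 \<Longrightarrow> mean (kernel t n) f = P t f n"
  using someI_ex[OF kernel_exists[OF _ conservative]] unfolding kernel_def by blast

end

text \<open>The weight \<open>h\<close> is an integrating factor: with
  \<open>h s = exp (d * s)\<close>, the lower bound \<open>- d * P s f n\<close> for
  \<open>P s g n\<close> becomes monotonicity of the weighted orbit.\<close>

lemma orbit_increment_mvt:
  assumes "feller P" "(f, g) \<in> generator P" "0 < t"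
  assumes h: "\<And>s. 0 \<le> s \<Longrightarrow> s \<le> t \<Longrightarrow> (h has_real_derivative h' s) (at s within {0..t})"
  shows "\<exists>z. 0 < z \<and> z < t \<and> h t * P t f n - h 0 * f n = t * (h' z * P z f n + h z * P z g n)"
proof -
  interpret feller P by fact
  have "\<exists>z\<in>{0<..<t}. h t * P t f n - h 0 * P 0 f n = (\<lambda>x. (h' z * P z f n + P z g n * h z) * x) (t - 0)"
  proof (rule mvt_simple[OF assms(3)])
    fix s assume s: "0 \<le> s" "s \<le> t"
    have "((\<lambda>s. P s f n) has_real_derivative P s g n) (at s within {0..t})"
      using s by (intro DERIV_subset[OF has_derivative_orbit[OF assms(2)]]) auto
    from DERIV_mult[OF h[OF s] this]
    show "((\<lambda>s. h s * P s f n) has_derivative (\<lambda>x. (h' s * P s f n + P s g n * h s) * x)) (at s within {0..t})"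
      by (simp add: has_field_derivative_def)
  qed
  then show ?thesis using at_0 generator_C0[OF assms(2)] by (auto simp: mult.commute)
qed

section \<open>The law of \<open>Q\<close> at time 1 started from 0: invariance, positivity and
  moments\<close>

context self_similar
begin

definition nu :: "nat pmf" where
  "nu = Q.kernel 1 0"

lemma mean_nu: "f \<in> C0 \<Longrightarrow> mean nu f = Q 1 f 0"
  unfolding nu_def by (rule Q.kernel) auto

lemma K_limit:
  assumes f: "f \<in> C0"
  shows "(\<lambda>i. K (real i) f n) \<longlonglongrightarrow> Q 1 f 0"
  unfolding LIMSEQ_iff
proof (intro allI impI)
  fix e :: real assume e: "0 < e"
  let ?a = "\<lambda>i. exp (- real i)"
  have a0: "?a \<longlonglongrightarrow> 0"
    by (rule filterlim_compose[OF exp_at_bot]) (simp add: filterlim_uminus_at_bot filterlim_real_sequentially)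
  obtain d where d: "0 < d" "\<And>t n. 0 \<le> t \<Longrightarrow> t < d \<Longrightarrow> \<bar>Q t f n - f n\<bar> < e/2"
    using Q.strongly_continuous[OF f half_gt_zero[OF e]] by metis
  have "(\<lambda>i. dil (?a i) (Q 1 f) n) \<longlonglongrightarrow> (\<Sum>r=0..n. real (n choose r) * 0 ^ r * (1 - 0) ^ (n - r) * Q 1 f r)"
    unfolding dil_def by (intro tendsto_intros a0)
  \<comment> \<open>At thinning parameter 0 only the term \<open>r = 0\<close> survives, with
    \<open>0 ^ 0 = 1\<close>.\<close>
  also have "(\<Sum>r=0..n. real (n choose r) * 0 ^ r * (1 - 0) ^ (n - r) * Q 1 f r) = (\<Sum>r\<in>{0}. Q 1 f r)"
    by (rule sum.mono_neutral_cong_right) auto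
  finally have "(\<lambda>i. dil (?a i) (Q 1 f) n) \<longlonglongrightarrow> Q 1 f 0" by simp
  then obtain N1 where N1: "\<And>i. i \<ge> N1 \<Longrightarrow> \<bar>dil (?a i) (Q 1 f) n - Q 1 f 0\<bar> < e/2"
    using half_gt_zero[OF e] unfolding LIMSEQ_iff real_norm_def by blast
  obtain N2 where N2: "\<And>i. i \<ge> N2 \<Longrightarrow> ?a i < d"
    using a0 d(1) unfolding LIMSEQ_iff by fastforce
  have "norm (K (real i) f n - Q 1 f 0) < e" if i: "i \<ge> max N1 N2" for i
  proof -
    have "Q ((1 - ?a i) + ?a i) f = Q (1 - ?a i) (Q (?a i) f)" using f by (intro Q.semigroup) auto
    then have Q1: "Q 1 f = Q (1 - ?a i) (Q (?a i) f)" by simp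
    have "\<bar>f n - Q (?a i) f n\<bar> \<le> e/2" for n using d(2)[of "?a i" n] N2[of i] i by (simp add: abs_minus_commute del: le_divide_eq_numeral1)
    then have "\<bar>Q (1 - ?a i) f n - Q 1 f n\<bar> \<le> e/2" for n
      unfolding Q1 using f by (intro Q.contraction_diff Q.closed) auto
    then have "\<bar>dil (?a i) (Q (1 - ?a i) f) n - dil (?a i) (Q 1 f) n\<bar> \<le> e/2"
      unfolding dil_diff[symmetric] by (intro dil_contraction) auto
    moreover have "K (real i) f n = dil (?a i) (Q (1 - ?a i) f) n" using K_alt[of "real i" f] f by simp
    moreover have "\<bar>dil (?a i) (Q 1 f) n - Q 1 f 0\<bar> < e/2" using i by (intro N1) simp
    ultimately show ?thesis unfolding real_norm_def by linarith
  qed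
  then show "\<exists>no. \<forall>i\<ge>no. norm (K (real i) f n - Q 1 f 0) < e" by blast
qed

text \<open>The times add up to \<open>1 + (exp t - 1) = exp t\<close>, which \<open>Q_dil\<close>
  rescales to 1, and thinning has no effect at the state 0.\<close>

lemma invariant_nu: "invariant_distribution K nu"
  unfolding invariant_distribution_def
proof (intro allI impI ballI)
  fix t :: real and f :: "nat \<Rightarrow> real" assume t: "0 \<le> t" and f: "f \<in> C0"
  have D: "dil (exp (- t)) f \<in> C0" by (rule dil_exp_C0[OF t f])
  have "mean nu (K t f) = Q 1 (Q (exp t - 1) (dil (exp (- t)) f)) 0"
    using mean_nu[OF K.closed[OF t f]] by (simp add: K_def)
  also have "\<dots> = Q (1 + (exp t - 1)) (dil (exp (- t)) f) 0"
    using t by (subst Q.semigroup[OF _ _ D]) auto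
  also have "\<dots> = dil (exp (- t)) (Q (exp (- t) * exp t) f) 0"
    using Q_dil[of "exp (- t)" "exp t" f] t f by simp
  also have "\<dots> = Q 1 f 0" by (simp add: dil_at_0 exp_minus_inverse mult.commute[of "exp (- t)"])
  finally show "mean nu (K t f) = mean nu f"
    using mean_nu[OF f] by simp
qed

text \<open>\<open>K i f\<close> converges to the same constant from every starting state, while its
  integral under an invariant law does not depend on \<open>i\<close>; dominated convergence equates
  the two.\<close>

lemma invariant_unique:
  assumes "invariant_distribution K \<nu>" shows "\<nu> = nu"
proof (rule pmf_eqI_C0)
  fix f assume f: "f \<in> C0"
  obtain B where B: "0 < B" "\<And>n. \<bar>f n\<bar> \<le> B" using C0_bounded[OF f] by blast
  have "(\<lambda>i. mean \<nu> (K (real i) f)) \<longlonglongrightarrow> mean \<nu> (\<lambda>_. Q 1 f 0)"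
  proof (rule integral_dominated_convergence[where w = "\<lambda>_. B"])
    show "AE n in measure_pmf \<nu>. norm (K (real i) f n) \<le> B" for i
      using K.contraction[of "real i" f B] f B by simp
  qed (use K_limit[OF f] in auto)
  moreover have "mean \<nu> (K (real i) f) = mean \<nu> f" for i
    using assms f unfolding invariant_distribution_def by simp
  ultimately show "mean \<nu> f = mean nu f"
    using mean_nu[OF f] by (simp add: LIMSEQ_const_iff)
qed

lemma exp_derivative: "((\<lambda>s. exp (d * s)) has_real_derivative d * exp (d * s)) (at s within S)" for d :: real
  by (auto intro!: derivative_eq_intros)

text \<open>Induction downwards from the target: the state \<open>n\<close> is kept with positive
  probability, and a state \<open>k\<close> below it climbs to \<open>k + 1\<close> at the positive
  rate \<open>rate (k + 1)\<close>.\<close>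

lemma Q_indicator_pos:
  assumes "\<And>j. 0 < rate (Suc j)" and "k \<le> n" "0 < t"
  shows "0 < Q t (indicator {n}) k"
  using assms(2,3)
proof (induction k arbitrary: t rule: inc_induct)
  case base
  let ?f = "indicator {n} :: nat \<Rightarrow> real"
  have g: "(?f, G ?f) \<in> generator Q" by (intro Q.on_Cc Cc_indicator) simp
  note C = Q.generator_C0[OF g]
  \<comment> \<open>\<open>d\<close> is the total rate of leaving \<open>n\<close>; multiplied by
    \<open>exp (d * s)\<close>, the probability of being at \<open>n\<close> does not fall below its
    initial value 1.\<close>
  define d where "d = - G ?f n"
  have lower: "- d * Q s ?f n \<le> Q s (G ?f) n" if "0 \<le> s" for s
  proof -
    have nn: "0 \<le> Q s ?f k" for k using that C by (intro Q.nonneg) auto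
    have "0 \<le> G (\<lambda>x. Q s ?f x - Q s ?f n * ?f x) n"
      by (rule G.minimum) (use nn in \<open>auto simp: indicator_def\<close>)
    then show ?thesis using Q.op_commutes[OF C that] unfolding G.op_diff G.op_scale by (simp add: d_def mult.commute)
  qed
  obtain z where z: "0 < z" "z < t" "exp (d * t) * Q t ?f n - exp (d * 0) * ?f n = t * (d * exp (d * z) * Q z ?f n + exp (d * z) * Q z (G ?f) n)"
    using orbit_increment_mvt[OF Q.feller_axioms g base, of "\<lambda>s. exp (d * s)" "\<lambda>s. d * exp (d * s)" n, OF exp_derivative]
    by blast
  have "0 \<le> t * (exp (d * z) * (d * Q z ?f n + Q z (G ?f) n))"
    using lower[of z] z base by (intro mult_nonneg_nonneg) auto
  then have "1 \<le> exp (d * t) * Q t ?f n" using z by (simp add: algebra_simps)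
  then show ?case by (smt (verit) exp_gt_zero mult_nonneg_nonpos)
next
  case (step k)
  let ?f = "indicator {n} :: nat \<Rightarrow> real" and ?h = "indicator {k} :: nat \<Rightarrow> real"
  have g: "(?f, G ?f) \<in> generator Q" by (intro Q.on_Cc Cc_indicator) simp
  note C = Q.generator_C0[OF g]
  define d where "d = - G ?h k"
  have lower: "- d * Q s ?f k < Q s (G ?f) k" if s: "0 < s" for s
  proof -
    have nn: "0 \<le> Q s ?f j" for j using s C by (intro Q.nonneg) auto
    let ?u = "\<lambda>x. Q s ?f x - Q s ?f k * ?h x"
    have "0 < rate (k + 1) * ?u (k + 1)"
      using step.IH[OF s] assms(1)[of k] by simp
    also have "\<dots> \<le> G ?u k"
      by (rule G_lower) (use nn in \<open>auto simp: indicator_def\<close>)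
    finally show ?thesis using Q.op_commutes[OF C less_imp_le[OF s]] unfolding G.op_diff G.op_scale by (simp add: d_def mult.commute)
  qed
  obtain z where z: "0 < z" "z < t" "exp (d * t) * Q t ?f k - exp (d * 0) * ?f k = t * (d * exp (d * z) * Q z ?f k + exp (d * z) * Q z (G ?f) k)"
    using orbit_increment_mvt[OF Q.feller_axioms g step.prems, of "\<lambda>s. exp (d * s)" "\<lambda>s. d * exp (d * s)" k, OF exp_derivative]
    by blast
  have "0 < t * (exp (d * z) * (d * Q z ?f k + Q z (G ?f) k))"
    using lower[of z] z step.prems by (intro mult_pos_pos) auto
  moreover have "exp (d * t) * Q t ?f k = ?f k + t * (exp (d * z) * (d * Q z ?f k + Q z (G ?f) k))"
    using z(3) by (simp add: algebra_simps)
  ultimately have "0 < exp (d * t) * Q t ?f k" using indicator_pos_le[of "{n}" k, where 'a = real] by linarith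
  then show ?case by (simp add: zero_less_mult_iff)
qed

lemma nu_pos: "(\<And>j. 0 < rate (Suc j)) \<Longrightarrow> 0 < pmf nu n"
  using Q_indicator_pos[of 0 n 1] mean_nu[OF Cc_subset_C0[OF Cc_indicator[of "{n}"]]]
  by (simp add: measure_pmf_single)

text \<open>Capping at \<open>N\<close> turns an unbounded test function into a constant minus a finitely supported one.\<close>

lemma capped_binomial_moment:
  assumes C: "0 < C" "\<And>k. 0 < k \<Longrightarrow> rate k \<le> C * real k" and s: "0 \<le> s"
  shows "real (N choose k) - Q s (\<lambda>x. real (N choose k) - real (min x N choose k)) 0 \<le> (C * s) ^ k"
  using s
proof (induction k arbitrary: s)
  case 0
  have "Q s (\<lambda>_. 0) 0 = 0" using Q.scale[OF 0 C0_zero, of 0 0] by simp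
  then show ?case by simp
next
  case (Suc k)
  define W where "W j x = real (N choose j) - real (min x N choose j)" for j x
  have W: "W j \<in> Cc" for j unfolding Cc_iff W_def by (intro exI[of _ N]) auto
  have g: "(W (Suc k), G (W (Suc k))) \<in> generator Q" by (rule Q.on_Cc[OF W])
  note CC = Q.generator_C0[OF g]
  \<comment> \<open>Strictly below \<open>N\<close> the cap is invisible to \<open>G\<close>, which
    sees at most \<open>N\<close> itself, and the binomial identity is exact. From \<open>N\<close>
    on, \<open>W (Suc k)\<close> is at its minimum 0 and an inequality in the right direction
    remains.\<close>
  have key: "- (rate (Suc k) * (real (N choose k) - W k x)) \<le> G (W (Suc k)) x" for x
  proof (cases "x < N")
    case True
    have "G (W (Suc k)) x = G (\<lambda>x. real (N choose Suc k) - real (x choose Suc k)) x"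
      using True by (intro G_local) (auto simp: W_def min_def)
    also have "\<dots> = - (rate (Suc k) * real (x choose k))" by (simp only: G.op_diff G.op_constant G_binomial)
    finally show ?thesis using True by (simp add: W_def)
  next
    case False
    have mono: "min y N choose Suc k \<le> N choose Suc k" for y by (rule binomial_right_mono) simp
    have "0 \<le> G (W (Suc k)) x" using False mono by (intro G.minimum) (auto simp: W_def)
    moreover have "0 \<le> rate (Suc k) * (real (N choose k) - W k x)"
      using rate_nonneg by (simp add: W_def)
    ultimately show ?thesis by linarith
  qed
  have lower: "- (C * real (Suc k) * (C * z) ^ k) \<le> Q z (G (W (Suc k))) 0" if z: "0 \<le> z" for z
  proof -
    let ?r = "rate (Suc k)"
    have "real (N choose k) - Q z (W k) 0 \<le> (C * z) ^ k" using Suc.IH[OF z] by (simp add: W_def[abs_def])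
    then have "?r * (real (N choose k) - Q z (W k) 0) \<le> (C * real (Suc k)) * (C * z) ^ k"
      using C(1) C(2)[of "Suc k"] z rate_nonneg[of "Suc k"]
      by (intro mult_mono') (auto intro!: Q.upper_bound Cc_subset_C0 W simp: W_def)
    moreover have "- (?r * real (N choose k)) \<le> Q z (\<lambda>x. G (W (Suc k)) x - ?r * W k x) 0"
    proof (rule Q.lower_bound[OF z])
      show "(\<lambda>x. G (W (Suc k)) x - ?r * W k x) \<in> C0"
        by (intro C0_diff C0_scale CC Cc_subset_C0[OF W])
      show "- (?r * real (N choose k)) \<le> G (W (Suc k)) x - ?r * W k x" for x
        using key[of x] by (simp add: right_diff_distrib)
    qed (simp add: rate_nonneg)
    moreover have "Q z (\<lambda>x. G (W (Suc k)) x - ?r * W k x) 0 = Q z (G (W (Suc k))) 0 - ?r * Q z (W k) 0"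
      using z CC Cc_subset_C0[OF W] by (simp add: Q.diff Q.scale C0_scale)
    ultimately show ?thesis by (simp add: algebra_simps)
  qed
  show ?case
  proof (cases "s = 0")
    case True
    then show ?thesis using Q.at_0[OF CC(1)] by (simp add: W_def[abs_def])
  next
    case False
    then have s0: "0 < s" using Suc.prems by simp
    \<comment> \<open>The derivative of the added power \<open>(C * z) ^ Suc k\<close> is the
      negative of the bound in \<open>lower\<close>, so the sum cannot decrease.\<close>
    have "\<exists>z\<in>{0<..<s}. (Q s (W (Suc k)) 0 + (C * s) ^ Suc k) - (Q 0 (W (Suc k)) 0 + (C * 0) ^ Suc k)
        = (\<lambda>x. (Q z (G (W (Suc k))) 0 + C * real (Suc k) * (C * z) ^ k) * x) (s - 0)"
    proof (rule mvt_simple[OF s0])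
      fix z assume z: "0 \<le> z" "z \<le> s"
      have "((\<lambda>z. Q z (W (Suc k)) 0) has_real_derivative Q z (G (W (Suc k))) 0) (at z within {0..s})"
        using z by (intro DERIV_subset[OF Q.has_derivative_orbit[OF g]]) auto
      moreover have "((\<lambda>z. (C * z) ^ Suc k) has_real_derivative C * real (Suc k) * (C * z) ^ k) (at z within {0..s})"
        by (rule derivative_eq_intros refl | simp)+
      ultimately have "((\<lambda>z. Q z (W (Suc k)) 0 + (C * z) ^ Suc k) has_real_derivative
          Q z (G (W (Suc k))) 0 + C * real (Suc k) * (C * z) ^ k) (at z within {0..s})" by (rule DERIV_add)
      then show "((\<lambda>z. Q z (W (Suc k)) 0 + (C * z) ^ Suc k) has_derivative
          (\<lambda>x. (Q z (G (W (Suc k))) 0 + C * real (Suc k) * (C * z) ^ k) * x)) (at z within {0..s})"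
        by (simp add: has_field_derivative_def)
    qed
    then obtain z where z: "0 < z" "(Q s (W (Suc k)) 0 + (C * s) ^ Suc k) - (Q 0 (W (Suc k)) 0 + (C * 0) ^ Suc k)
        = (Q z (G (W (Suc k))) 0 + C * real (Suc k) * (C * z) ^ k) * s" by auto
    have "0 \<le> (Q z (G (W (Suc k))) 0 + C * real (Suc k) * (C * z) ^ k) * s"
      using lower[of z] z(1) s0 by (intro mult_nonneg_nonneg) auto
    moreover have "Q 0 (W (Suc k)) 0 = real (N choose Suc k)" using Q.at_0[OF CC(1)] by (simp add: W_def)
    ultimately show ?thesis using z(2) by (simp add: W_def[abs_def])
  qed
qed

text \<open>The binomial theorem writes \<open>(1 + \<delta>) ^ x\<close> as a sum of
  \<open>\<delta> ^ k * binom(x,k)\<close>, and the binomial moments are at most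
  \<open>C ^ k\<close>. The choice \<open>\<delta> * C = 1/2\<close> makes the bound geometric with
  sum at most 2; the cap keeps all sums finite until monotone convergence removes it.\<close>

lemma nu_exponential_moment:
  obtains \<delta> where "0 < \<delta>" "(\<integral>\<^sup>+ x. ennreal ((1 + \<delta>) ^ x) \<partial>measure_pmf nu) \<le> 2"
proof -
  obtain C where C: "0 < C" "\<And>k. 0 < k \<Longrightarrow> rate k \<le> C * real k" using rate_linear_bound by blast
  define \<delta> where "\<delta> = 1 / (2 * C)"
  have \<delta>: "0 < \<delta>" "\<delta> * C = 1/2" using C by (auto simp: \<delta>_def)
  have fin: "(\<integral>\<^sup>+ x. ennreal ((1 + \<delta>) ^ min x N) \<partial>measure_pmf nu) \<le> 2" for N
  proof -
    have int: "integrable (measure_pmf nu) (\<lambda>x. real (min x N choose k))" for k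
      by (rule integrable_pmf_bounded[of _ "real (N choose k)"]) (simp add: binomial_right_mono)
    have mom: "mean nu (\<lambda>x. real (min x N choose k)) \<le> C ^ k" for k
    proof -
      have "(\<lambda>x. real (N choose k) - real (min x N choose k)) \<in> C0"
        by (rule Cc_subset_C0) (auto simp: Cc_iff intro!: exI[of _ N])
      from mean_nu[OF this]
      have "Q 1 (\<lambda>x. real (N choose k) - real (min x N choose k)) 0
          = real (N choose k) - mean nu (\<lambda>x. real (min x N choose k))"
        using int by simp
      then show ?thesis using capped_binomial_moment[OF C, of 1 N k] by simp
    qed
    have exp: "(1 + \<delta>) ^ min x N = (\<Sum>k\<le>N. \<delta> ^ k * real (min x N choose k))" for x
    proof -
      have "(\<delta> + 1) ^ min x N = (\<Sum>k\<le>min x N. real (min x N choose k) * \<delta> ^ k * 1 ^ (min x N - k))"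
        by (rule binomial_ring)
      also have "\<dots> = (\<Sum>k\<le>N. \<delta> ^ k * real (min x N choose k))"
        by (rule sum.mono_neutral_cong_left) (auto simp: binomial_eq_0)
      finally show ?thesis by (simp add: add.commute)
    qed
    have "mean nu (\<lambda>x. (1 + \<delta>) ^ min x N) = (\<Sum>k\<le>N. \<delta> ^ k * mean nu (\<lambda>x. real (min x N choose k)))"
      unfolding exp using int by simp
    also have "\<dots> \<le> (\<Sum>k\<le>N. \<delta> ^ k * C ^ k)" using mom \<delta> by (intro sum_mono mult_left_mono) auto
    also have "\<dots> = (\<Sum>k\<le>N. (1/2) ^ k)" by (simp add: power_mult_distrib[symmetric] \<delta>)
    also have "\<dots> \<le> 2" 
    proof -
      have "(\<Sum>k\<le>N. (1/2::real) ^ k) = 2 - (1/2) ^ N" by (induction N) simp_all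
      then show ?thesis by simp
    qed
    finally have "mean nu (\<lambda>x. (1 + \<delta>) ^ min x N) \<le> 2" .
    moreover have "integrable (measure_pmf nu) (\<lambda>x. (1 + \<delta>) ^ min x N)"
      unfolding exp using int by simp
    ultimately show ?thesis
      using \<delta>(1) by (subst nn_integral_eq_integral) (auto simp: ennreal_le_iff2 simp flip: ennreal_numeral)
  qed
  have "(\<integral>\<^sup>+ x. ennreal ((1 + \<delta>) ^ x) \<partial>measure_pmf nu) = (\<integral>\<^sup>+ x. (SUP N. ennreal ((1 + \<delta>) ^ min x N)) \<partial>measure_pmf nu)"
  proof (intro nn_integral_cong antisym)
    fix x
    show "ennreal ((1 + \<delta>) ^ x) \<le> (SUP N. ennreal ((1 + \<delta>) ^ min x N))"
      by (rule SUP_upper2[of x]) auto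
    show "(SUP N. ennreal ((1 + \<delta>) ^ min x N)) \<le> ennreal ((1 + \<delta>) ^ x)"
      using \<delta>(1) by (intro SUP_least ennreal_leI power_increasing) auto
  qed
  also have "\<dots> = (SUP N. \<integral>\<^sup>+ x. ennreal ((1 + \<delta>) ^ min x N) \<partial>measure_pmf nu)"
    using \<delta>(1) by (intro nn_integral_monotone_convergence_SUP)
      (auto simp: incseq_def le_fun_def intro!: ennreal_leI power_increasing)
  also have "\<dots> \<le> 2" using fin by (intro SUP_least)
  finally show ?thesis using that \<delta>(1) by blast
qed

lemma nu_moments:
  obtains A where "1 \<le> A" "\<And>k. integrable (measure_pmf nu) (\<lambda>x. real x ^ k)"
    "\<And>k. mean nu (\<lambda>x. real x ^ k) \<le> 2 * A ^ k * fact k"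
proof -
  obtain \<delta> where \<delta>: "0 < \<delta>" "(\<integral>\<^sup>+ x. ennreal ((1 + \<delta>) ^ x) \<partial>measure_pmf nu) \<le> 2"
    using nu_exponential_moment by blast
  \<comment> \<open>This keeps \<open>exp (\<beta> * x)\<close> below
    \<open>(1 + \<delta>) ^ x\<close>; the minimum with 1 ensures
    \<open>1 / \<beta> \<ge> 1\<close>, as the moment criterion asks of its base.\<close>
  define \<beta> where "\<beta> = min 1 (ln (1 + \<delta>))"
  have \<beta>: "0 < \<beta>" "\<beta> \<le> 1" "\<beta> \<le> ln (1 + \<delta>)" using \<delta> by (auto simp: \<beta>_def)
  have int: "integrable (measure_pmf nu) (\<lambda>x. (1 + \<delta>) ^ x)"
    using \<delta> by (intro integrableI_nonneg) (auto intro: le_less_trans)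
  have E: "mean nu (\<lambda>x. (1 + \<delta>) ^ x) \<le> 2"
    using \<delta> nn_integral_eq_integral[OF int] by (simp add: ennreal_le_iff2 flip: ennreal_numeral)
  have bound: "real x ^ k \<le> (1 / \<beta>) ^ k * fact k * (1 + \<delta>) ^ x" for x k
  proof -
    have "(\<beta> * real x) ^ k / fact k \<le> exp (\<beta> * real x)"
    proof -
      have "(\<beta> * real x) ^ k /\<^sub>R fact k \<le> (\<Sum>n. (\<beta> * real x) ^ n /\<^sub>R fact n)"
        using sum_le_suminf[OF summable_exp_generic[of "\<beta> * real x"], of "{k}"] \<beta> by auto
      then show ?thesis by (simp add: exp_def divide_inverse mult.commute)
    qed
    also have "\<dots> \<le> exp (ln (1 + \<delta>) * real x)" using \<beta> by (simp add: mult_right_mono)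
    also have "\<dots> = (1 + \<delta>) ^ x" using \<delta>(1) by (simp add: mult.commute exp_of_nat_mult)
    finally have "(\<beta> * real x) ^ k \<le> fact k * (1 + \<delta>) ^ x" by (simp add: divide_le_eq mult.commute)
    then show ?thesis using \<beta> by (simp add: power_mult_distrib power_divide field_simps)
  qed
  have intk: "integrable (measure_pmf nu) (\<lambda>x. real x ^ k)" for k
    by (rule Bochner_Integration.integrable_bound[OF integrable_mult_right[OF int, of "(1 / \<beta>) ^ k * fact k"]])
      (auto intro: order_trans[OF bound abs_ge_self])
  show ?thesis
  proof (rule that[of "1 / \<beta>"])
    show "1 \<le> 1 / \<beta>" using \<beta> by simp
    show "integrable (measure_pmf nu) (\<lambda>x. real x ^ k)" for k by (rule intk)
    fix k
    have "mean nu (\<lambda>x. real x ^ k) \<le> mean nu (\<lambda>x. (1 / \<beta>) ^ k * fact k * (1 + \<delta>) ^ x)"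
      by (intro integral_mono intk integrable_mult_right int bound)
    also have "\<dots> = (1 / \<beta>) ^ k * fact k * mean nu (\<lambda>x. (1 + \<delta>) ^ x)" by simp
    also have "\<dots> \<le> (1 / \<beta>) ^ k * fact k * 2" using \<beta> E by (intro mult_left_mono) auto
    finally show "mean nu (\<lambda>x. real x ^ k) \<le> 2 * (1 / \<beta>) ^ k * fact k" by (simp add: mult_ac)
  qed
qed

end

section \<open>Extension to the weighted Hilbert space\<close>

lemma integrable_pmf_nat_iff:
  fixes f :: "nat \<Rightarrow> real"
  shows "integrable (measure_pmf p) f \<longleftrightarrow> summable (\<lambda>n. \<bar>f n * pmf p n\<bar>)"
  unfolding measure_pmf_eq_density
  by (subst integrable_density) (auto simp: integrable_count_space_nat_iff abs_mult mult.commute)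

lemma mean_nat:
  fixes f :: "nat \<Rightarrow> real"
  assumes "integrable (measure_pmf p) f"
  shows "mean p f = (\<Sum>n. f n * pmf p n)"
proof -
  have "integrable (count_space UNIV) (\<lambda>n. pmf p n *\<^sub>R f n)"
    using assms unfolding measure_pmf_eq_density by (subst (asm) integrable_density) auto
  then have "integral\<^sup>L (count_space UNIV) (\<lambda>n. pmf p n *\<^sub>R f n) = (\<Sum>n. pmf p n *\<^sub>R f n)"
    by (rule integral_count_space_nat)
  moreover have "mean p f = integral\<^sup>L (count_space UNIV) (\<lambda>n. pmf p n *\<^sub>R f n)"
    unfolding measure_pmf_eq_density by (subst integral_density) auto
  ultimately show ?thesis by (simp add: mult.commute)
qed

definition energy :: "nat pmf \<Rightarrow> (nat \<Rightarrow> real) \<Rightarrow> real" where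
  "energy p f = mean p (\<lambda>n. (f n)\<^sup>2)"

lemma energy_nonneg: "0 \<le> energy p f"
  unfolding energy_def by (intro Bochner_Integration.integral_nonneg) simp

lemma l2_iff: "f \<in> l2 p \<longleftrightarrow> integrable (measure_pmf p) (\<lambda>n. (f n)\<^sup>2)"
  unfolding l2_def integrable_pmf_nat_iff by (simp add: abs_mult)

lemma l2_product_integrable:
  assumes "f \<in> l2 p" "g \<in> l2 p" shows "integrable (measure_pmf p) (\<lambda>n. f n * g n)"
proof (rule Bochner_Integration.integrable_bound)
  show "integrable (measure_pmf p) (\<lambda>n. (f n)\<^sup>2 + (g n)\<^sup>2)"
    using assms unfolding l2_iff by simp
  show "AE n in measure_pmf p. norm (f n * g n) \<le> norm ((f n)\<^sup>2 + (g n)\<^sup>2)"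
  proof (intro always_eventually allI)
    fix n
    have "2 * (\<bar>f n\<bar> * \<bar>g n\<bar>) \<le> (f n)\<^sup>2 + (g n)\<^sup>2"
      using sum_squares_bound[of "\<bar>f n\<bar>" "\<bar>g n\<bar>"] by simp
    moreover have "0 \<le> \<bar>f n\<bar> * \<bar>g n\<bar>" by simp
    ultimately show "norm (f n * g n) \<le> norm ((f n)\<^sup>2 + (g n)\<^sup>2)"
      by (simp only: real_norm_def abs_mult)
  qed
qed simp

lemma l2_inner_eq: "f \<in> l2 p \<Longrightarrow> g \<in> l2 p \<Longrightarrow> l2_inner p f g = mean p (\<lambda>n. f n * g n)"
  unfolding l2_inner_def by (simp add: mean_nat l2_product_integrable)

lemma l2_norm_eq: "f \<in> l2 p \<Longrightarrow> l2_norm p f = sqrt (energy p f)"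
  unfolding l2_norm_def energy_def by (simp add: l2_inner_eq power2_eq_square)

lemma l2_integrable: "f \<in> l2 p \<Longrightarrow> integrable (measure_pmf p) f"
  using l2_product_integrable[of f p "\<lambda>_. 1"] by (simp add: l2_iff)

lemma l2_combination:
  assumes "f \<in> l2 p" "g \<in> l2 p" shows "(\<lambda>n. a * f n + b * g n) \<in> l2 p"
proof -
  have "integrable (measure_pmf p) (\<lambda>n. a\<^sup>2 * (f n)\<^sup>2 + 2 * a * b * (f n * g n) + b\<^sup>2 * (g n)\<^sup>2)"
    using assms l2_product_integrable[OF assms] unfolding l2_iff by simp
  moreover have "(a * f n + b * g n)\<^sup>2 = a\<^sup>2 * (f n)\<^sup>2 + 2 * a * b * (f n * g n) + b\<^sup>2 * (g n)\<^sup>2" for n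
    by (simp add: power2_eq_square algebra_simps)
  ultimately show ?thesis unfolding l2_iff by simp
qed

lemma l2_diff: "f \<in> l2 p \<Longrightarrow> g \<in> l2 p \<Longrightarrow> (\<lambda>n. f n - g n) \<in> l2 p"
  using l2_combination[of f p g 1 "-1"] by simp

lemma l2_bounded: "(\<And>n. \<bar>f n\<bar> \<le> B) \<Longrightarrow> f \<in> l2 p"
  unfolding l2_iff by (rule integrable_pmf_bounded[of _ "B\<^sup>2"]) (metis abs_power2 power2_abs power_mono abs_ge_zero)

lemma l2_C0: "f \<in> C0 \<Longrightarrow> f \<in> l2 p"
  by (metis C0_bounded l2_bounded)

lemma l2_dominated:
  assumes "f \<in> l2 p" "\<And>n. \<bar>g n\<bar> \<le> \<bar>f n\<bar>" shows "g \<in> l2 p"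
  unfolding l2_iff
  by (rule Bochner_Integration.integrable_bound[OF assms(1)[unfolded l2_iff]]) (use assms(2) in \<open>auto simp: abs_le_square_iff\<close>)

lemma mean_cong:
  fixes f g :: "nat \<Rightarrow> real"
  assumes "\<And>n. n \<in> set_pmf p \<Longrightarrow> f n = g n"
  shows "mean p f = mean p g"
  using assms by (intro integral_cong_AE) (auto simp: AE_measure_pmf_iff)

text \<open>Cauchy-Schwarz in additive form, with a parameter \<open>a\<close> to be tuned and
  without square roots.\<close>

lemma inner_bound:
  assumes "f \<in> l2 p" "g \<in> l2 p" "0 < a"
  shows "\<bar>mean p (\<lambda>n. f n * g n)\<bar> \<le> a * energy p f + energy p g / a"
proof -
  have "\<bar>mean p (\<lambda>n. f n * g n)\<bar> \<le> mean p (\<lambda>n. \<bar>f n * g n\<bar>)"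
    by (rule integral_abs_bound)
  also have "\<dots> \<le> mean p (\<lambda>n. a * (f n)\<^sup>2 + (g n)\<^sup>2 / a)"
  proof (rule integral_mono)
    show "integrable (measure_pmf p) (\<lambda>n. \<bar>f n * g n\<bar>)" using l2_product_integrable[OF assms(1,2)] by simp
    show "integrable (measure_pmf p) (\<lambda>n. a * (f n)\<^sup>2 + (g n)\<^sup>2 / a)" using assms unfolding l2_iff by simp
    fix n
    have "0 \<le> (a * \<bar>f n\<bar> - \<bar>g n\<bar>)\<^sup>2" by simp
    then have "2 * (a * \<bar>f n\<bar> * \<bar>g n\<bar>) \<le> a * a * (f n)\<^sup>2 + (g n)\<^sup>2"
      by (simp add: power2_diff power_mult_distrib power2_eq_square[of a])
    then have "2 * (\<bar>f n\<bar> * \<bar>g n\<bar>) \<le> a * (f n)\<^sup>2 + (g n)\<^sup>2 / a"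
      using assms(3) by (simp add: field_simps)
    moreover have "0 \<le> \<bar>f n\<bar> * \<bar>g n\<bar>" by simp
    ultimately show "\<bar>f n * g n\<bar> \<le> a * (f n)\<^sup>2 + (g n)\<^sup>2 / a"
      by (simp only: abs_mult)
  qed
  also have "\<dots> = a * energy p f + energy p g / a" unfolding energy_def using assms by (simp add: l2_iff)
  finally show ?thesis .
qed

lemma energy_le_sq: "(\<And>n. \<bar>f n\<bar> \<le> B) \<Longrightarrow> energy p f \<le> B\<^sup>2"
  unfolding energy_def
  by (intro measure_pmf.integral_le_const integrable_pmf_bounded[of _ "B\<^sup>2"])
    (auto simp: abs_le_square_iff[symmetric] intro!: AE_I2 order_trans[OF _ abs_ge_self])

lemma l2_Cc_dense:
  assumes "f \<in> l2 p" "0 < e"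
  obtains g where "g \<in> Cc" "energy p (\<lambda>n. f n - g n) < e"
proof -
  have "(\<lambda>N. mean p (\<lambda>n. (f n - indicator {..<N} n * f n)\<^sup>2)) \<longlonglongrightarrow> mean p (\<lambda>n. 0)"
  proof (rule integral_dominated_convergence[where w = "\<lambda>n. (f n)\<^sup>2"])
    show "integrable (measure_pmf p) (\<lambda>n. (f n)\<^sup>2)" using assms(1) by (simp add: l2_iff)
    show "AE n in measure_pmf p. (\<lambda>N. (f n - indicator {..<N} n * f n)\<^sup>2) \<longlonglongrightarrow> 0"
    proof (intro always_eventually allI)
      fix n
      have "\<forall>\<^sub>F N in sequentially. (f n - indicator {..<N} n * f n)\<^sup>2 = 0"
        using eventually_gt_at_top[of n] by eventually_elim simp
      then show "(\<lambda>N. (f n - indicator {..<N} n * f n)\<^sup>2) \<longlonglongrightarrow> 0" by (rule tendsto_eventually)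
    qed
    show "AE n in measure_pmf p. norm ((f n - indicator {..<N} n * f n)\<^sup>2) \<le> (f n)\<^sup>2" for N
      by (auto simp: indicator_def)
  qed auto
  then have "\<forall>\<^sub>F N in sequentially. energy p (\<lambda>n. f n - indicator {..<N} n * f n) < e"
    using assms(2) by (intro order_tendstoD) (auto simp: energy_def)
  then obtain N where "energy p (\<lambda>n. f n - indicator {..<N} n * f n) < e"
    by (auto simp: eventually_sequentially)
  moreover have "(\<lambda>n. indicator {..<N} n * f n) \<in> Cc" by (intro Cc_mult Cc_indicator) simp
  ultimately show ?thesis using that by blast
qed

text \<open>The support of \<open>\<nu>\<close> may be proper, for instance the state 0 alone when
  \<phi> = 0; statements on values of \<open>l2\<close> functions are therefore restricted to
  \<open>set_pmf \<nu>\<close>.\<close>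

locale invariant_kernel = feller P for P +
  fixes p :: "real \<Rightarrow> nat \<Rightarrow> nat pmf" and \<nu> :: "nat pmf"
  assumes kernel: "0 \<le> t \<Longrightarrow> f \<in> C0 \<Longrightarrow> mean (p t n) f = P t f n"
    and invariant: "0 \<le> t \<Longrightarrow> f \<in> C0 \<Longrightarrow> mean \<nu> (P t f) = mean \<nu> f"
begin

lemma pmf_kernel: "0 \<le> t \<Longrightarrow> pmf (p t n) k = P t (indicator {k}) n"
  using kernel[of t "indicator {k}" n] Cc_subset_C0[OF Cc_indicator[of "{k}"]] by (simp add: measure_pmf_single)

lemma bind_invariant: "0 \<le> t \<Longrightarrow> bind_pmf \<nu> (p t) = \<nu>"
  using invariant[of t "indicator {k}" for k] Cc_subset_C0[OF Cc_indicator]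
  by (intro pmf_eqI) (simp add: pmf_bind pmf_kernel measure_pmf_single)

lemma kernel_0: "p 0 n = return_pmf n"
  by (rule pmf_eqI_C0) (simp add: kernel at_0)

lemma kernel_add:
  assumes "0 \<le> s" "0 \<le> t" shows "p (s + t) n = bind_pmf (p s n) (p t)"
proof (rule pmf_eqI)
  fix k
  have k: "indicator {k} \<in> C0" by (intro Cc_subset_C0 Cc_indicator) simp
  have "pmf (bind_pmf (p s n) (p t)) k = mean (p s n) (P t (indicator {k}))"
    using assms by (simp add: pmf_bind pmf_kernel)
  also have "\<dots> = pmf (p (s + t) n) k"
    using assms k by (simp add: kernel closed pmf_kernel semigroup)
  finally show "pmf (p (s + t) n) k = pmf (bind_pmf (p s n) (p t)) k" ..
qed

text \<open>By invariance a kernel started in the support of \<open>\<nu>\<close> never leaves it,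
  so identities valid only on the support may be integrated against that kernel.\<close>

lemma kernel_support:
  assumes "0 \<le> t" "n \<in> set_pmf \<nu>" shows "set_pmf (p t n) \<subseteq> set_pmf \<nu>"
  using assms arg_cong[OF bind_invariant[OF assms(1)], of set_pmf] by auto

text \<open>Integrability under the kernel is guaranteed from states in the support of
  \<open>\<nu>\<close>; elsewhere the expectation may take its default value 0, which the Hilbert
  space does not see.\<close>

definition ext :: "real \<Rightarrow> (nat \<Rightarrow> real) \<Rightarrow> nat \<Rightarrow> real" where
  "ext t f n = mean (p t n) f"

lemma ext_C0: "0 \<le> t \<Longrightarrow> f \<in> C0 \<Longrightarrow> ext t f = P t f"
  by (rule HOL.ext) (simp add: ext_def kernel)

text \<open>Jensen's inequality under each kernel, in the form that a variance is nonnegative;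
  integration over \<open>\<nu>\<close> and invariance then give contraction. Finiteness of the
  iterated integral forces square integrability at every atom of \<open>\<nu>\<close>.\<close>

lemma l2_kernel:
  assumes "0 \<le> t" "f \<in> l2 \<nu>"
  shows "n \<in> set_pmf \<nu> \<Longrightarrow> f \<in> l2 (p t n)"
    and "ext t f \<in> l2 \<nu>" and "energy \<nu> (ext t f) \<le> energy \<nu> f"
proof -
  have int: "integrable (measure_pmf \<nu>) (\<lambda>n. (f n)\<^sup>2)" using assms(2) by (simp add: l2_iff)
  have fin: "(\<integral>\<^sup>+ n. ennreal ((f n)\<^sup>2) \<partial>measure_pmf \<nu>) = ennreal (energy \<nu> f)"
    unfolding energy_def by (intro nn_integral_eq_integral int) simp
  have bind: "(\<integral>\<^sup>+ n. \<integral>\<^sup>+ k. ennreal ((f k)\<^sup>2) \<partial>measure_pmf (p t n) \<partial>measure_pmf \<nu>) = ennreal (energy \<nu> f)"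
    unfolding nn_integral_bind_pmf[symmetric] bind_invariant[OF assms(1)] by (rule fin)
  have "AE n in measure_pmf \<nu>. (\<integral>\<^sup>+ k. ennreal ((f k)\<^sup>2) \<partial>measure_pmf (p t n)) \<noteq> \<infinity>"
    by (rule nn_integral_noteq_infinite) (simp_all add: bind)
  then have l2: "f \<in> l2 (p t n)" if "n \<in> set_pmf \<nu>" for n
    using that unfolding l2_iff AE_measure_pmf_iff
    by (intro integrableI_nonneg) (auto simp: top.not_eq_extremum)
  then show "n \<in> set_pmf \<nu> \<Longrightarrow> f \<in> l2 (p t n)" .
  have sq: "(ext t f n)\<^sup>2 \<le> energy (p t n) f" if "n \<in> set_pmf \<nu>" for n
  proof -
    have "0 \<le> measure_pmf.variance (p t n) f" by (rule measure_pmf.variance_positive)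
    also have "\<dots> = energy (p t n) f - (ext t f n)\<^sup>2"
      unfolding energy_def ext_def
      by (rule measure_pmf.variance_eq[OF l2_integrable[OF l2[OF that]] l2[OF that, unfolded l2_iff]])
    finally show ?thesis by simp
  qed
  have le: "(\<integral>\<^sup>+ n. ennreal ((ext t f n)\<^sup>2) \<partial>measure_pmf \<nu>) \<le> ennreal (energy \<nu> f)"
    unfolding bind[symmetric]
  proof (rule nn_integral_mono_AE, unfold AE_measure_pmf_iff, intro ballI)
    fix n assume n: "n \<in> set_pmf \<nu>"
    have "ennreal ((ext t f n)\<^sup>2) \<le> ennreal (energy (p t n) f)" using sq[OF n] by (rule ennreal_leI)
    also have "\<dots> = (\<integral>\<^sup>+ k. ennreal ((f k)\<^sup>2) \<partial>measure_pmf (p t n))"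
      unfolding energy_def using l2[OF n] by (intro nn_integral_eq_integral[symmetric]) (simp_all add: l2_iff)
    finally show "ennreal ((ext t f n)\<^sup>2) \<le> (\<integral>\<^sup>+ k. ennreal ((f k)\<^sup>2) \<partial>measure_pmf (p t n))" .
  qed
  show *: "ext t f \<in> l2 \<nu>"
    unfolding l2_iff using le by (intro integrableI_nonneg) (auto intro: le_less_trans)
  have "ennreal (energy \<nu> (ext t f)) \<le> ennreal (energy \<nu> f)"
    using le nn_integral_eq_integral[OF *[unfolded l2_iff]] by (simp add: energy_def)
  then show "energy \<nu> (ext t f) \<le> energy \<nu> f" using energy_nonneg by (simp add: ennreal_le_iff)
qed

lemma ext_combination:
  assumes "0 \<le> t" "f \<in> l2 \<nu>" "g \<in> l2 \<nu>" "n \<in> set_pmf \<nu>"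
  shows "ext t (\<lambda>k. a * f k + b * g k) n = a * ext t f n + b * ext t g n"
  unfolding ext_def
  using l2_integrable[OF l2_kernel(1)[OF assms(1,2,4)]] l2_integrable[OF l2_kernel(1)[OF assms(1,3,4)]] by simp

text \<open>Nonnegative integrals iterate without integrability conditions, which is
  Chapman-Kolmogorov; signed functions are split into their two parts afterwards.\<close>

lemma ext_semigroup_nonneg:
  assumes s: "0 \<le> s" and t: "0 \<le> t" and f: "f \<in> l2 \<nu>" "\<And>k. 0 \<le> f k" and n: "n \<in> set_pmf \<nu>"
  shows "ext (s + t) f n = ext s (ext t f) n"
proof -
  have e: "ext r g k = enn2real (\<integral>\<^sup>+ x. ennreal (g x) \<partial>measure_pmf (p r k))" if "\<And>k. 0 \<le> g k" for r g k
    unfolding ext_def using that by (intro integral_eq_nn_integral) auto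
  have "0 \<le> ext t f k" for k unfolding ext_def using f(2) by (intro Bochner_Integration.integral_nonneg)
  then have "ext s (ext t f) n = enn2real (\<integral>\<^sup>+ x. ennreal (ext t f x) \<partial>measure_pmf (p s n))" by (rule e)
  also have "(\<integral>\<^sup>+ x. ennreal (ext t f x) \<partial>measure_pmf (p s n)) = (\<integral>\<^sup>+ x. \<integral>\<^sup>+ y. ennreal (f y) \<partial>measure_pmf (p t x) \<partial>measure_pmf (p s n))"
  proof (rule nn_integral_cong_AE, unfold AE_measure_pmf_iff, intro ballI)
    fix x assume "x \<in> set_pmf (p s n)"
    then have "x \<in> set_pmf \<nu>" using kernel_support[OF s n] by blast
    then show "ennreal (ext t f x) = (\<integral>\<^sup>+ y. ennreal (f y) \<partial>measure_pmf (p t x))"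
      unfolding ext_def using f(2) by (intro nn_integral_eq_integral[symmetric] l2_integrable l2_kernel(1)[OF t f(1)]) auto
  qed
  also have "\<dots> = (\<integral>\<^sup>+ y. ennreal (f y) \<partial>measure_pmf (p (s + t) n))"
    unfolding kernel_add[OF s t] by simp
  also have "enn2real \<dots> = ext (s + t) f n" using f(2) by (rule e[symmetric])
  finally show ?thesis ..
qed

lemma ext_semigroup:
  assumes s: "0 \<le> s" and t: "0 \<le> t" and f: "f \<in> l2 \<nu>" and n: "n \<in> set_pmf \<nu>"
  shows "ext (s + t) f n = ext s (ext t f) n"
proof -
  define g h where "g k = max (f k) 0" and "h k = max (- f k) 0" for k
  have gh: "g \<in> l2 \<nu>" "h \<in> l2 \<nu>" "\<And>k. 0 \<le> g k" "\<And>k. 0 \<le> h k"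
    by (auto intro!: l2_dominated[OF f] simp: g_def h_def)
  have fgh: "f = (\<lambda>k. 1 * g k + -1 * h k)" by (auto simp: g_def h_def)
  have "ext (s + t) f n = ext s (ext t g) n - ext s (ext t h) n"
    unfolding fgh using ext_combination[of "s + t" g h n 1 "-1"] gh n s t by (simp add: ext_semigroup_nonneg)
  also have "\<dots> = ext s (\<lambda>k. 1 * ext t g k + -1 * ext t h k) n"
    using ext_combination[of s "ext t g" "ext t h" n 1 "-1"] l2_kernel(2)[OF t] gh n s by simp
  also have "\<dots> = ext s (ext t f) n"
    unfolding ext_def[of s]
  proof (rule mean_cong)
    fix k assume "k \<in> set_pmf (p s n)"
    then have "k \<in> set_pmf \<nu>" using kernel_support[OF s n] by blast
    then show "1 * ext t g k + -1 * ext t h k = ext t f k"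
      unfolding fgh using ext_combination[OF t gh(1,2), of k 1 "-1"] by simp
  qed
  finally show ?thesis .
qed

lemma ext_strongly_continuous:
  assumes f: "f \<in> l2 \<nu>"
  shows "((\<lambda>t. l2_norm \<nu> (\<lambda>n. ext t f n - f n)) \<longlongrightarrow> 0) (at_right 0)"
proof -
  have l2: "(\<lambda>n. ext t f n - f n) \<in> l2 \<nu>" if "0 \<le> t" for t
    by (intro l2_diff l2_kernel(2) that f)
  have "((\<lambda>t. energy \<nu> (\<lambda>n. ext t f n - f n)) \<longlongrightarrow> 0) (at_right 0)"
    unfolding tendsto_iff eventually_at_right_field
  proof (intro allI impI)
    fix e :: real assume e: "0 < e"
    \<comment> \<open>The square of a sum of three terms costs a factor 3, so three energies of at
      most \<open>e / 12\<close> add up to at most \<open>3 * e / 4\<close>.\<close>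
    obtain g where g: "g \<in> Cc" "energy \<nu> (\<lambda>n. f n - g n) < e / 12" using l2_Cc_dense[OF f, of "e / 12"] e by auto
    note gC = Cc_subset_C0[OF g(1)]
    note g2 = l2_C0[OF gC]
    define h where "h n = f n - g n" for n
    have h: "h \<in> l2 \<nu>" unfolding h_def by (rule l2_diff[OF f g2])
    obtain d where d: "0 < d" "\<And>t n. 0 \<le> t \<Longrightarrow> t < d \<Longrightarrow> \<bar>P t g n - g n\<bar> < sqrt (e / 12)"
      using strongly_continuous[OF gC, of "sqrt (e / 12)"] e by auto
    have "dist (energy \<nu> (\<lambda>n. ext t f n - f n)) 0 < e" if t: "0 < t" "t < d" for t
    proof -
      have t0: "0 \<le> t" using t by simp
      have b: "energy \<nu> (\<lambda>n. P t g n - g n) \<le> e / 12"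
        using energy_le_sq[of "\<lambda>n. P t g n - g n" "sqrt (e / 12)" \<nu>] d(2)[OF t0 t(2)] e by (simp add: less_imp_le del: le_divide_eq_numeral1)
      have c: "energy \<nu> (ext t h) \<le> e / 12" using l2_kernel(3)[OF t0 h] g(2) unfolding h_def by linarith
      have i1: "(\<lambda>n. P t g n - g n) \<in> l2 \<nu>" by (intro l2_C0 C0_diff closed t0 gC)
      note i2 = l2_kernel(2)[OF t0 h]
      have "energy \<nu> (\<lambda>n. ext t f n - f n) \<le> mean \<nu> (\<lambda>n. 3 * (ext t h n)\<^sup>2 + 3 * (P t g n - g n)\<^sup>2 + 3 * (h n)\<^sup>2)"
        unfolding energy_def
      proof (rule integral_mono_AE)
        show "integrable (measure_pmf \<nu>) (\<lambda>n. (ext t f n - f n)\<^sup>2)" using l2[OF t0] by (simp add: l2_iff)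
        show "integrable (measure_pmf \<nu>) (\<lambda>n. 3 * (ext t h n)\<^sup>2 + 3 * (P t g n - g n)\<^sup>2 + 3 * (h n)\<^sup>2)"
          using i1 i2 h by (simp add: l2_iff)
        show "AE n in measure_pmf \<nu>. (ext t f n - f n)\<^sup>2 \<le> 3 * (ext t h n)\<^sup>2 + 3 * (P t g n - g n)\<^sup>2 + 3 * (h n)\<^sup>2"
          unfolding AE_measure_pmf_iff
        proof
          fix n assume n: "n \<in> set_pmf \<nu>"
          have "ext t (\<lambda>k. 1 * h k + 1 * g k) n = 1 * ext t h n + 1 * ext t g n"
            by (rule ext_combination[OF t0 h g2 n])
          then have "ext t f n - f n = ext t h n + (P t g n - g n) - h n"
            using ext_C0[OF t0 gC] by (simp add: h_def)
          then have eq: "(ext t f n - f n)\<^sup>2 = (ext t h n + (P t g n - g n) - h n)\<^sup>2" by (simp only:)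
          have "(x + y - z)\<^sup>2 \<le> 3 * x\<^sup>2 + 3 * y\<^sup>2 + 3 * z\<^sup>2" for x y z :: real
            using sum_squares_bound[of x y] sum_squares_bound[of x "-z"] sum_squares_bound[of y "-z"]
            by (simp add: power2_eq_square algebra_simps)
          then show "(ext t f n - f n)\<^sup>2 \<le> 3 * (ext t h n)\<^sup>2 + 3 * (P t g n - g n)\<^sup>2 + 3 * (h n)\<^sup>2"
            unfolding eq .
        qed
      qed
      also have "\<dots> = 3 * energy \<nu> (ext t h) + 3 * energy \<nu> (\<lambda>n. P t g n - g n) + 3 * energy \<nu> h"
        using i1 i2 h by (simp add: energy_def l2_iff)
      also have "\<dots> < e" using b c g(2) e unfolding h_def by linarith
      finally show ?thesis using energy_nonneg[of \<nu> "\<lambda>n. ext t f n - f n"] by simp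
    qed
    then show "\<exists>b>0. \<forall>y>0. y < b \<longrightarrow> dist (energy \<nu> (\<lambda>n. ext y f n - f n)) 0 < e" using d(1) by blast
  qed
  then have "((\<lambda>t. sqrt (energy \<nu> (\<lambda>n. ext t f n - f n))) \<longlongrightarrow> sqrt 0) (at_right 0)" by (rule tendsto_real_sqrt)
  moreover have "\<forall>\<^sub>F t in at_right 0. l2_norm \<nu> (\<lambda>n. ext t f n - f n) = sqrt (energy \<nu> (\<lambda>n. ext t f n - f n))"
    using eventually_at_right_less by eventually_elim (simp add: l2_norm_eq l2)
  ultimately show ?thesis by (simp add: tendsto_cong)
qed

lemma l2_extension_ext: "l2_extension \<nu> P ext"
  unfolding l2_extension_def
proof (intro conjI allI impI ballI)
  show "ext t f \<in> l2 \<nu>" if "0 \<le> t" "f \<in> l2 \<nu>" for t f using that by (rule l2_kernel)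
  show "l2_norm \<nu> (ext t f) \<le> l2_norm \<nu> f" if "0 \<le> t" "f \<in> l2 \<nu>" for t f
    using l2_kernel[OF that] that by (simp add: l2_norm_eq)
  show "ext t (\<lambda>k. a * f k + b * g k) n = a * ext t f n + b * ext t g n"
    if "0 \<le> t" "f \<in> l2 \<nu>" "g \<in> l2 \<nu>" "n \<in> set_pmf \<nu>" for t f g a b n
    by (rule ext_combination[OF that])
  show "ext 0 f n = f n" for f n by (simp add: ext_def kernel_0)
  show "ext (s + t) f n = ext s (ext t f) n" if "0 \<le> s" "0 \<le> t" "f \<in> l2 \<nu>" "n \<in> set_pmf \<nu>" for s t f n
    by (rule ext_semigroup[OF that])
  show "((\<lambda>t. l2_norm \<nu> (\<lambda>n. ext t f n - f n)) \<longlongrightarrow> 0) (at_right 0)" if "f \<in> l2 \<nu>" for f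
    by (rule ext_strongly_continuous[OF that])
  show "ext t f n = P t f n" if "0 \<le> t" "f \<in> C0" for t f n using ext_C0[OF that] by simp
qed

text \<open>The criterion does not depend on the extension chosen: all agree with \<open>P\<close>
  on finitely supported functions, and the defect \<open>B\<close> of symmetry is a bilinear form,
  bounded because \<open>E\<close> contracts, so it vanishes once it does on a dense set.\<close>

lemma selfadjoint_iff:
  assumes E: "l2_extension \<nu> P E"
  shows "l2_selfadjoint \<nu> E \<longleftrightarrow> (\<forall>t\<ge>0. \<forall>f\<in>Cc. \<forall>g\<in>Cc.
    mean \<nu> (\<lambda>n. P t f n * g n) = mean \<nu> (\<lambda>n. f n * P t g n))"
proof -
  let ?I = "\<lambda>f g. mean \<nu> (\<lambda>n. f n * g n)"
  have El2: "E t f \<in> l2 \<nu>" if "0 \<le> t" "f \<in> l2 \<nu>" for t f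
    using E that unfolding l2_extension_def by blast
  have En: "energy \<nu> (E t f) \<le> energy \<nu> f" if "0 \<le> t" "f \<in> l2 \<nu>" for t f
  proof -
    have "l2_norm \<nu> (E t f) \<le> l2_norm \<nu> f" using E that unfolding l2_extension_def by blast
    then show ?thesis using El2[OF that] that by (simp add: l2_norm_eq)
  qed
  have Elin: "E t (\<lambda>k. a * f k + b * g k) n = a * E t f n + b * E t g n"
    if "0 \<le> t" "f \<in> l2 \<nu>" "g \<in> l2 \<nu>" "n \<in> set_pmf \<nu>" for t f g a b n
    using E that unfolding l2_extension_def by blast
  have EC: "E t f n = P t f n" if "0 \<le> t" "f \<in> C0" "n \<in> set_pmf \<nu>" for t f n
    using E that unfolding l2_extension_def by blast
  have ECc: "?I (E t f) g = ?I (P t f) g" "?I g (E t f) = ?I g (P t f)" if "0 \<le> t" "f \<in> Cc" for t f g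
    using EC[OF that(1) Cc_subset_C0[OF that(2)]] by (auto intro!: mean_cong)
  have Cl2: "f \<in> l2 \<nu>" if "f \<in> Cc" for f using that by (intro l2_C0 Cc_subset_C0)
  define B where "B t f g = ?I (E t f) g - ?I f (E t g)" for t f g
  have sa: "l2_selfadjoint \<nu> E \<longleftrightarrow> (\<forall>t\<ge>0. \<forall>f\<in>l2 \<nu>. \<forall>g\<in>l2 \<nu>. B t f g = 0)"
    unfolding l2_selfadjoint_def B_def using El2 by (auto simp: l2_inner_eq)
  have BCc: "B t f g = ?I (P t f) g - ?I f (P t g)" if "0 \<le> t" "f \<in> Cc" "g \<in> Cc" for t f g
    unfolding B_def using that ECc by simp
  have Bb: "\<bar>B t f g\<bar> \<le> (a * energy \<nu> f + energy \<nu> g / a) + (a * energy \<nu> f + energy \<nu> g / a)" if "0 \<le> t" "f \<in> l2 \<nu>" "g \<in> l2 \<nu>" "0 < a" for t f g a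
  proof -
    have "\<bar>?I (E t f) g\<bar> \<le> a * energy \<nu> (E t f) + energy \<nu> g / a" using that by (intro inner_bound El2) auto
    also have "\<dots> \<le> a * energy \<nu> f + energy \<nu> g / a" using En[OF that(1,2)] that by (intro add_right_mono mult_left_mono) auto
    finally have 1: "\<bar>?I (E t f) g\<bar> \<le> a * energy \<nu> f + energy \<nu> g / a" .
    have "\<bar>?I f (E t g)\<bar> \<le> a * energy \<nu> f + energy \<nu> (E t g) / a" using that by (intro inner_bound El2) auto
    also have "\<dots> \<le> a * energy \<nu> f + energy \<nu> g / a" using En[OF that(1,3)] that by (intro add_left_mono divide_right_mono) auto
    finally have 2: "\<bar>?I f (E t g)\<bar> \<le> a * energy \<nu> f + energy \<nu> g / a" .
    have "\<bar>B t f g\<bar> \<le> \<bar>?I (E t f) g\<bar> + \<bar>?I f (E t g)\<bar>" unfolding B_def by (rule abs_triangle_ineq4)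
    then show ?thesis using 1 2 by linarith
  qed
  have Bl: "B t f g = B t (\<lambda>n. f n - f' n) g + B t f' g" if "0 \<le> t" "f \<in> l2 \<nu>" "f' \<in> l2 \<nu>" "g \<in> l2 \<nu>" for t f f' g
  proof -
    have d: "(\<lambda>n. f n - f' n) \<in> l2 \<nu>" using that by (intro l2_diff)
    have "?I (E t f) g = mean \<nu> (\<lambda>n. E t (\<lambda>n. f n - f' n) n * g n + E t f' n * g n)"
      using Elin[OF that(1) d that(3), of _ 1 1] by (intro mean_cong) (simp add: distrib_right[symmetric])
    also have "\<dots> = ?I (E t (\<lambda>n. f n - f' n)) g + ?I (E t f') g"
      using that d by (intro Bochner_Integration.integral_add l2_product_integrable El2)
    finally have 1: "?I (E t f) g = ?I (E t (\<lambda>n. f n - f' n)) g + ?I (E t f') g" .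
    have "?I f (E t g) = mean \<nu> (\<lambda>n. (f n - f' n) * E t g n + f' n * E t g n)"
      by (simp add: algebra_simps)
    also have "\<dots> = ?I (\<lambda>n. f n - f' n) (E t g) + ?I f' (E t g)"
      using that d by (intro Bochner_Integration.integral_add l2_product_integrable El2)
    finally show ?thesis using 1 by (simp add: B_def)
  qed
  have Bs: "B t f g = - B t g f" for t f g unfolding B_def by (simp add: mult.commute)
  have approx: "B t f g = 0"
    if t: "0 \<le> t" and fg: "f \<in> l2 \<nu>" "g \<in> l2 \<nu>" and z: "\<And>h. h \<in> Cc \<Longrightarrow> B t h g = 0" for t f g
  proof -
    have "\<bar>B t f g\<bar> \<le> 0 + e" if e: "0 < e" for e
    proof -
      \<comment> \<open>A large \<open>a\<close> makes the terms in \<open>g\<close> small, and only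
        then is \<open>h\<close> chosen close to \<open>f\<close> relative to \<open>a\<close>.
        Adding 1 keeps \<open>a\<close> positive when \<open>g\<close> has energy 0.\<close>
      define a where "a = 4 * (energy \<nu> g + 1) / e"
      have a: "0 < a" using e energy_nonneg[of \<nu> g] by (simp add: a_def add_nonneg_pos)
      have "energy \<nu> g / a \<le> e / 4" using a e energy_nonneg[of \<nu> g] by (simp add: a_def field_simps)
      moreover obtain h where h: "h \<in> Cc" "energy \<nu> (\<lambda>n. f n - h n) < e / (4 * a)"
        using l2_Cc_dense[OF fg(1), of "e / (4 * a)"] a e by auto
      moreover have "a * energy \<nu> (\<lambda>n. f n - h n) \<le> e / 4" using h(2) a by (simp add: field_simps)
      moreover have "B t f g = B t (\<lambda>n. f n - h n) g" using Bl[OF t fg(1) Cl2[OF h(1)] fg(2)] z[OF h(1)] by simp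
      moreover have "\<bar>B t (\<lambda>n. f n - h n) g\<bar> 
          \<le> (a * energy \<nu> (\<lambda>n. f n - h n) + energy \<nu> g / a) + (a * energy \<nu> (\<lambda>n. f n - h n) + energy \<nu> g / a)"
        by (intro Bb t l2_diff fg Cl2 h a)
      ultimately show ?thesis by linarith
    qed
    then have "\<bar>B t f g\<bar> \<le> 0" by (rule field_le_epsilon)
    then show ?thesis by simp
  qed
  show ?thesis unfolding sa
  proof (intro iffI allI impI ballI)
    fix t :: real and f g assume "\<forall>t\<ge>0. \<forall>f\<in>l2 \<nu>. \<forall>g\<in>l2 \<nu>. B t f g = 0" "0 \<le> t" "f \<in> Cc" "g \<in> Cc"
    then show "?I (P t f) g = ?I f (P t g)" using BCc Cl2 by fastforce
  next
    fix t :: real and f g assume sym: "\<forall>t\<ge>0. \<forall>f\<in>Cc. \<forall>g\<in>Cc. ?I (P t f) g = ?I f (P t g)" and t: "0 \<le> t" and fg: "f \<in> l2 \<nu>" "g \<in> l2 \<nu>"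
    have 0: "B t h k = 0" if "h \<in> Cc" "k \<in> Cc" for h k using BCc[OF t that] sym t that by simp
    have 1: "B t f h = 0" if h: "h \<in> Cc" for h by (rule approx[OF t fg(1) Cl2[OF h] 0[OF _ h]])
    show "B t f g = 0"
      \<comment> \<open>Antisymmetry of \<open>B\<close> exchanges the arguments, so approximation
        in the first one serves for both.\<close>
      unfolding Bs[of t f g] neg_equal_0_iff_equal
      by (rule approx[OF t fg(2,1)]) (subst Bs, simp add: 1)
  qed
qed

end

section \<open>Symmetry\<close>

lemma C0_mult: "f \<in> C0 \<Longrightarrow> g \<in> C0 \<Longrightarrow> (\<lambda>n. f n * g n) \<in> C0"
  unfolding C0_def using tendsto_mult[of f 0 sequentially g 0] by simp

lemma C0_bounded_range: "f \<in> C0 \<Longrightarrow> bounded (range f)"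
  by (rule C0_bounded) (auto intro!: boundedI)

lemma mean_uniform_limit:
  fixes h :: "'b \<Rightarrow> nat \<Rightarrow> real"
  assumes "uniform_limit UNIV h l F" "\<forall>\<^sub>F x in F. integrable (measure_pmf p) (h x)" "integrable (measure_pmf p) l"
  shows "((\<lambda>x. mean p (h x)) \<longlongrightarrow> mean p l) F"
  unfolding tendsto_iff
proof (intro allI impI)
  fix e :: real assume e: "0 < e"
  have "\<forall>\<^sub>F x in F. \<forall>n\<in>UNIV. dist (h x n) (l n) < e/2"
    using assms(1) half_gt_zero[OF e] unfolding uniform_limit_iff by blast
  with assms(2) show "\<forall>\<^sub>F x in F. dist (mean p (h x)) (mean p l) < e"
  proof eventually_elim
    fix x assume x: "integrable (measure_pmf p) (h x)" "\<forall>n\<in>UNIV. dist (h x n) (l n) < e/2"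
    have "\<bar>mean p (\<lambda>n. h x n - l n)\<bar> \<le> e/2"
      using x(2) by (intro mean_bound) (auto simp: dist_real_def intro: less_imp_le)
    then show "dist (mean p (h x)) (mean p l) < e"
      using x(1) assms(3) e by (simp add: dist_real_def)
  qed
qed

section \<open>Invariance and symmetry at the level of the generator\<close>

context rate_semigroup
begin

lemma invariant_op:
  assumes "\<And>t f. 0 \<le> t \<Longrightarrow> f \<in> C0 \<Longrightarrow> mean \<nu> (P t f) = mean \<nu> f"
    and f: "f \<in> Cc"
  shows "mean \<nu> (A f) = 0"
proof -
  note g = on_Cc[OF f]
  note C = generator_C0[OF g]
  have "((\<lambda>t. mean \<nu> (\<lambda>n. (P t f n - f n) / t)) \<longlongrightarrow> mean \<nu> (A f)) (at_right 0)"
  proof (rule mean_uniform_limit)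
    show "uniform_limit UNIV (\<lambda>t n. (P t f n - f n) / t) (A f) (at_right 0)" using g by (simp add: generator_def)
    show "\<forall>\<^sub>F t in at_right 0. integrable (measure_pmf \<nu>) (\<lambda>n. (P t f n - f n) / t)"
      using eventually_at_right_less
      by eventually_elim (intro integrable_pmf_C0 C0_divide C0_diff closed C less_imp_le)
  qed (intro integrable_pmf_C0 C)
  moreover have "\<forall>\<^sub>F t in at_right 0. mean \<nu> (\<lambda>n. (P t f n - f n) / t) = 0"
    using eventually_at_right_less
    by eventually_elim (simp add: assms(1) C closed integrable_pmf_C0)
  ultimately show ?thesis
    using tendsto_unique[OF _ _ tendsto_eventually] trivial_limit_at_right_real by blast
qed

lemma symmetric_op:
  assumes sym: "\<And>t. 0 \<le> t \<Longrightarrow> mean \<nu> (\<lambda>n. P t f n * g n) = mean \<nu> (\<lambda>n. f n * P t g n)"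
    and f: "f \<in> Cc" and g: "g \<in> Cc"
  shows "mean \<nu> (\<lambda>n. A f n * g n) = mean \<nu> (\<lambda>n. f n * A g n)"
proof -
  have lim: "((\<lambda>t. mean \<nu> (\<lambda>n. (P t u n - u n) / t * v n)) \<longlongrightarrow> mean \<nu> (\<lambda>n. A u n * v n)) (at_right 0)"
    if u: "u \<in> Cc" and v: "v \<in> Cc" for u v
  proof (rule mean_uniform_limit)
    note gu = on_Cc[OF u]
    note C = generator_C0[OF gu] Cc_subset_C0[OF v]
    show "uniform_limit UNIV (\<lambda>t n. (P t u n - u n) / t * v n) (\<lambda>n. A u n * v n) (at_right 0)"
      using gu by (intro uniform_lim_mult C0_bounded_range C uniform_limit_const) (simp add: generator_def)
    show "\<forall>\<^sub>F t in at_right 0. integrable (measure_pmf \<nu>) (\<lambda>n. (P t u n - u n) / t * v n)"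
      using eventually_at_right_less
      by eventually_elim (intro integrable_pmf_C0 C0_mult C0_divide C0_diff closed C less_imp_le)
    show "integrable (measure_pmf \<nu>) (\<lambda>n. A u n * v n)" by (intro integrable_pmf_C0 C0_mult C)
  qed
  have "\<forall>\<^sub>F t in at_right 0. mean \<nu> (\<lambda>n. (P t f n - f n) / t * g n) = mean \<nu> (\<lambda>n. (P t g n - g n) / t * f n)"
    using eventually_at_right_less
  proof eventually_elim
    fix t :: real assume t: "0 < t"
    have int: "integrable (measure_pmf \<nu>) (\<lambda>n. P t u n * v n)" "integrable (measure_pmf \<nu>) (\<lambda>n. u n * v n)"
      if "u \<in> Cc" "v \<in> Cc" for u v
      by (intro integrable_pmf_C0 C0_mult closed Cc_subset_C0 that less_imp_le[OF t])+
    have "mean \<nu> (\<lambda>n. (P t u n - u n) / t * v n) = (mean \<nu> (\<lambda>n. P t u n * v n) - mean \<nu> (\<lambda>n. u n * v n)) / t"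
      if "u \<in> Cc" "v \<in> Cc" for u v
      using int[OF that] by (simp add: left_diff_distrib diff_divide_distrib)
    then show "mean \<nu> (\<lambda>n. (P t f n - f n) / t * g n) = mean \<nu> (\<lambda>n. (P t g n - g n) / t * f n)"
      using f g sym[of t] t by (simp add: mult.commute)
  qed
  from tendsto_cong[OF this] lim[OF f g]
  have "((\<lambda>t. mean \<nu> (\<lambda>n. (P t g n - g n) / t * f n)) \<longlongrightarrow> mean \<nu> (\<lambda>n. A f n * g n)) (at_right 0)"
    by simp
  from tendsto_unique[OF _ this lim[OF g f]] show ?thesis by (simp add: mult.commute)
qed

text \<open>Cutoffs extend the symmetry to the whole domain of the generator. This is needed for
  orbits \<open>P s f\<close>, which stay in that domain but need not have finite support.\<close>

lemma symmetric_generator: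
  assumes sym: "\<And>f g. f \<in> Cc \<Longrightarrow> g \<in> Cc \<Longrightarrow>
      mean \<nu> (\<lambda>n. A f n * g n) = mean \<nu> (\<lambda>n. f n * A g n)"
    and u: "u \<in> C0" "A u \<in> C0" and v: "v \<in> C0" "A v \<in> C0"
  shows "mean \<nu> (\<lambda>n. A u n * v n) = mean \<nu> (\<lambda>n. u n * A v n)"
proof -
  let ?E = "\<lambda>u v. mean \<nu> (\<lambda>n. u n * v n)"
  let ?u = "\<lambda>N x. cut (Suc N) x * u x" and ?v = "\<lambda>N x. cut (Suc N) x * v x"
  have c: "?u N \<in> Cc" "?v N \<in> Cc" for N by (auto intro!: Cc_mult cut_Cc)
  have C: "?u N \<in> C0" "?v N \<in> C0" "A (?u N) \<in> C0" "A (?v N) \<in> C0" for N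
    using Cc_subset_C0 c generator_C0(2)[OF on_Cc] by auto
  have "(\<lambda>N. ?E (A (?u N)) (?v N)) \<longlonglongrightarrow> ?E (A u) v"
    by (intro mean_uniform_limit uniform_lim_mult cutoff_approx u v C0_bounded_range always_eventually allI
      integrable_pmf_C0 C0_mult C)
  moreover have "(\<lambda>N. ?E (?u N) (A (?v N))) \<longlonglongrightarrow> ?E u (A v)"
    by (intro mean_uniform_limit uniform_lim_mult cutoff_approx u v C0_bounded_range always_eventually allI
      integrable_pmf_C0 C0_mult C)
  ultimately show ?thesis using sym[OF c] by (simp add: LIMSEQ_unique)
qed

text \<open>Moving time from one factor to the other in \<open>N\<close> equal steps costs \<open>o(1/N)\<close> per step.\<close>

lemma symmetric_semigroup:
  assumes sym: "\<And>f g. f \<in> Cc \<Longrightarrow> g \<in> Cc \<Longrightarrow>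
      mean \<nu> (\<lambda>n. A f n * g n) = mean \<nu> (\<lambda>n. f n * A g n)"
    and t: "0 \<le> t" and f: "f \<in> Cc" and g: "g \<in> Cc"
  shows "mean \<nu> (\<lambda>n. P t f n * g n) = mean \<nu> (\<lambda>n. f n * P t g n)"
proof (cases "t = 0")
  case True then show ?thesis using f g by (simp add: at_0 Cc_subset_C0)
next
  case False
  let ?E = "\<lambda>u v. mean \<nu> (\<lambda>n. u n * v n)"
  note gf = on_Cc[OF f] and gg = on_Cc[OF g]
  note C = generator_C0[OF gf] generator_C0[OF gg]
  obtain Bf where Bf: "0 < Bf" "\<And>n. \<bar>f n\<bar> \<le> Bf" using C0_bounded[OF C(1)] by blast
  obtain Bg where Bg: "0 < Bg" "\<And>n. \<bar>g n\<bar> \<le> Bg" using C0_bounded[OF C(3)] by blast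
  let ?D = "?E (P t f) g - ?E f (P t g)"
  have "\<bar>?D\<bar> \<le> 0 + e" if e: "0 < e" for e
  proof -
    \<comment> \<open>\<open>N\<close> steps of length \<open>h\<close> with error
      \<open>h * e' * (Bf + Bg)\<close> each add up to
      \<open>t * e' * (Bf + Bg) = e\<close>.\<close>
    define e' where "e' = e / (t * (Bf + Bg))"
    have e': "0 < e'" using e t False Bf Bg by (simp add: e'_def)
    obtain d1 where d1: "0 < d1" "\<And>h n. 0 < h \<Longrightarrow> h < d1 \<Longrightarrow> \<bar>(P h f n - f n) / h - A f n\<bar> < e'"
      using generatorE[OF gf e'] by metis
    obtain d2 where d2: "0 < d2" "\<And>h n. 0 < h \<Longrightarrow> h < d2 \<Longrightarrow> \<bar>(P h g n - g n) / h - A g n\<bar> < e'"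
      using generatorE[OF gg e'] by metis
    obtain N :: nat where N: "t / min d1 d2 < N" using reals_Archimedean2 by blast
    have mn: "0 < min d1 d2" using d1(1) d2(1) by simp
    have N': "t < min d1 d2 * real N" using N mn by (simp only: pos_divide_less_eq mult.commute)
    have N0: "0 < real N" using N' t mn by (metis mult_zero_right not_less of_nat_0 of_nat_0_less_iff neq0_conv)
    define h where "h = t / N"
    have h: "0 < h" "h < d1" "h < d2" "real N * h = t"
      using N' N0 t False by (auto simp: h_def pos_divide_less_eq min_mult_distrib_right)
    have small: "\<bar>P (s + h) u n - P s u n - h * P s (A u) n\<bar> \<le> h * e'"
      if s: "0 \<le> s" and u: "u \<in> C0" "A u \<in> C0" and near: "\<And>n. \<bar>(P h u n - u n) / h - A u n\<bar> < e'" for s u n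
    proof -
      have "P s (\<lambda>n. (P h u n - u n) / h - A u n) n = (P s (P h u) n - P s u n) / h - P s (A u) n"
        using s u h by (simp add: closed diff divide C0_diff C0_divide)
      then have "P (s + h) u n - P s u n - h * P s (A u) n = h * P s (\<lambda>n. (P h u n - u n) / h - A u n) n"
        unfolding semigroup[OF s less_imp_le[OF h(1)] u(1)] using h by (simp add: field_simps)
      moreover have "\<bar>P s (\<lambda>n. (P h u n - u n) / h - A u n) n\<bar> \<le> e'"
        using s u h less_imp_le[OF near] by (intro contraction C0_diff C0_divide closed) auto
      ultimately show ?thesis using h by (simp add: abs_mult)
    qed
    \<comment> \<open>Interpolates between \<open>T 0\<close>, with all of the time on
      \<open>g\<close>, and \<open>T N\<close>, with all of it on \<open>f\<close>; the first-order
      terms of a step cancel by symmetry of the generator.\<close>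
    define T where "T i = mean \<nu> (\<lambda>n. P (real i * h) f n * P (real (N - i) * h) g n)" for i
    have step: "\<bar>T (Suc i) - T i\<bar> \<le> h * e' * (Bf + Bg)" if i: "i < N" for i
    proof -
      define r where "r = real i * h"
      define s where "s = real (N - Suc i) * h"
      have rs: "0 \<le> r" "0 \<le> s" using h by (auto simp: r_def s_def)
      have r': "real (Suc i) * h = r + h" by (simp add: r_def distrib_right)
      have "real (N - i) = real (N - Suc i) + 1" using i by (simp add: of_nat_diff)
      then have s': "real (N - i) * h = s + h" by (simp only: s_def distrib_right mult_1)
      let ?u = "P r f" and ?v = "P s g"
      let ?x = "\<lambda>n. P (r + h) f n - ?u n - h * P r (A f) n" and ?y = "\<lambda>n. P (s + h) g n - ?v n - h * P s (A g) n"
      have uv: "?u \<in> C0" "?v \<in> C0" "P r (A f) \<in> C0" "P s (A g) \<in> C0" "P (r + h) f \<in> C0" "P (s + h) g \<in> C0"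
        using rs h C by (auto intro!: closed)
      have xy: "?x \<in> C0" "?y \<in> C0" by (intro C0_diff C0_scale uv)+
      note int = integrable_pmf_C0[OF C0_mult]
      have Auv: "A ?u = P r (A f)" "A ?v = P s (A g)" using op_commutes C rs by auto
      have "?E (A ?u) ?v = ?E ?u (A ?v)"
        by (rule symmetric_generator[OF sym]) (simp_all only: Auv uv)
      then have 0: "?E (P r (A f)) ?v = ?E ?u (P s (A g))"
        by (simp only: Auv)
      have "T (Suc i) = mean \<nu> (\<lambda>n. ?u n * ?v n + h * (P r (A f) n * ?v n) + ?x n * ?v n)"
        unfolding T_def r' s_def[symmetric] by (simp add: algebra_simps)
      also have "\<dots> = ?E ?u ?v + h * ?E (P r (A f)) ?v + ?E ?x ?v"
        by (simp only: Bochner_Integration.integral_add Bochner_Integration.integrable_add integral_mult_right_zero integrable_mult_right int uv xy)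
      finally have 1: "T (Suc i) = ?E ?u ?v + h * ?E (P r (A f)) ?v + ?E ?x ?v" .
      have "T i = mean \<nu> (\<lambda>n. ?u n * ?v n + h * (?u n * P s (A g) n) + ?u n * ?y n)"
        unfolding T_def s' r_def[symmetric] by (simp add: algebra_simps)
      also have "\<dots> = ?E ?u ?v + h * ?E ?u (P s (A g)) + ?E ?u ?y"
        by (simp only: Bochner_Integration.integral_add Bochner_Integration.integrable_add integral_mult_right_zero integrable_mult_right int uv xy)
      finally have 2: "T i = ?E ?u ?v + h * ?E ?u (P s (A g)) + ?E ?u ?y" .
      have "\<bar>?E ?x ?v\<bar> \<le> h * e' * Bg"
      proof (intro mean_bound)
        fix n
        have "\<bar>?x n\<bar> \<le> h * e'" by (rule small[OF rs(1) C(1,2) d1(2)[OF h(1,2)]])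
        moreover have "\<bar>?v n\<bar> \<le> Bg" by (rule contraction[OF rs(2) C(3) Bg(2)])
        ultimately show "\<bar>?x n * ?v n\<bar> \<le> h * e' * Bg" unfolding abs_mult using h e' by (intro mult_mono) auto
      qed
      moreover have "\<bar>?E ?u ?y\<bar> \<le> Bf * (h * e')"
      proof (intro mean_bound)
        fix n
        have "\<bar>?y n\<bar> \<le> h * e'" by (rule small[OF rs(2) C(3,4) d2(2)[OF h(1,3)]])
        moreover have "\<bar>?u n\<bar> \<le> Bf" by (rule contraction[OF rs(1) C(1) Bf(2)])
        ultimately show "\<bar>?u n * ?y n\<bar> \<le> Bf * (h * e')" unfolding abs_mult using h e' Bf by (intro mult_mono) auto
      qed
      moreover have "h * e' * (Bf + Bg) = h * e' * Bg + Bf * (h * e')" by (simp add: algebra_simps)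
      ultimately show ?thesis unfolding 1 2 0 by linarith
    qed
    have "\<bar>T i - T 0\<bar> \<le> real i * (h * e' * (Bf + Bg))" if "i \<le> N" for i
      using that
    proof (induction i)
      case (Suc i)
      then show ?case using step[of i] by (simp add: distrib_right)
    qed simp
    from this[of N] have "\<bar>T N - T 0\<bar> \<le> (real N * h) * e' * (Bf + Bg)" by (simp add: mult.assoc)
    also have "\<dots> = e" unfolding h(4) using t False Bf Bg by (simp add: e'_def)
    finally show ?thesis using C by (simp add: T_def h(4) at_0)
  qed
  then have "\<bar>?D\<bar> \<le> 0" by (rule field_le_epsilon)
  then show ?thesis by simp
qed

end

section \<open>Detecting a vanishing jump measure\<close>

context levy_data
begin

text \<open>Three nonnegative terms add up to 0, and \<open>exp_remainder\<close> is positive on the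
  half-line that carries \<mu>.\<close>

lemma rate_zero:
  assumes "rate (Suc j) = 0" shows "m = 0" "s2 = 0" "AE y in \<mu>. False"
proof -
  let ?I = "LINT y|\<mu>. exp_remainder (real (Suc j) * y)"
  have I: "0 \<le> ?I" by (rule integral_exp_remainder_nonneg)
  then have "0 \<le> ?I / real (Suc j)" by simp
  moreover have "0 \<le> s2 * real (Suc j)" using s2_nonneg by simp
  ultimately have *: "m = 0" "s2 * real (Suc j) = 0" "?I / real (Suc j) = 0"
    using assms m_nonneg unfolding rate_def by linarith+
  then show "m = 0" "s2 = 0" by simp_all
  have "?I = 0" using *(3) by simp
  then have "AE y in \<mu>. exp_remainder (real (Suc j) * y) = 0"
    using integral_nonneg_eq_0_iff_AE[OF integrable_exp_remainder[of "Suc j"]] exp_remainder_nonneg by simp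
  with AE_pos show "AE y in \<mu>. False"
  proof eventually_elim
    fix y :: real assume "0 < y" "exp_remainder (real (Suc j) * y) = 0"
    then show False using exp_remainder_pos[of "real (Suc j) * y"] by simp
  qed
qed

lemma measure_null: "AE y in \<mu>. False \<Longrightarrow> measure \<mu> X = 0"
proof -
  assume "AE y in \<mu>. False"
  then have "emeasure \<mu> (space \<mu>) = 0" using AE_iff_measurable[of "space \<mu>" \<mu> "\<lambda>_. False"] by simp
  then have "emeasure \<mu> X = 0" using emeasure_space[of \<mu> X] by (metis le_zero_eq)
  then show ?thesis by (simp add: measure_def)
qed

lemma tail_finite: "0 < c \<Longrightarrow> emeasure \<mu> {c<..} < \<infinity>"
proof -
  assume c: "0 < (c::real)"
  let ?c = "min c (c\<^sup>2)"
  have c': "0 < ?c" using c by simp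
  have "ennreal ?c * emeasure \<mu> {c<..} = (\<integral>\<^sup>+ y. ennreal ?c * indicator {c<..} y \<partial>\<mu>)"
    by (subst nn_integral_cmult_indicator) (auto simp: sets_mu)
  also have "\<dots> \<le> (\<integral>\<^sup>+ y. ennreal (min y (y\<^sup>2)) \<partial>\<mu>)"
  proof (intro nn_integral_mono)
    fix y
    show "ennreal ?c * indicator {c<..} y \<le> ennreal (min y (y\<^sup>2))"
    proof (cases "c < y")
      case True
      then have "?c \<le> min y (y\<^sup>2)" using c by (intro min.mono power_mono) auto
      then have "ennreal ?c \<le> ennreal (min y (y\<^sup>2))" by (rule ennreal_leI)
      then show ?thesis using True by simp
    qed simp
  qed
  also have "\<dots> < \<infinity>" by (rule finite_integral)
  finally show ?thesis using c' by (auto simp: ennreal_mult_less_top ennreal_mult_eq_top_iff top.not_eq_extremum[symmetric])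
qed

lemma sigma_finite_mu: "sigma_finite_measure \<mu>"
proof
  show "\<exists>A. countable A \<and> A \<subseteq> sets \<mu> \<and> \<Union> A = space \<mu> \<and> (\<forall>a\<in>A. emeasure \<mu> a \<noteq> \<infinity>)"
  proof (intro exI[of _ "insert {..0} (range (\<lambda>n. {1 / real (Suc n)<..}))"] conjI)
    show "\<Union> (insert {..0} (range (\<lambda>n. {1 / real (Suc n)<..}))) = space \<mu>"
    proof -
      have "\<exists>n. 1 / real (Suc n) < x" if "0 < x" for x :: real
        using reals_Archimedean[OF that] by (auto simp: inverse_eq_divide)
      then show ?thesis by (auto simp: not_le[symmetric]) (metis not_le)
    qed
    show "\<forall>a\<in>insert {..0} (range (\<lambda>n. {1 / real (Suc n)<..})). emeasure \<mu> a \<noteq> \<infinity>"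
      using tail_finite null_nonpos by (auto simp: less_top[symmetric])
  qed (auto simp: sets_mu)
qed

lemma tail_measurable [measurable]: "(\<lambda>y. emeasure \<mu> {y<..}) \<in> borel_measurable borel"
proof -
  interpret sigma_finite_measure \<mu> by (rule sigma_finite_mu)
  have "(\<lambda>y. \<integral>\<^sup>+ z. indicator {p. fst p < snd p} (y, z) \<partial>\<mu>) \<in> borel_measurable borel"
    by measurable
  moreover have "(\<integral>\<^sup>+ z. indicator {p. fst p < snd p} (y, z) \<partial>\<mu>) = emeasure \<mu> {y<..}" for y :: real
  proof -
    have "(\<integral>\<^sup>+ z. indicator {p. fst p < snd p} (y, z) \<partial>\<mu>) = (\<integral>\<^sup>+ z. indicator {y<..} z \<partial>\<mu>)"
      by (intro nn_integral_cong) (auto simp: indicator_def)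
    then show ?thesis by (simp add: sets_mu)
  qed
  ultimately show ?thesis by simp
qed

text \<open>Tonelli reduces the claim to the integral of \<open>1 - exp (- u y)\<close> over
  \<open>(0,z)\<close>, at most \<open>min 1 (u * z) * z\<close>, which up to the factor
  \<open>1 + u\<close> is dominated by the integrand in the condition on \<mu>.\<close>

lemma tail_integrable:
  assumes u: "0 \<le> u"
  shows "set_integrable lborel {0<..} (\<lambda>y. (1 - exp (- (u * y))) * measure \<mu> {y<..})"
proof -
  interpret mu: sigma_finite_measure \<mu> by (rule sigma_finite_mu)
  interpret pair_sigma_finite lborel \<mu> ..
  let ?w = "\<lambda>y. ennreal (indicator {0<..} y * (1 - exp (- (u * y))))"
  have w0: "0 \<le> indicator {0<..} y * (1 - exp (- (u * y)))" for y :: real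
    using u by (auto simp: indicator_def)
  have eq: "ennreal (indicator {0<..} y * ((1 - exp (- (u * y))) * measure \<mu> {y<..})) = (\<integral>\<^sup>+ z. ?w y * indicator {y<..} z \<partial>\<mu>)" for y
  proof (cases "0 < y")
    case True
    have "emeasure \<mu> {y<..} = ennreal (measure \<mu> {y<..})"
      using tail_finite[OF True] by (intro emeasure_eq_ennreal_measure) (simp add: less_top)
    then show ?thesis
      using w0[of y] True by (subst nn_integral_cmult_indicator) (auto simp: sets_mu ennreal_mult)
  qed simp
  have "(\<integral>\<^sup>+ y. ennreal (indicator {0<..} y * ((1 - exp (- (u * y))) * measure \<mu> {y<..})) \<partial>lborel)
      = (\<integral>\<^sup>+ y. \<integral>\<^sup>+ z. ?w y * indicator {y<..} z \<partial>\<mu> \<partial>lborel)"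
    by (simp only: eq)
  also have "\<dots> = (\<integral>\<^sup>+ z. \<integral>\<^sup>+ y. ?w y * indicator {y<..} z \<partial>lborel \<partial>\<mu>)"
  proof -
    have "(\<lambda>(y, z). ?w y * indicator {y<..} z) \<in> borel_measurable (lborel \<Otimes>\<^sub>M \<mu>)"
    proof -
      have "(\<lambda>p. ?w (fst p) * indicator {p. fst p < snd p} p) \<in> borel_measurable (lborel \<Otimes>\<^sub>M \<mu>)"
        by measurable
      then show ?thesis by (simp add: case_prod_unfold indicator_def)
    qed
    from Fubini[OF this] show ?thesis by simp
  qed
  also have "\<dots> \<le> (\<integral>\<^sup>+ z. ennreal ((1 + u) * min z (z\<^sup>2)) \<partial>\<mu>)"
  proof (rule nn_integral_mono_AE)
    show "AE z in \<mu>. (\<integral>\<^sup>+ y. ?w y * indicator {y<..} z \<partial>lborel) \<le> ennreal ((1 + u) * min z (z\<^sup>2))"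
      using AE_pos
    proof eventually_elim
      fix z :: real assume z: "0 < z"
      have "(\<integral>\<^sup>+ y. ?w y * indicator {y<..} z \<partial>lborel) \<le> (\<integral>\<^sup>+ y. ennreal (min 1 (u * z)) * indicator {0<..<z} y \<partial>lborel)"
      proof (intro nn_integral_mono)
        fix y
        have "1 - exp (- (u * y)) \<le> min 1 (u * z)" if "0 < y" "y < z"
        proof -
          have "u * y \<le> u * z" using u that by (intro mult_left_mono) auto
          then show ?thesis using exp_ge_add_one_self[of "- (u * y)"] by simp
        qed
        then show "?w y * indicator {y<..} z \<le> ennreal (min 1 (u * z)) * indicator {0<..<z} y"
          by (auto simp: indicator_def intro: ennreal_leI)
      qed
      also have "\<dots> = ennreal (min 1 (u * z) * z)"
        using z u by (subst nn_integral_cmult_indicator) (auto simp: ennreal_mult)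
      also have "\<dots> \<le> ennreal ((1 + u) * min z (z\<^sup>2))"
      proof (rule ennreal_leI)
        show "min 1 (u * z) * z \<le> (1 + u) * min z (z\<^sup>2)"
        proof (cases "z \<le> 1")
          case True
          then have "z * z \<le> 1 * z" using z by (intro mult_right_mono) auto
          then have "min z (z\<^sup>2) = z * z" by (simp add: power2_eq_square)
          moreover have "min 1 (u * z) * z \<le> (u * z) * z" using z by (intro mult_right_mono) auto
          moreover have "(u * z) * z \<le> (1 + u) * (z * z)" by (simp add: distrib_right mult.assoc)
          ultimately show ?thesis by (simp only:)
        next
          case False
          then have "1 * z \<le> z * z" by (intro mult_right_mono) auto
          then have "min z (z\<^sup>2) = z" by (simp add: power2_eq_square)
          moreover have "min 1 (u * z) * z \<le> 1 * z" using z by (intro mult_right_mono) auto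
          moreover have "0 \<le> u * z" using u z by simp
          ultimately show ?thesis by (simp add: distrib_right)
        qed
      qed
      finally show "(\<integral>\<^sup>+ y. ?w y * indicator {y<..} z \<partial>lborel) \<le> ennreal ((1 + u) * min z (z\<^sup>2))" .
    qed
  qed
  also have "\<dots> < \<infinity>"
  proof -
    have "integrable \<mu> (\<lambda>z. (1 + u) * min z (z\<^sup>2))" using integrable_min by simp
    moreover have "AE z in \<mu>. 0 \<le> (1 + u) * min z (z\<^sup>2)" using AE_pos u by (auto elim!: eventually_mono)
    ultimately show ?thesis by (simp add: nn_integral_eq_integral)
  qed
  finally have "(\<integral>\<^sup>+ y. ennreal (indicator {0<..} y * ((1 - exp (- (u * y))) * measure \<mu> {y<..})) \<partial>lborel) < \<infinity>" .
  moreover have "0 \<le> indicator {0<..} y * ((1 - exp (- (u * y))) * measure \<mu> {y<..})" for y :: real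
    using u by (auto simp: indicator_def)
  ultimately show ?thesis
    unfolding set_integrable_def measure_def by (intro integrableI_nonneg) (auto simp: measure_def)
qed

text \<open>The coefficients \<open>m'\<close> and \<open>s'\<close> are not assumed to be
  \<open>m\<close> and \<open>s2\<close>. The combination \<open>2 * F 1 - F 2\<close> is 0 for an
  affine \<open>F\<close> with \<open>F 0 = 0\<close>, yet it is the integral of the square
  \<open>(1 - exp (- y))\<^sup>2\<close> against the tail, so the tail vanishes almost
  everywhere.\<close>

lemma affine_imp_null:
  assumes phi: "\<And>u. 0 \<le> u \<Longrightarrow> \<phi> u = m + s2 * u + (LINT y:{0<..}|lborel. (1 - exp (- (u * y))) * measure \<mu> {y<..})"
    and aff: "\<And>u. 0 \<le> u \<Longrightarrow> \<phi> u = m' + s' * u"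
  shows "AE y in \<mu>. False"
proof -
  define F where "F u = (LINT y:{0<..}|lborel. (1 - exp (- (u * y))) * measure \<mu> {y<..})" for u
  have F: "F u = m' - m + (s' - s2) * u" if "0 \<le> u" for u
    using phi[OF that] aff[OF that] by (simp add: F_def algebra_simps)
  have "F 0 = 0" by (simp add: F_def)
  then have "2 * F 1 - F 2 = 0" using F[of 0] F[of 1] F[of 2] by simp
  moreover have "2 * F 1 - F 2 = (LINT y:{0<..}|lborel. (1 - exp (- y))\<^sup>2 * measure \<mu> {y<..})"
  proof -
    have "2 * F 1 - F 2 = (LINT y:{0<..}|lborel. 2 * ((1 - exp (- (1 * y))) * measure \<mu> {y<..}) - (1 - exp (- (2 * y))) * measure \<mu> {y<..})"
      unfolding F_def using tail_integrable[of 1] tail_integrable[of 2] by (simp add: set_integral_diff set_integrable_mult_right)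
    also have "\<dots> = (LINT y:{0<..}|lborel. (1 - exp (- y))\<^sup>2 * measure \<mu> {y<..})"
    proof -
      have "exp (- (2 * y)) = (exp (- y))\<^sup>2" for y :: real
        by (simp add: power2_eq_square exp_add[symmetric])
      then show ?thesis by (simp add: power2_eq_square algebra_simps)
    qed
    finally show ?thesis .
  qed
  moreover have int: "set_integrable lborel {0<..} (\<lambda>y. (1 - exp (- y))\<^sup>2 * measure \<mu> {y<..})"
  proof -
    have "set_integrable lborel {0<..} (\<lambda>y. 2 * ((1 - exp (- (1 * y))) * measure \<mu> {y<..}) - (1 - exp (- (2 * y))) * measure \<mu> {y<..})"
      by (intro set_integral_diff(1) set_integrable_mult_right tail_integrable) auto
    moreover have "2 * ((1 - exp (- (1 * y))) * measure \<mu> {y<..}) - (1 - exp (- (2 * y))) * measure \<mu> {y<..} = (1 - exp (- y))\<^sup>2 * measure \<mu> {y<..}" for y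
    proof -
      have "exp (- (2 * y)) = (exp (- y))\<^sup>2" by (simp add: power2_eq_square exp_add[symmetric])
      then show ?thesis by (simp add: power2_eq_square algebra_simps)
    qed
    ultimately show ?thesis by (simp only:)
  qed
  ultimately have "(LINT y|lborel. indicator {0<..} y *\<^sub>R ((1 - exp (- y))\<^sup>2 * measure \<mu> {y<..})) = 0"
    unfolding set_lebesgue_integral_def by simp
  moreover have "AE y in lborel. 0 \<le> indicator {0<..} y *\<^sub>R ((1 - exp (- y))\<^sup>2 * measure \<mu> {y<..})"
    by (intro always_eventually allI) simp
  ultimately have "AE y in lborel. indicator {0<..} y *\<^sub>R ((1 - exp (- y))\<^sup>2 * measure \<mu> {y<..}) = 0"
    using integral_nonneg_eq_0_iff_AE[OF int[unfolded set_integrable_def]] by simp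
  then have ae: "AE y in lborel. 0 < y \<longrightarrow> measure \<mu> {y<..} = 0"
    by eventually_elim (auto simp: indicator_def)
  have zero: "emeasure \<mu> {c<..} = 0" if c: "0 < c" for c
  proof -
    \<comment> \<open>A tail that vanishes almost everywhere does so at some point below
      \<open>c\<close>, and then at \<open>c\<close> by monotonicity.\<close>
    have "\<exists>y. 0 < y \<and> y < c \<and> measure \<mu> {y<..} = 0"
    proof (rule ccontr)
      assume "\<not> ?thesis"
      then have "AE y in lborel. y \<notin> {0<..<c}" using ae by (auto elim!: eventually_mono)
      then have "{0<..<c} \<in> null_sets lborel" by (subst AE_iff_null_sets) auto
      then show False using c by (simp add: null_sets_def)
    qed
    then obtain y where y: "0 < y" "y < c" "measure \<mu> {y<..} = 0" by blast
    have "emeasure \<mu> {y<..} = 0" using y(3) tail_finite[OF y(1)] by (auto simp: measure_def enn2real_eq_0_iff)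
    moreover have "emeasure \<mu> {c<..} \<le> emeasure \<mu> {y<..}" using y(2) by (intro emeasure_mono) (auto simp: sets_mu)
    ultimately show ?thesis by simp
  qed
  have "AE y in \<mu>. \<forall>n. \<not> 1 / real (Suc n) < y"
    unfolding AE_all_countable
  proof
    fix n
    show "AE y in \<mu>. \<not> 1 / real (Suc n) < y"
      using zero[of "1 / real (Suc n)"] by (intro AE_I[of _ _ "{1 / real (Suc n)<..}"]) (auto simp: sets_mu)
  qed
  with AE_pos show ?thesis
  proof eventually_elim
    fix y :: real assume "0 < y" "\<forall>n. \<not> 1 / real (Suc n) < y"
    then show False using reals_Archimedean[of y] by (auto simp: inverse_eq_divide)
  qed
qed

lemma L_null:
  assumes "AE y in \<mu>. False"
  shows "L f n = (m + s2 * real (n + 1)) * (f (n + 1) - f n) + real n * (s2 + 1) * (f (n - 1) - f n)"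
proof -
  have "(LINT y|\<mu>. jump f n y) = 0" by (rule integral_eq_zero_AE) (use assms in \<open>auto elim: eventually_mono\<close>)
  then show ?thesis unfolding L_eq G_eq death_op_def dplus_def dminus_def by (simp add: algebra_simps)
qed

text \<open>At \<open>n = 2\<close> thinning starts from \<open>n + 1 = 3\<close> individuals and
  reaches 0 when all three are removed; the prefactor is \<open>1 / (n + 1)\<close>. The other terms
  move by one step and do not reach 0 from 2.\<close>

lemma L_downward_two: "L (indicator {0}) 2 = (1 / 3) * (LINT y|\<mu>. (1 - exp (- y)) ^ 3)"
proof -
  have "jump (indicator {0}) 2 = (\<lambda>y. (1 - exp (- y)) ^ 3)"
  proof
    fix y
    have "dil (exp (- y)) (indicator {0}) 3 = (\<Sum>r\<in>{0::nat}. (1 - exp (- y)) ^ 3)"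
      unfolding dil_def by (rule sum.mono_neutral_cong_right) (auto simp: indicator_def)
    then show "jump (indicator {0}) 2 y = (1 - exp (- y)) ^ 3" by (simp add: jump_def dplus_def numeral_eq_Suc)
  qed
  then show ?thesis unfolding L_eq G_eq death_op_def dplus_def dminus_def by simp
qed

end

section \<open>Symmetry of \<open>K\<close> and the jump measure; moments of the invariant law on
  the real line\<close>

context self_similar
begin

sublocale inv: invariant_kernel K K.kernel nu
  using invariant_nu unfolding invariant_distribution_def by unfold_locales (auto intro: K.kernel)

lemma symmetric_imp_null:
  assumes sym: "\<forall>t\<ge>0. \<forall>f\<in>Cc. \<forall>g\<in>Cc. mean nu (\<lambda>n. K t f n * g n) = mean nu (\<lambda>n. f n * K t g n)"
    and pos: "0 < pmf nu 2"
  shows "AE y in \<mu>. False"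
proof -
  let ?f = "indicator {0} :: nat \<Rightarrow> real" and ?g = "indicator {2} :: nat \<Rightarrow> real"
  have c: "?f \<in> Cc" "?g \<in> Cc" by (auto intro!: Cc_indicator)
  have "mean nu (\<lambda>n. L ?f n * ?g n) = mean nu (\<lambda>n. ?f n * L ?g n)"
    using sym c by (intro K.symmetric_op) auto
  moreover have "mean nu (\<lambda>n. L ?f n * ?g n) = (\<Sum>n\<in>{2}. pmf nu n *\<^sub>R (L ?f n * ?g n))"
    by (rule integral_measure_pmf) (auto simp: indicator_def split: if_splits)
  moreover have "(\<lambda>n. ?f n * L ?g n) = (\<lambda>n. 0)"
  proof
    fix n
    \<comment> \<open>From 0 only the states 0 and 1 are visible, so the jump up to 2 has rate
      0.\<close>
    have "L ?g 0 = L (\<lambda>x. 0) 0" by (rule L.local) simp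
    then have "L ?g 0 = 0" by (simp add: L.op_constant)
    then show "?f n * L ?g n = 0" by (cases "n = 0") (simp_all del: indicator_simps add: indicator_def)
  qed
  ultimately have "L ?f 2 = 0" using pos by simp
  then have I: "(LINT y|\<mu>. (1 - exp (- y)) ^ 3) = 0" unfolding L_downward_two by simp
  have int: "integrable \<mu> (\<lambda>y. (1 - exp (- y)) ^ 3)"
  proof (rule Bochner_Integration.integrable_bound[OF integrable_min])
    show "AE y in \<mu>. norm ((1 - exp (- y)) ^ 3) \<le> norm (min y (y\<^sup>2))"
      using AE_pos
    proof eventually_elim
      fix y :: real assume y: "0 < y"
      let ?z = "1 - exp (- y)"
      have z: "0 \<le> ?z" "?z \<le> 1" "?z \<le> y" using y exp_ge_add_one_self[of "- y"] by auto
      have "?z ^ 3 \<le> ?z ^ 1" "?z ^ 3 \<le> ?z ^ 2" using z by (intro power_decreasing; simp)+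
      moreover have "?z ^ 2 \<le> y ^ 2" using z by (intro power_mono)
      ultimately have "?z ^ 3 \<le> y\<^sup>2" "?z ^ 3 \<le> y" using z by (blast intro: order_trans, simp)
      then have "?z ^ 3 \<le> min y (y\<^sup>2)" by simp
      then show "norm (?z ^ 3) \<le> norm (min y (y\<^sup>2))" using z by (simp add: abs_of_nonneg)
    qed
  qed simp
  have nn: "AE y in \<mu>. 0 \<le> (1 - exp (- y)) ^ 3" using AE_pos by (auto elim!: eventually_mono)
  have "AE y in \<mu>. (1 - exp (- y)) ^ 3 = 0"
    using I integral_nonneg_eq_0_iff_AE[OF int nn] by simp
  with AE_pos show ?thesis by eventually_elim simp
qed

text \<open>Invariance tested on the indicator of \<open>{..n}\<close> measures the net flow across
  the edge from \<open>n\<close> to \<open>n + 1\<close>, which gives detailed balance; symmetry is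
  then summation by parts.\<close>

lemma null_imp_symmetric:
  assumes null: "AE y in \<mu>. False" and t: "0 \<le> t" and f: "f \<in> Cc" and g: "g \<in> Cc"
  shows "mean nu (\<lambda>n. K t f n * g n) = mean nu (\<lambda>n. f n * K t g n)"
proof (rule K.symmetric_semigroup[OF _ t f g])
  fix f g :: "nat \<Rightarrow> real" assume f: "f \<in> Cc" and g: "g \<in> Cc"
  define up where "up n = m + s2 * real (n + 1)" for n
  define down where "down n = real n * (s2 + 1)" for n
  have L: "L f n = up n * (f (n + 1) - f n) + down n * (f (n - 1) - f n)" for f n
    unfolding L_null[OF null] up_def down_def ..
  have balance: "pmf nu (Suc n) * down (Suc n) = pmf nu n * up n" for n
  proof -
    let ?h = "indicator {..n} :: nat \<Rightarrow> real"
    have "mean nu (L ?h) = 0"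
      by (rule K.invariant_op[OF inv.invariant]) (auto intro!: Cc_indicator)
    moreover have "mean nu (L ?h) = (\<Sum>k\<in>{n, Suc n}. pmf nu k *\<^sub>R L ?h k)"
    proof (rule integral_measure_pmf)
      fix k assume "L ?h k \<noteq> 0"
      moreover have "L ?h k = 0" if "k < n \<or> Suc n < k" using that by (auto simp: L indicator_def)
      ultimately show "k \<in> {n, Suc n}" by fastforce
    qed simp
    ultimately show ?thesis by (simp add: L indicator_def)
  qed
  obtain N1 where N1: "\<And>n. n \<ge> N1 \<Longrightarrow> f n = 0" using f unfolding Cc_iff by blast
  obtain N2 where N2: "\<And>n. n \<ge> N2 \<Longrightarrow> g n = 0" using g unfolding Cc_iff by blast
  \<comment> \<open>One more than the supports require, so that both functions vanish at
    \<open>N - 1\<close> as well and the boundary term \<open>w (N - 1)\<close> is 0.\<close>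
  define N where "N = Suc (N1 + N2)"
  have z: "f n = 0" "g n = 0" if "n \<ge> N1 + N2" for n using that N1 N2 by auto
  have zN: "f n = 0" "g n = 0" if "N \<le> n" for n using that z[of n] by (auto simp: N_def)
  \<comment> \<open>Boundary term of the summation by parts: a discrete Wronskian weighted by the
    flow from \<open>n\<close> to \<open>n + 1\<close>.\<close>
  define w where "w n = pmf nu n * up n * (g n * f (n + 1) - f n * g (n + 1))" for n
  have tele: "(\<Sum>n<M. pmf nu n * (L f n * g n - f n * L g n)) = (if M = 0 then 0 else w (M - 1))" for M
  proof (induction M)
    case (Suc M)
    have "pmf nu M * (L f M * g M - f M * L g M) = w M - (if M = 0 then 0 else w (M - 1))"
    proof (cases M)
      case 0
      then show ?thesis by (simp add: L w_def down_def algebra_simps)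
    next
      case (Suc k)
      have "pmf nu M * (L f M * g M - f M * L g M) = w M - (pmf nu M * down M) * (g k * f M - f k * g M)"
        unfolding L w_def using Suc by (simp add: algebra_simps)
      also have "pmf nu M * down M = pmf nu k * up k" using balance[of k] Suc by simp
      finally show ?thesis using Suc by (simp add: w_def)
    qed
    then show ?case using Suc by simp
  qed simp
  have sum: "mean nu h = (\<Sum>n<N. pmf nu n * h n)" if "\<And>n. n \<ge> N \<Longrightarrow> h n = 0" for h
    using integral_measure_pmf[of "{..<N}" nu h] that by (auto simp: not_less[symmetric])
  have "mean nu (\<lambda>n. L f n * g n) - mean nu (\<lambda>n. f n * L g n)
      = (\<Sum>n<N. pmf nu n * (L f n * g n)) - (\<Sum>n<N. pmf nu n * (f n * L g n))"
    by (subst (1 2) sum) (simp_all add: zN)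
  also have "\<dots> = w (N - 1)" using tele[of N] by (simp add: N_def right_diff_distrib sum_subtractf)
  also have "\<dots> = 0" unfolding w_def by (simp add: z N_def)
  finally show "mean nu (\<lambda>n. L f n * g n) = mean nu (\<lambda>n. f n * L g n)" by simp
qed

lemma nu_all_moments: "has_all_moments (distr (measure_pmf nu) borel real)"
proof -
  obtain A where "\<And>k. integrable (measure_pmf nu) (\<lambda>x. real x ^ k)" using nu_moments by blast
  then show ?thesis unfolding has_all_moments_def by (simp add: integrable_distr_eq)
qed

lemma nu_moment_determinate: "moment_determinate (distr (measure_pmf nu) borel real)"
proof -
  obtain A where A: "1 \<le> A" "\<And>k. mean nu (\<lambda>x. real x ^ k) \<le> 2 * A ^ k * fact k"
    using nu_moments by metis
  show ?thesis
  proof (rule moment_determinate_factorial_growth[OF _ _ _ _ A(1)])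
    show "prob_space (distr (measure_pmf nu) borel real)" by (rule measure_pmf.prob_space_distr) simp
    show "integrable (distr (measure_pmf nu) borel real) (\<lambda>x. x ^ k)" for k
      using nu_all_moments unfolding has_all_moments_def by blast
    show "(LINT x|distr (measure_pmf nu) borel real. \<bar>x\<bar> ^ k) \<le> 2 * A ^ k * fact k" for k
      using A(2)[of k] by (simp add: integral_distr)
  qed auto
qed

end

lemma invariant_distribution_cong:
  assumes "\<And>t f. 0 \<le> t \<Longrightarrow> f \<in> C0 \<Longrightarrow> P t f = R t f"
  shows "invariant_distribution P = invariant_distribution R"
  unfolding invariant_distribution_def using assms by auto

lemma l2_extension_cong:
  assumes "\<And>t f. 0 \<le> t \<Longrightarrow> f \<in> C0 \<Longrightarrow> P t f = R t f"
  shows "l2_extension \<nu> P = l2_extension \<nu> R"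
proof -
  have "(\<forall>t\<ge>0. \<forall>f\<in>C0. \<forall>n\<in>set_pmf \<nu>. E t f n = P t f n) \<longleftrightarrow> (\<forall>t\<ge>0. \<forall>f\<in>C0. \<forall>n\<in>set_pmf \<nu>. E t f n = R t f n)" for E
    using assms by auto
  then show ?thesis unfolding l2_extension_def by (intro ext) (simp only:)
qed

text \<open>Positivity is conditional on \<phi> not vanishing identically: for \<phi> = 0 the
  semigroup is pure death and its invariant law is the point mass at 0. The clauses hold for every
  semigroup with the given generator and every Hilbert space extension, whose existence is stated
  separately.\<close>

theorem theorem2p8:
  fixes \<phi> :: "real \<Rightarrow> real" and m s2 :: real and \<mu> :: "real measure"
    and Q :: "real \<Rightarrow> (nat \<Rightarrow> real) \<Rightarrow> nat \<Rightarrow> real"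
  assumes phi: "bernstein_rep \<phi> m s2 \<mu>"
    and Q_feller: "feller_semigroup Q"
    and Q_gen: "generates (GG m s2 \<mu>) Cc Q"
  shows "(\<exists>K. feller_markov_semigroup K \<and> generates (LL m s2 \<mu>) Cc K) \<and>
    (\<forall>K. feller_markov_semigroup K \<and> generates (LL m s2 \<mu>) Cc K \<longrightarrow>
      (\<forall>f\<in>C0. \<forall>t\<ge>0. K t f = Q (exp t - 1) (dil (exp (- t)) f)) \<and>
      (\<exists>\<nu>. invariant_distribution K \<nu> \<and>
        (\<forall>\<nu>'. invariant_distribution K \<nu>' \<longrightarrow> \<nu>' = \<nu>) \<and>
        ((\<exists>u\<ge>0. \<phi> u \<noteq> 0) \<longrightarrow> (\<forall>n. pmf \<nu> n > 0)) \<and>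
        has_all_moments (distr (measure_pmf \<nu>) borel real) \<and>
        moment_determinate (distr (measure_pmf \<nu>) borel real) \<and>
        (\<exists>E. l2_extension \<nu> K E) \<and>
        (\<forall>E. l2_extension \<nu> K E \<longrightarrow>
          (l2_selfadjoint \<nu> E \<longleftrightarrow>
            (\<exists>m'\<ge>0. \<exists>s'\<ge>0. \<forall>u\<ge>0. \<phi> u = m' + s' * u)))))"
proof -
  interpret self_similar m s2 \<mu> Q
    using phi Q_feller Q_gen unfolding bernstein_rep_def by unfold_locales auto
  have rep: "\<phi> u = m + s2 * u + (LINT y:{0<..}|lborel. (1 - exp (- (u * y))) * measure \<mu> {y<..})" if "0 \<le> u" for u
    using phi that unfolding bernstein_rep_def by blast
  have null_phi: "\<phi> u = m + s2 * u" if "AE y in \<mu>. False" "0 \<le> u" for u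
    using rep[OF that(2)] measure_null[OF that(1)] by simp
  have pos: "0 < pmf nu n" if "\<exists>u\<ge>0. \<phi> u \<noteq> 0" for n
  proof (rule nu_pos, rule ccontr)
    fix j assume "\<not> 0 < rate (Suc j)"
    then have z: "rate (Suc j) = 0" using rate_nonneg[of "Suc j"] by simp
    have "\<phi> u = 0" if "0 \<le> u" for u using null_phi[OF rate_zero(3)[OF z] that] rate_zero(1,2)[OF z] by simp
    then show False using \<open>\<exists>u\<ge>0. \<phi> u \<noteq> 0\<close> by blast
  qed
  have sym: "l2_selfadjoint nu E \<longleftrightarrow> (\<exists>m'\<ge>0. \<exists>s'\<ge>0. \<forall>u\<ge>0. \<phi> u = m' + s' * u)" if E: "l2_extension nu K E" for E
  proof
    assume "l2_selfadjoint nu E"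
    then have S: "\<forall>t\<ge>0. \<forall>f\<in>Cc. \<forall>g\<in>Cc. mean nu (\<lambda>n. K t f n * g n) = mean nu (\<lambda>n. f n * K t g n)"
      unfolding inv.selfadjoint_iff[OF E] .
    show "\<exists>m'\<ge>0. \<exists>s'\<ge>0. \<forall>u\<ge>0. \<phi> u = m' + s' * u"
    \<comment> \<open>Comparing the states 0 and 2 needs positive mass at 2, hence \<phi> not
      identically 0; otherwise \<phi> is affine with both coefficients 0.\<close>
    proof (cases "\<exists>u\<ge>0. \<phi> u \<noteq> 0")
      case True
      then have "AE y in \<mu>. False" by (intro symmetric_imp_null[OF S] pos)
      then show ?thesis using null_phi m_nonneg s2_nonneg by blast
    next
      case False
      then show ?thesis by (intro exI[of _ 0]) auto
    qed
  next
    assume "\<exists>m'\<ge>0. \<exists>s'\<ge>0. \<forall>u\<ge>0. \<phi> u = m' + s' * u"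
    then obtain m' s' where "\<And>u. 0 \<le> u \<Longrightarrow> \<phi> u = m' + s' * u" by blast
    then have "AE y in \<mu>. False" using rep by (intro affine_imp_null) auto
    then show "l2_selfadjoint nu E" unfolding inv.selfadjoint_iff[OF E] using null_imp_symmetric by blast
  qed
  show ?thesis
  proof (intro conjI allI impI)
    show "\<exists>K. feller_markov_semigroup K \<and> generates L Cc K"
      using K.feller_markov K.generates_op by blast
    fix K' assume K': "feller_markov_semigroup K' \<and> generates L Cc K'"
    \<comment> \<open>Any semigroup generated by \<open>L\<close> falls under the uniqueness lemma,
      so what is proved for \<open>K\<close> transfers to it.\<close>
    interpret K': rate_semigroup L "rate 1" "2 * rate 2 + rate 1 + 1" K'
      using K' unfolding feller_markov_semigroup_def generates_def by unfold_locales auto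
    have eq: "K' t f = K t f" if "0 \<le> t" "f \<in> C0" for t f
      by (rule K'.unique[OF K.rate_semigroup_axioms that])
    show "\<forall>f\<in>C0. \<forall>t\<ge>0. K' t f = Q (exp t - 1) (dil (exp (- t)) f)"
      using eq by (simp add: K_def)
    show "\<exists>\<nu>. invariant_distribution K' \<nu> \<and>
        (\<forall>\<nu>'. invariant_distribution K' \<nu>' \<longrightarrow> \<nu>' = \<nu>) \<and>
        ((\<exists>u\<ge>0. \<phi> u \<noteq> 0) \<longrightarrow> (\<forall>n. pmf \<nu> n > 0)) \<and>
        has_all_moments (distr (measure_pmf \<nu>) borel real) \<and>
        moment_determinate (distr (measure_pmf \<nu>) borel real) \<and>
        (\<exists>E. l2_extension \<nu> K' E) \<and>
        (\<forall>E. l2_extension \<nu> K' E \<longrightarrow>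
          (l2_selfadjoint \<nu> E \<longleftrightarrow>
            (\<exists>m'\<ge>0. \<exists>s'\<ge>0. \<forall>u\<ge>0. \<phi> u = m' + s' * u)))"
    proof (intro exI[of _ nu] conjI allI impI)
      have inv: "invariant_distribution K' = invariant_distribution K"
        by (rule invariant_distribution_cong) (rule eq)
      have ext: "l2_extension nu K' = l2_extension nu K"
        by (rule l2_extension_cong) (rule eq)
      show "invariant_distribution K' nu" unfolding inv by (rule invariant_nu)
      show "\<nu>' = nu" if "invariant_distribution K' \<nu>'" for \<nu>'
        using that unfolding inv by (rule invariant_unique)
      show "0 < pmf nu n" if "\<exists>u\<ge>0. \<phi> u \<noteq> 0" for n using that by (rule pos)
      show "has_all_moments (distr (measure_pmf nu) borel real)" by (rule nu_all_moments)
      show "moment_determinate (distr (measure_pmf nu) borel real)" by (rule nu_moment_determinate)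
      show "\<exists>E. l2_extension nu K' E" unfolding ext using inv.l2_extension_ext by blast
      show "l2_selfadjoint nu E \<longleftrightarrow> (\<exists>m'\<ge>0. \<exists>s'\<ge>0. \<forall>u\<ge>0. \<phi> u = m' + s' * u)"
        if "l2_extension nu K' E" for E
        using that unfolding ext by (rule sym)
    qed
  qed
qed

end
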